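(* Let $\mathcal{A}$ be the abelian category of all small $R$-modules, where $R=\mathbb{Z}[I]$ is the polynomial ring freely generated by the class $I$ of all small ordinals, and let $\mathbf{A}(\mathcal{A})$ be the triangulated category of acyclic chain complexes in $\mathcal{A}$, a full subcategory of the homotopy category $\mathbf{K}(\mathcal{A})$ of chain complexes in $\mathcal{A}$. Then neither the category $\mathbf{A}(\mathcal{A})$ nor its dual $\mathbf{A}(\mathcal{A})^{\mathrm{op}}$ satisfies Brown representability.
   Context: Foundations are those of Mac Lane (Categories for the Working Mathematician, I.6): a universe $U$ is fixed, a set is small if it is an element of $U$, and classes are subsets of $U$. Let $I$ be the class of all small ordinals and let $R=\mathbb{Z}[I]$ be the (commutative) polynomial ring over $\mathbb{Z}$ freely generated by $I$. The category $\mathcal{A}$ is the abelian category of all small $R$-modules: an object is a small abelian group $M$ together with group endomorphisms $\varphi_i\colon M\to M$ for every $i\in I$, such that all the $\varphi_i$ commute with one another; morphisms are the $R$-module homomorphisms, i.e. the group homomorphisms commuting with all $\varphi_i$. $\mathbf{K}(\mathcal{A})$ has as objects the (unbounded) chain complexes in $\mathcal{A}$ and as morphisms the chain homotopy classes of chain maps; $\mathbf{A}(\mathcal{A})\subset\mathbf{K}(\mathcal{A})$ is the full subcategory of acyclic complexes. Both are triangulated categories with small $\operatorname{Hom}$-sets. $\mathbf{K}(\mathcal{A})$ has small products and coproducts, and $\mathbf{A}(\mathcal{A})$ is closed under both in $\mathbf{K}(\mathcal{A})$, so $\mathbf{A}(\mathcal{A})$ has small products and coproducts as well. Let $\mathcal{A}b$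 denote the category of small abelian groups. A functor from a triangulated category to $\mathcal{A}b$ is called homological if it takes triangles to long exact sequences. A triangulated category $\mathcal{T}$ satisfies Brown representability if it has small coproducts and every homological functor $H\colon\mathcal{T}^{\mathrm{op}}\to\mathcal{A}b$ that takes products to products (i.e. takes small coproducts in $\mathcal{T}$ to products in $\mathcal{A}b$) is representable, meaning that there is an object $A$ in $\mathcal{T}$ such that $H$ is naturally isomorphic to $\operatorname{Hom}_{\mathcal{T}}(-,A)$. *)

theory Defs
  imports "HOL-Algebra.Module" "HOL-Algebra.Exact_Sequence" "HOL-Algebra.Product_Groups" "HOL-Library.Poly_Mapping"
begin

section \<open>The universe\<close>

text \<open>
  A universe in the sense of Mac Lane (I.6): the universe \<open>U\<close> is the type itself, its elements are
  the small sets, and classes are subsets of \<open>U\<close>, i.e. terms of type \<open>'u set\<close>.  The set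
  \<open>elts x\<close> is the extension of the small set \<open>x\<close>.  Transitivity of \<open>U\<close> is built into the type of
  \<open>elts\<close>; replacement ranges over arbitrary functions of the ambient logic, and
  together with the empty set (which is part of the infinity axiom) it yields that every subset of
  a small set is small.  Since HOL does not prove that such a type exists, the sort constraint
  is the hypothesis that a universe has been fixed.
\<close>

class universe =
  fixes elts :: "'a \<Rightarrow> 'a set"
  assumes extensionality: "elts x = elts y \<Longrightarrow> x = y"
    and foundation: "wf {(x, y). x \<in> elts y}"
    and pairing: "\<exists>z. elts z = {x, y}"
    and union: "\<exists>z. elts z = (\<Union>y\<in>elts x. elts y)"
    and powerset: "\<exists>z. elts z = {y. elts y \<subseteq> elts x}"
    and infinity: "\<exists>w. (\<exists>z\<in>elts w. elts z = {}) \<and>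
                       (\<forall>n\<in>elts w. \<exists>s\<in>elts w. elts s = insert n (elts n))"
    and replacement: "\<exists>z. elts z = f ` elts x"

definition small :: "'u::universe set \<Rightarrow> bool" where
  "small S \<longleftrightarrow> (\<exists>x. elts x = S)"

definition set_of_class :: "'u::universe set \<Rightarrow> 'u" where
  "set_of_class S = (THE x. elts x = S)"

text \<open>Kuratowski pairs and their projections.\<close>

definition vpair :: "'u::universe \<Rightarrow> 'u \<Rightarrow> 'u" where
  "vpair x y = set_of_class {set_of_class {x}, set_of_class {x, y}}"

definition vfst :: "'u::universe \<Rightarrow> 'u" where
  "vfst p = (THE x. \<exists>y. p = vpair x y)"

definition vsnd :: "'u::universe \<Rightarrow> 'u" where
  "vsnd p = (THE y. \<exists>x. p = vpair x y)"

text \<open>Von Neumann ordinals: transitive sets of transitive sets.\<close>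

definition transitive_set :: "'u::universe \<Rightarrow> bool" where
  "transitive_set x \<longleftrightarrow> (\<forall>y\<in>elts x. elts y \<subseteq> elts x)"

typedef (overloaded) 'u ordinal =
  "{\<alpha>::'u::universe. transitive_set \<alpha> \<and> (\<forall>\<beta>\<in>elts \<alpha>. transitive_set \<beta>)}"
proof -
  obtain z :: 'u where "elts z = {}"
    using infinity by blast
  then show ?thesis
    by (auto simp: transitive_set_def)
qed


section \<open>Small modules over the polynomial ring on all small ordinals\<close>

text \<open>
  A monomial is a finitely supported function from the variables to the exponents, a polynomial is a
  finitely supported function from the monomials to the coefficients.
\<close>

type_synonym 'u big_poly = "('u ordinal \<Rightarrow>\<^sub>0 nat) \<Rightarrow>\<^sub>0 int"

definition big_ring :: "'u::universe big_poly ring" where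
  "big_ring = \<lparr>carrier = UNIV, mult = (*), one = 1, zero = 0, add = (+)\<rparr>"

type_synonym 'u big_module = "('u big_poly, 'u) module"

definition small_module :: "'u::universe big_module \<Rightarrow> bool" where
  "small_module M \<longleftrightarrow> module big_ring M \<and> small (carrier M)"

definition module_hom :: "'u::universe big_module \<Rightarrow> 'u big_module \<Rightarrow> ('u \<Rightarrow> 'u) set" where
  "module_hom M N = {h. h \<in> carrier M \<rightarrow> carrier N \<and>
     (\<forall>x\<in>carrier M. \<forall>y\<in>carrier M. h (x \<oplus>\<^bsub>M\<^esub> y) = h x \<oplus>\<^bsub>N\<^esub> h y) \<and>
     (\<forall>r. \<forall>x\<in>carrier M. h (r \<odot>\<^bsub>M\<^esub> x) = r \<odot>\<^bsub>N\<^esub> h x)}"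

text \<open>The fields \<open>mult\<close> and \<open>one\<close> of a module record carry no meaning.\<close>

definition direct_sum :: "'u::universe big_module \<Rightarrow> 'u big_module \<Rightarrow> 'u big_module" where
  "direct_sum M N =
     \<lparr>carrier = {vpair x y | x y. x \<in> carrier M \<and> y \<in> carrier N},
      mult = undefined, one = undefined,
      zero = vpair \<zero>\<^bsub>M\<^esub> \<zero>\<^bsub>N\<^esub>,
      add = (\<lambda>p q. vpair (vfst p \<oplus>\<^bsub>M\<^esub> vfst q) (vsnd p \<oplus>\<^bsub>N\<^esub> vsnd q)),
      smult = (\<lambda>r p. vpair (r \<odot>\<^bsub>M\<^esub> vfst p) (r \<odot>\<^bsub>N\<^esub> vsnd p))\<rparr>"


section \<open>Triangulated categories and Brown representability\<close>

text \<open>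
  The data of a triangulated category with objects in \<open>'o\<close> and morphisms in \<open>'m\<close>:
  the abelian group of morphisms \<open>X \<rightarrow> Y\<close> is \<open>Hom X Y\<close> (written multiplicatively, as the
  commutative groups of \<open>HOL-Algebra\<close> are), \<open>Comp X Y Z g f\<close> is the composite of
  \<open>f: X \<rightarrow> Y\<close> and \<open>g: Y \<rightarrow> Z\<close>, \<open>Shift n\<close> and \<open>ShiftHom n\<close> give the \<open>n\<close>-th power of the
  suspension automorphism (so that \<open>Shift m (Shift n X) = Shift (m + n) X\<close> on objects), and
  \<open>(X, Y, Z, u, v, w) \<in> Triangles\<close> says that \<open>X \<rightarrow> Y \<rightarrow> Z \<rightarrow> Shift 1 X\<close> is a distinguished triangle.
\<close>

record ('o, 'm) tricat =
  Ob :: "'o set"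
  Hom :: "'o \<Rightarrow> 'o \<Rightarrow> 'm monoid"
  Id :: "'o \<Rightarrow> 'm"
  Comp :: "'o \<Rightarrow> 'o \<Rightarrow> 'o \<Rightarrow> 'm \<Rightarrow> 'm \<Rightarrow> 'm"
  Shift :: "int \<Rightarrow> 'o \<Rightarrow> 'o"
  ShiftHom :: "int \<Rightarrow> 'o \<Rightarrow> 'o \<Rightarrow> 'm \<Rightarrow> 'm"
  Triangles :: "('o \<times> 'o \<times> 'o \<times> 'm \<times> 'm \<times> 'm) set"

text \<open>
  The suspension of the dual is the desuspension, and
  \<open>X \<rightarrow> Y \<rightarrow> Z \<rightarrow> Shift (-1) X\<close> is a triangle of the dual iff, read backwards, it is a triangle
  \<open>Shift (-1) X \<rightarrow> Z \<rightarrow> Y \<rightarrow> X\<close> of the original category.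
\<close>

definition dual :: "('o, 'm) tricat \<Rightarrow> ('o, 'm) tricat" where
  "dual T =
     \<lparr>Ob = Ob T,
      Hom = (\<lambda>X Y. Hom T Y X),
      Id = Id T,
      Comp = (\<lambda>X Y Z g f. Comp T Z Y X f g),
      Shift = (\<lambda>n. Shift T (- n)),
      ShiftHom = (\<lambda>n X Y. ShiftHom T (- n) Y X),
      Triangles = {(X, Y, Z, u, v, w). X \<in> Ob T \<and> Y \<in> Ob T \<and> Z \<in> Ob T \<and>
        (Shift T (- 1) X, Z, Y, w, v, u) \<in> Triangles T}\<rparr>"

definition full_subcategory :: "('o, 'm) tricat \<Rightarrow> ('o \<Rightarrow> bool) \<Rightarrow> ('o, 'm) tricat" where
  "full_subcategory T P =
     T\<lparr>Ob := {X \<in> Ob T. P X},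
       Triangles := {(X, Y, Z, u, v, w) \<in> Triangles T. P X \<and> P Y \<and> P Z}\<rparr>"

definition is_isomorphism :: "('o, 'm) tricat \<Rightarrow> 'o \<Rightarrow> 'o \<Rightarrow> 'm \<Rightarrow> bool" where
  "is_isomorphism T X Y f \<longleftrightarrow> f \<in> carrier (Hom T X Y) \<and>
     (\<exists>g\<in>carrier (Hom T Y X). Comp T X Y X g f = Id T X \<and> Comp T Y X Y f g = Id T Y)"

definition is_coproduct ::
  "('o, 'm) tricat \<Rightarrow> 'i set \<Rightarrow> ('i \<Rightarrow> 'o) \<Rightarrow> 'o \<Rightarrow> ('i \<Rightarrow> 'm) \<Rightarrow> bool" where
  "is_coproduct T J X C \<iota> \<longleftrightarrow>
     C \<in> Ob T \<and> (\<forall>j\<in>J. \<iota> j \<in> carrier (Hom T (X j) C)) \<and>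
     (\<forall>Y\<in>Ob T. \<forall>f. (\<forall>j\<in>J. f j \<in> carrier (Hom T (X j) Y)) \<longrightarrow>
        (\<exists>!g. g \<in> carrier (Hom T C Y) \<and> (\<forall>j\<in>J. Comp T (X j) C Y g (\<iota> j) = f j)))"

definition has_small_coproducts :: "'u::universe itself \<Rightarrow> ('o, 'm) tricat \<Rightarrow> bool" where
  "has_small_coproducts TYPE('u) T \<longleftrightarrow>
     (\<forall>(J::'u set) X. small J \<and> X ` J \<subseteq> Ob T \<longrightarrow> (\<exists>C \<iota>. is_coproduct T J X C \<iota>))"

text \<open>
  Functors \<open>T\<^sup>o\<^sup>p \<rightarrow> Ab\<close> into the category of small abelian groups: \<open>H\<close> is the
  action on objects, and \<open>h X Y f\<close> is the homomorphism \<open>H Y \<rightarrow> H X\<close> induced by \<open>f: X \<rightarrow> Y\<close>.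
\<close>

definition cofunctor_to_Ab ::
  "('o, 'm) tricat \<Rightarrow> ('o \<Rightarrow> 'u::universe monoid) \<Rightarrow> ('o \<Rightarrow> 'o \<Rightarrow> 'm \<Rightarrow> 'u \<Rightarrow> 'u) \<Rightarrow> bool" where
  "cofunctor_to_Ab T H h \<longleftrightarrow>
     (\<forall>X\<in>Ob T. comm_group (H X) \<and> small (carrier (H X))) \<and>
     (\<forall>X\<in>Ob T. \<forall>Y\<in>Ob T. \<forall>f\<in>carrier (Hom T X Y). h X Y f \<in> hom (H Y) (H X)) \<and>
     (\<forall>X\<in>Ob T. \<forall>x\<in>carrier (H X). h X X (Id T X) x = x) \<and>
     (\<forall>X\<in>Ob T. \<forall>Y\<in>Ob T. \<forall>Z\<in>Ob T.
        \<forall>f\<in>carrier (Hom T X Y). \<forall>g\<in>carrier (Hom T Y Z). \<forall>z\<in>carrier (H Z).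
          h X Z (Comp T X Y Z g f) z = h X Y f (h Y Z g z))"

text \<open>
  The five-term exact sequences below, for all \<open>n\<close>, are the overlapping segments of the long
  exact sequence of a triangle; \<open>exact_seq\<close> lists groups and maps from the last to the first.
\<close>

definition homological ::
  "('o, 'm) tricat \<Rightarrow> ('o \<Rightarrow> 'u::universe monoid) \<Rightarrow> ('o \<Rightarrow> 'o \<Rightarrow> 'm \<Rightarrow> 'u \<Rightarrow> 'u) \<Rightarrow> bool" where
  "homological T H h \<longleftrightarrow>
     (\<forall>(X, Y, Z, u, v, w) \<in> Triangles T. \<forall>n.
        let S = Shift T n; \<Sigma> = Shift T 1 in
        exact_seq
          ([H (S X), H (S Y), H (S Z), H (S (\<Sigma> X)), H (S (\<Sigma> Y))],
           [h (S X) (S Y) (ShiftHom T n X Y u),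
            h (S Y) (S Z) (ShiftHom T n Y Z v),
            h (S Z) (S (\<Sigma> X)) (ShiftHom T n Z (\<Sigma> X) w),
            h (S (\<Sigma> X)) (S (\<Sigma> Y)) (ShiftHom T n (\<Sigma> X) (\<Sigma> Y) (ShiftHom T 1 X Y u))]))"

definition coproducts_to_products ::
  "('o, 'm) tricat \<Rightarrow> ('o \<Rightarrow> 'u::universe monoid) \<Rightarrow> ('o \<Rightarrow> 'o \<Rightarrow> 'm \<Rightarrow> 'u \<Rightarrow> 'u) \<Rightarrow> bool" where
  "coproducts_to_products T H h \<longleftrightarrow>
     (\<forall>(J::'u set) X C \<iota>. small J \<and> X ` J \<subseteq> Ob T \<and> is_coproduct T J X C \<iota> \<longrightarrow>
        (\<lambda>x. \<lambda>j\<in>J. h (X j) C (\<iota> j) x) \<in> iso (H C) (product_group J (\<lambda>j. H (X j))))"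

definition representable ::
  "('o, 'm) tricat \<Rightarrow> ('o \<Rightarrow> 'u::universe monoid) \<Rightarrow> ('o \<Rightarrow> 'o \<Rightarrow> 'm \<Rightarrow> 'u \<Rightarrow> 'u) \<Rightarrow> bool" where
  "representable T H h \<longleftrightarrow>
     (\<exists>A\<in>Ob T. \<exists>\<eta>.
        (\<forall>X\<in>Ob T. \<eta> X \<in> iso (H X) (Hom T X A)) \<and>
        (\<forall>X\<in>Ob T. \<forall>Y\<in>Ob T. \<forall>f\<in>carrier (Hom T X Y). \<forall>y\<in>carrier (H Y).
           \<eta> X (h X Y f y) = Comp T X Y A (\<eta> Y y) f))"

definition Brown_representability :: "'u::universe itself \<Rightarrow> ('o, 'm) tricat \<Rightarrow> bool" where
  "Brown_representability TYPE('u) T \<longleftrightarrow>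
     has_small_coproducts TYPE('u) T \<and>
     (\<forall>(H :: 'o \<Rightarrow> 'u monoid) h.
        cofunctor_to_Ab T H h \<and> homological T H h \<and> coproducts_to_products T H h
        \<longrightarrow> representable T H h)"


section \<open>The homotopy category and its subcategory of acyclic complexes\<close>

record (overloaded) 'u chain_complex =
  cmod :: "int \<Rightarrow> 'u big_module"
  cdiff :: "int \<Rightarrow> 'u \<Rightarrow> 'u"

text \<open>
  The differential \<open>cdiff X k\<close> goes from degree \<open>k\<close> to degree \<open>k - 1\<close>.  It is required to be
  \<open>extensional\<close>, i.e. determined by its values on the module, so that shifting is strictly invertible.
\<close>

definition chain_complexes :: "'u::universe chain_complex set" where
  "chain_complexes = {X. \<forall>k. small_module (cmod X k) \<and>
     cdiff X k \<in> module_hom (cmod X k) (cmod X (k - 1)) \<inter> extensional (carrier (cmod X k)) \<and>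
     (\<forall>x\<in>carrier (cmod X k). cdiff X (k - 1) (cdiff X k x) = \<zero>\<^bsub>cmod X (k - 2)\<^esub>)}"

definition acyclic_complex :: "'u::universe chain_complex \<Rightarrow> bool" where
  "acyclic_complex X \<longleftrightarrow> (\<forall>k.
     {x \<in> carrier (cmod X k). cdiff X k x = \<zero>\<^bsub>cmod X (k - 1)\<^esub>} =
     cdiff X (k + 1) ` carrier (cmod X (k + 1)))"

definition chain_maps ::
  "'u::universe chain_complex \<Rightarrow> 'u chain_complex \<Rightarrow> (int \<Rightarrow> 'u \<Rightarrow> 'u) set" where
  "chain_maps X Y = {f. \<forall>k. f k \<in> module_hom (cmod X k) (cmod Y k) \<and>
     (\<forall>x\<in>carrier (cmod X k). cdiff Y k (f k x) = f (k - 1) (cdiff X k x))}"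

definition chain_homotopic ::
  "'u::universe chain_complex \<Rightarrow> 'u chain_complex \<Rightarrow> (int \<Rightarrow> 'u \<Rightarrow> 'u) \<Rightarrow> (int \<Rightarrow> 'u \<Rightarrow> 'u) \<Rightarrow> bool"
where
  "chain_homotopic X Y f g \<longleftrightarrow>
     (\<exists>s. \<forall>k. s k \<in> module_hom (cmod X k) (cmod Y (k + 1)) \<and>
        (\<forall>x\<in>carrier (cmod X k).
           f k x \<ominus>\<^bsub>cmod Y k\<^esub> g k x =
           cdiff Y (k + 1) (s k x) \<oplus>\<^bsub>cmod Y k\<^esub> s (k - 1) (cdiff X k x)))"

text \<open>
  The values of a chain map outside the modules are irrelevant: two chain maps that agree on the
  modules are homotopic, hence give the same homotopy class.
\<close>

definition homotopy_class ::
  "'u::universe chain_complex \<Rightarrow> 'u chain_complex \<Rightarrow> (int \<Rightarrow> 'u \<Rightarrow> 'u) \<Rightarrow> (int \<Rightarrow> 'u \<Rightarrow> 'u) set" where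
  "homotopy_class X Y f = {g \<in> chain_maps X Y. chain_homotopic X Y f g}"

type_synonym 'u hclass = "(int \<Rightarrow> 'u \<Rightarrow> 'u) set"

definition K_Hom :: "'u::universe chain_complex \<Rightarrow> 'u chain_complex \<Rightarrow> 'u hclass monoid" where
  "K_Hom X Y =
     \<lparr>carrier = homotopy_class X Y ` chain_maps X Y,
      mult = (\<lambda>F G. \<Union>f\<in>F. \<Union>g\<in>G. homotopy_class X Y (\<lambda>k x. f k x \<oplus>\<^bsub>cmod Y k\<^esub> g k x)),
      one = homotopy_class X Y (\<lambda>k x. \<zero>\<^bsub>cmod Y k\<^esub>)\<rparr>"

definition K_Id :: "'u::universe chain_complex \<Rightarrow> 'u hclass" where
  "K_Id X = homotopy_class X X (\<lambda>k x. x)"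

definition K_Comp ::
  "'u::universe chain_complex \<Rightarrow> 'u chain_complex \<Rightarrow> 'u chain_complex
     \<Rightarrow> 'u hclass \<Rightarrow> 'u hclass \<Rightarrow> 'u hclass" where
  "K_Comp X Y Z G F = (\<Union>g\<in>G. \<Union>f\<in>F. homotopy_class X Z (\<lambda>k. g k \<circ> f k))"

definition shift_complex :: "int \<Rightarrow> 'u::universe chain_complex \<Rightarrow> 'u chain_complex" where
  "shift_complex n X =
     \<lparr>cmod = (\<lambda>k. cmod X (k - n)),
      cdiff = (\<lambda>k. \<lambda>x\<in>carrier (cmod X (k - n)).
        if even n then cdiff X (k - n) x
        else \<ominus>\<^bsub>cmod X (k - n - 1)\<^esub> cdiff X (k - n) x)\<rparr>"

definition K_ShiftHom ::
  "int \<Rightarrow> 'u::universe chain_complex \<Rightarrow> 'u chain_complex \<Rightarrow> 'u hclass \<Rightarrow> 'u hclass" where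
  "K_ShiftHom n X Y F =
     (\<Union>f\<in>F. homotopy_class (shift_complex n X) (shift_complex n Y) (\<lambda>k. f (k - n)))"

text \<open>
  The mapping cone of \<open>f: X \<rightarrow> Y\<close> is \<open>Y\<^sub>k \<oplus> X\<^sub>k\<^sub>-\<^sub>1\<close> in degree \<open>k\<close>, with differential
  \<open>(y, x) \<mapsto> (d y + f x, - d x)\<close>.
\<close>

definition mapping_cone ::
  "'u::universe chain_complex \<Rightarrow> 'u chain_complex \<Rightarrow> (int \<Rightarrow> 'u \<Rightarrow> 'u) \<Rightarrow> 'u chain_complex" where
  "mapping_cone X Y f =
     \<lparr>cmod = (\<lambda>k. direct_sum (cmod Y k) (cmod X (k - 1))),
      cdiff = (\<lambda>k. \<lambda>p\<in>carrier (direct_sum (cmod Y k) (cmod X (k - 1))).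
        vpair (cdiff Y k (vfst p) \<oplus>\<^bsub>cmod Y (k - 1)\<^esub> f (k - 1) (vsnd p))
              (\<ominus>\<^bsub>cmod X (k - 2)\<^esub> cdiff X (k - 1) (vsnd p)))\<rparr>"

definition cone_inclusion ::
  "'u::universe chain_complex \<Rightarrow> 'u chain_complex \<Rightarrow> (int \<Rightarrow> 'u \<Rightarrow> 'u) \<Rightarrow> 'u hclass" where
  "cone_inclusion X Y f =
     homotopy_class Y (mapping_cone X Y f) (\<lambda>k y. vpair y \<zero>\<^bsub>cmod X (k - 1)\<^esub>)"

definition cone_projection ::
  "'u::universe chain_complex \<Rightarrow> 'u chain_complex \<Rightarrow> (int \<Rightarrow> 'u \<Rightarrow> 'u) \<Rightarrow> 'u hclass" where
  "cone_projection X Y f =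
     homotopy_class (mapping_cone X Y f) (shift_complex 1 X) (\<lambda>k. vsnd)"

definition K_cat_without_triangles :: "('u::universe chain_complex, 'u hclass) tricat" where
  "K_cat_without_triangles =
     \<lparr>Ob = chain_complexes, Hom = K_Hom, Id = K_Id, Comp = K_Comp,
      Shift = shift_complex, ShiftHom = K_ShiftHom, Triangles = {}\<rparr>"

text \<open>
  The distinguished triangles are the candidate triangles isomorphic, in the homotopy category, to
  a mapping cone triangle \<open>X' \<rightarrow> Y' \<rightarrow> Z' \<rightarrow> Shift 1 X'\<close> where \<open>Z'\<close> is the cone of \<open>f: X' \<rightarrow> Y'\<close>.
\<close>

definition K_Triangles ::
  "('u::universe chain_complex \<times> 'u chain_complex \<times> 'u chain_complex
     \<times> 'u hclass \<times> 'u hclass \<times> 'u hclass) set" where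
  "K_Triangles = {(X, Y, Z, u, v, w).
     X \<in> chain_complexes \<and> Y \<in> chain_complexes \<and> Z \<in> chain_complexes \<and>
     u \<in> carrier (K_Hom X Y) \<and> v \<in> carrier (K_Hom Y Z) \<and>
     w \<in> carrier (K_Hom Z (shift_complex 1 X)) \<and>
     (\<exists>X'\<in>chain_complexes. \<exists>Y'\<in>chain_complexes. \<exists>f\<in>chain_maps X' Y'. \<exists>a b c.
        let Z' = mapping_cone X' Y' f; \<Sigma>X = shift_complex 1 X; \<Sigma>X' = shift_complex 1 X' in
        is_isomorphism K_cat_without_triangles X X' a \<and>
        is_isomorphism K_cat_without_triangles Y Y' b \<and>
        is_isomorphism K_cat_without_triangles Z Z' c \<and>
        K_Comp X Y Y' b u = K_Comp X X' Y' (homotopy_class X' Y' f) a \<and>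
        K_Comp Y Z Z' c v = K_Comp Y Y' Z' (cone_inclusion X' Y' f) b \<and>
        K_Comp Z \<Sigma>X \<Sigma>X' (K_ShiftHom 1 X X' a) w =
          K_Comp Z Z' \<Sigma>X' (cone_projection X' Y' f) c)}"

definition K_cat :: "('u::universe chain_complex, 'u hclass) tricat" where
  "K_cat = K_cat_without_triangles\<lparr>Triangles := K_Triangles\<rparr>"

definition A_cat :: "('u::universe chain_complex, 'u hclass) tricat" where
  "A_cat = full_subcategory K_cat acyclic_complex"

end

theory Submission
  imports Defs "HOL-Library.Z2"
begin

text \<open>
  The obstruction is that the extensions of the trivial module \<open>F\<^sub>2\<close> by itself form a proper class:
  for every ordinal \<open>i\<close>, the dual numbers \<open>F\<^sub>2[\<epsilon>]\<close> become a module on which the variable \<open>X\<^sub>i\<close> acts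
  as \<open>\<epsilon>\<close> and all other variables act as \<open>0\<close>.  Spliced together, infinitely many copies of this
  module give an acyclic complex \<open>P\<^sub>i\<close> with \<open>F\<^sub>2[\<epsilon>]\<close> in each degree and \<open>\<epsilon>\<close> as differential.

  Two functors on complexes detect all the \<open>P\<^sub>i\<close>.  The covariant one takes a complex to the homology
  of its subcomplex of invariants, the elements killed by all variables; these are the
  homotopy classes of maps from a shift of the trivial module \<open>Z\<close>.  The contravariant one takes a
  complex to the cohomology of its functionals, the additive maps to \<open>F\<^sub>2\<close> that kill all multiples
  of variables; these are the homotopy classes of maps to a shift of the trivial module \<open>F\<^sub>2\<close>.

  Suppose that the covariant functor is represented by an acyclic complex \<open>A\<close>.  The universal element
  is the class of an invariant cycle \<open>a\<close> in \<open>A\<^sub>0\<close>, and for every \<open>i\<close> there is a chain map \<open>g\<^sub>i\<close> from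
  \<open>A\<close> to \<open>P\<^sub>i\<close> with \<open>g\<^sub>i a = \<epsilon>\<close>.  Since \<open>A\<close> is acyclic, \<open>a = d b\<close>, and \<open>d (g\<^sub>i b) = \<epsilon>\<close> means that
  \<open>X\<^sub>i (g\<^sub>i b) = \<epsilon>\<close>.  The module \<open>A\<^sub>1\<close> is small and the class of ordinals is not, hence \<open>X\<^sub>i b = X\<^sub>j b\<close>
  for some \<open>i \<noteq> j\<close>, and \<open>\<epsilon> = g\<^sub>i (X\<^sub>i b) = g\<^sub>i (X\<^sub>j b) = X\<^sub>j (g\<^sub>i b) = 0\<close>.  This contradiction is
  \<open>inv_not_representable\<close>.

  Suppose that the contravariant functor is represented by \<open>A\<close>.  Now the universal element is the
  class of a functional \<open>p\<close> on \<open>A\<^sub>0\<close> that vanishes on boundaries, and there are chain maps \<open>g\<^sub>i\<close> from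
  \<open>P\<^sub>i\<close> to \<open>A\<close> such that \<open>p (g\<^sub>i 1) = 1\<close>.  By smallness of \<open>A\<close> there are \<open>i \<noteq> j\<close> such that \<open>g\<^sub>i 1\<close> and
  \<open>g\<^sub>j 1\<close> agree in degrees \<open>0\<close> and \<open>-1\<close>, with values \<open>a\<close> and \<open>b\<close>.  Then \<open>d a = g\<^sub>i \<epsilon> = X\<^sub>i b\<close>, while
  \<open>X\<^sub>i b = g\<^sub>j (X\<^sub>i 1) = 0\<close>.  So \<open>a\<close> is a cycle, hence a boundary, and \<open>p a = 0\<close>, which contradicts
  \<open>p a = 1\<close>.  This is \<open>func_not_representable\<close>.

  Both functors satisfy the hypotheses of Brown representability.  They are homological because
  a mapping cone gives a long exact sequence (\<open>inv_homological\<close>, \<open>func_homological\<close>), by a direct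
  computation at each term of a cone triangle.  They turn products, respectively coproducts, of
  acyclic complexes into products of groups (\<open>inv_products\<close>, \<open>func_coproducts\<close>): this is clear for
  products and direct sums taken degree by degree, and an abstract coproduct is a retract of any
  such construction (\<open>coproducts_to_productsI\<close>).
\<close>

section \<open>Small sets\<close>

lemma small_elts: "small (elts x)"
  by (auto simp: small_def)

lemma elts_set_of_class: "elts (set_of_class S) = S" if "small S"
proof -
  from that obtain x where x: "elts x = S" by (auto simp: small_def)
  then show ?thesis
    unfolding set_of_class_def by (rule theI2) (use x in \<open>auto intro: extensionality\<close>)
qed

lemma set_of_class_elts [simp]: "set_of_class (elts x) = x"
  by (simp add: elts_set_of_class extensionality small_elts)

lemma set_of_class_inject: "set_of_class S = set_of_class S' \<longleftrightarrow> S = S'" if "small S" "small S'"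
  using that by (metis elts_set_of_class)

lemma small_image: "small (f ` S)" if "small S" for f :: "'u::universe \<Rightarrow> 'u"
proof -
  from that obtain x where "elts x = S" by (auto simp: small_def)
  with replacement[of f x] show ?thesis by (simp add: small_def)
qed

lemma small_empty: "small ({} :: 'u::universe set)"
  using infinity unfolding small_def by blast

lemma small_subset: "small S'" if "small S" "S' \<subseteq> S" for S :: "'u::universe set"
proof (cases "S' = {}")
  case False
  then obtain a where "a \<in> S'" by auto
  with that(2) have "S' = (\<lambda>x. if x \<in> S' then x else a) ` S" by auto
  with small_image[OF that(1)] show ?thesis by metis
qed (simp add: small_empty)

lemma small_pair: "small {x, y}"
  using pairing[of x y] by (simp add: small_def)

lemma small_singleton: "small {x}"
  using small_pair[of x x] by simp

lemma small_UN: "small (\<Union>x\<in>S. F x)" if "small S" "\<And>x. x \<in> S \<Longrightarrow> small (F x)"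
  for S :: "'u::universe set" and F :: "'u \<Rightarrow> 'u set"
proof -
  have "small ((\<lambda>x. set_of_class (F x)) ` S)" using that(1) by (rule small_image)
  then obtain w where w: "elts w = (\<lambda>x. set_of_class (F x)) ` S" by (auto simp: small_def)
  have "(\<Union>y\<in>elts w. elts y) = (\<Union>x\<in>S. F x)"
    using that(2) by (simp add: w elts_set_of_class)
  then show ?thesis using union[of w] by (auto simp: small_def)
qed

lemma small_codes_of_subsets: "small {y. elts y \<subseteq> S}" if "small S"
proof -
  from that obtain x where "elts x = S" by (auto simp: small_def)
  with powerset[of x] show ?thesis by (auto simp: small_def)
qed

lemma vpair_inject [simp]: "vpair x y = vpair x' y' \<longleftrightarrow> x = x' \<and> y = y'"
  unfolding vpair_def by (simp add: set_of_class_inject small_pair small_singleton doubleton_eq_iff) blast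

lemma vfst_vpair [simp]: "vfst (vpair x y) = x" and vsnd_vpair [simp]: "vsnd (vpair x y) = y"
  by (auto simp: vfst_def vsnd_def)

lemma small_vpairs: "small {vpair x y | x y. x \<in> S \<and> y \<in> S'}" if "small S" "small S'"
proof -
  have "{vpair x y | x y. x \<in> S \<and> y \<in> S'} = (\<Union>x\<in>S. vpair x ` S')" by auto
  then show ?thesis using that by (simp add: small_UN small_image)
qed

text \<open>
  Burali-Forti: if the ordinals embedded into a small set, they would form a small set, which would
  then be an ordinal and hence an element of itself.
\<close>

lemma ordinals_not_small:
  fixes f :: "'u::universe ordinal \<Rightarrow> 'u"
  assumes "small S" "range f \<subseteq> S"
  obtains i j where "i \<noteq> j" "f i = f j"
proof -
  have "\<not> inj f"
  proof
    assume "inj f"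
    have "small (range f)" using assms small_subset by blast
    then have "small ((\<lambda>y. Rep_ordinal (inv_into UNIV f y)) ` range f)" by (rule small_image)
    also have "(\<lambda>y. Rep_ordinal (inv_into UNIV f y)) ` range f = range Rep_ordinal"
      using \<open>inj f\<close> by (simp add: image_image)
    also have "range Rep_ordinal =
        {\<alpha>::'u. transitive_set \<alpha> \<and> (\<forall>\<beta>\<in>elts \<alpha>. transitive_set \<beta>)}"
      by (rule type_definition.Rep_range[OF type_definition_ordinal])
    finally obtain W :: 'u where
      W: "elts W = {\<alpha>. transitive_set \<alpha> \<and> (\<forall>\<beta>\<in>elts \<alpha>. transitive_set \<beta>)}"
      by (auto simp: small_def)
    have "elts \<beta> \<subseteq> elts \<alpha>" if "transitive_set \<alpha>" "\<beta> \<in> elts \<alpha>" for \<alpha> \<beta> :: "'u"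
      using that by (auto simp: transitive_set_def)
    with W have "transitive_set W" unfolding transitive_set_def[of W] by blast
    with W have "W \<in> elts W" by simp
    then show False using wf_not_refl[OF foundation, of W] by simp
  qed
  then show ?thesis using that by (auto simp: inj_def)
qed

definition vfamily :: "'u::universe set \<Rightarrow> ('u \<Rightarrow> 'u) \<Rightarrow> 'u" where
  "vfamily J f = set_of_class ((\<lambda>j. vpair j (f j)) ` J)"

definition vcomponent :: "'u::universe \<Rightarrow> 'u \<Rightarrow> 'u" where
  "vcomponent x j = (THE y. vpair j y \<in> elts x)"

lemma vcomponent_vfamily [simp]: "vcomponent (vfamily J f) j = f j" if "small J" "j \<in> J"
proof -
  have "elts (vfamily J f) = (\<lambda>j. vpair j (f j)) ` J"
    unfolding vfamily_def by (rule elts_set_of_class) (rule small_image[OF that(1)])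
  then have "vpair j y \<in> elts (vfamily J f) \<longleftrightarrow> y = f j" for y
    using that(2) by auto
  then show ?thesis by (simp add: vcomponent_def)
qed

lemma vfamily_cong: "vfamily J f = vfamily J g" if "\<And>j. j \<in> J \<Longrightarrow> f j = g j"
  using that by (simp add: vfamily_def cong: image_cong)

lemma small_vfamilies: "small {vfamily J f | f. \<forall>j\<in>J. f j \<in> S j}" if "small J" "\<And>j. j \<in> J \<Longrightarrow> small (S j)"
proof (rule small_subset)
  show "small {y. elts y \<subseteq> (\<Union>j\<in>J. vpair j ` S j)}"
    using that by (intro small_codes_of_subsets small_UN small_image)
  show "{vfamily J f | f. \<forall>j\<in>J. f j \<in> S j} \<subseteq> {y. elts y \<subseteq> (\<Union>j\<in>J. vpair j ` S j)}"
    using that(1) by (fastforce simp: vfamily_def elts_set_of_class small_image)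
qed

section \<open>Functors into small abelian groups\<close>

text \<open>
  A quotient of a group with elements in the universe consists of small cosets, and these are in
  turn coded by elements of the universe.
\<close>

definition coded_group :: "'u::universe set monoid \<Rightarrow> 'u monoid" where
  "coded_group G = \<lparr>carrier = set_of_class ` carrier G,
     mult = (\<lambda>x y. set_of_class (elts x \<otimes>\<^bsub>G\<^esub> elts y)), one = set_of_class \<one>\<^bsub>G\<^esub>\<rparr>"

lemma coded_group_iso:
  assumes "group G" and small: "\<And>S. S \<in> carrier G \<Longrightarrow> small S"
  shows "set_of_class \<in> iso G (coded_group G)"
proof (rule isoI)
  interpret group G by fact
  show "set_of_class \<in> hom G (coded_group G)"
    by (rule homI) (simp_all add: coded_group_def elts_set_of_class small)
  have "inj_on set_of_class (carrier G)"
    by (rule inj_onI) (use small set_of_class_inject in blast)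
  then show "bij_betw set_of_class (carrier G) (carrier (coded_group G))"
    by (simp add: bij_betw_def coded_group_def)
qed

lemma coded_group_comm_group:
  assumes "comm_group G" and small: "\<And>S. S \<in> carrier G \<Longrightarrow> small S"
  shows "comm_group (coded_group G)"
proof -
  interpret comm_group G by fact
  have "set_of_class \<in> iso G (coded_group G)" by (rule coded_group_iso) (use small in auto)
  then have "comm_group (coded_group G \<lparr>one := set_of_class \<one>\<^bsub>G\<^esub>\<rparr>)" by (rule iso_imp_img_comm_group)
  then show ?thesis by (simp add: coded_group_def)
qed

text \<open>
  A contravariant functor into cochain complexes, seen in one degree: \<open>Z\<close> are the cocycles, \<open>B\<close> the
  coboundaries, and \<open>act\<close> is the action on cocycles of the representatives of a morphism.
  Representatives of the same morphism may act differently on cocycles, but not on cohomology.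
\<close>

locale cocycle_functor =
  fixes T :: "('o, 'c set) tricat"
    and Z :: "'o \<Rightarrow> 'u::universe monoid"
    and B :: "'o \<Rightarrow> 'u set"
    and act :: "'o \<Rightarrow> 'o \<Rightarrow> 'c \<Rightarrow> 'u \<Rightarrow> 'u"
  assumes cocycles: "X \<in> Ob T \<Longrightarrow> comm_group (Z X)"
    and small_cocycles: "X \<in> Ob T \<Longrightarrow> small (carrier (Z X))"
    and coboundaries: "X \<in> Ob T \<Longrightarrow> subgroup (B X) (Z X)"
    and nonempty: "\<lbrakk>X \<in> Ob T; Y \<in> Ob T; F \<in> carrier (Hom T X Y)\<rbrakk> \<Longrightarrow> F \<noteq> {}"
    and act_hom: "\<lbrakk>X \<in> Ob T; Y \<in> Ob T; F \<in> carrier (Hom T X Y); f \<in> F\<rbrakk>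
        \<Longrightarrow> act X Y f \<in> hom (Z Y) (Z X)"
    and act_coboundary: "\<lbrakk>X \<in> Ob T; Y \<in> Ob T; F \<in> carrier (Hom T X Y); f \<in> F; z \<in> B Y\<rbrakk>
        \<Longrightarrow> act X Y f z \<in> B X"
    and act_cong: "\<lbrakk>X \<in> Ob T; Y \<in> Ob T; F \<in> carrier (Hom T X Y); f \<in> F; g \<in> F; z \<in> carrier (Z Y)\<rbrakk>
        \<Longrightarrow> act X Y f z \<otimes>\<^bsub>Z X\<^esub> inv\<^bsub>Z X\<^esub> act X Y g z \<in> B X"
    and act_Id: "X \<in> Ob T \<Longrightarrow> Id T X \<in> carrier (Hom T X X) \<and>
        (\<exists>f\<in>Id T X. \<forall>z\<in>carrier (Z X). act X X f z = z)"
    and act_Comp: "\<lbrakk>X \<in> Ob T; Y \<in> Ob T; W \<in> Ob T; F \<in> carrier (Hom T X Y); G \<in> carrier (Hom T Y W)\<rbrakk>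
        \<Longrightarrow> Comp T X Y W G F \<in> carrier (Hom T X W) \<and>
          (\<exists>k\<in>Comp T X Y W G F. \<exists>f\<in>F. \<exists>g\<in>G. \<forall>z\<in>carrier (Z W). act X W k z = act X Y f (act Y W g z))"
begin

definition cls :: "'o \<Rightarrow> 'u \<Rightarrow> 'u" where
  "cls X z = set_of_class (B X #>\<^bsub>Z X\<^esub> z)"

definition H :: "'o \<Rightarrow> 'u monoid" where
  "H X = coded_group (Z X Mod B X)"

definition h :: "'o \<Rightarrow> 'o \<Rightarrow> 'c set \<Rightarrow> 'u \<Rightarrow> 'u" where
  "h X Y F c = cls X (act X Y (SOME f. f \<in> F) (SOME z. z \<in> carrier (Z Y) \<and> cls Y z = c))"

context
  fixes X assumes X: "X \<in> Ob T"
begin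

interpretation ZX: comm_group "Z X" by (rule cocycles[OF X])
interpretation BX: normal "B X" "Z X" by (rule ZX.subgroup_imp_normal[OF coboundaries[OF X]])

lemma small_coset: "S \<in> carrier (Z X Mod B X) \<Longrightarrow> small S"
  by (rule small_subset[OF small_cocycles[OF X]])
    (use BX.rcosets_carrier ZX.is_group in \<open>auto simp: FactGroup_def\<close>)

lemma H_group: "comm_group (H X)"
  unfolding H_def
  by (rule coded_group_comm_group[OF ZX.abelian_FactGroup[OF BX.subgroup_axioms] small_coset])

lemma carrier_H: "carrier (H X) = cls X ` carrier (Z X)"
  by (auto simp: H_def coded_group_def cls_def FactGroup_def RCOSETS_def)

lemma small_H: "small (carrier (H X))"
  unfolding carrier_H by (rule small_image[OF small_cocycles[OF X]])

lemma cls_hom: "cls X \<in> hom (Z X) (H X)"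
proof -
  have "set_of_class \<in> hom (Z X Mod B X) (H X)"
    using coded_group_iso[OF BX.factorgroup_is_group small_coset] by (simp add: H_def iso_def)
  from hom_compose[OF BX.r_coset_hom_Mod this] show ?thesis
    by (simp add: cls_def[abs_def] comp_def)
qed

lemma cls_group_hom: "group_hom (Z X) (H X) (cls X)"
  using H_group cls_hom by (intro group_hom.intro group_hom_axioms.intro) (auto simp: comm_group_def)

lemma cls_eq_iff: "cls X y = cls X z \<longleftrightarrow> y \<otimes>\<^bsub>Z X\<^esub> inv\<^bsub>Z X\<^esub> z \<in> B X"
  if "y \<in> carrier (Z X)" "z \<in> carrier (Z X)"
proof -
  have "cls X y = cls X z \<longleftrightarrow> B X #>\<^bsub>Z X\<^esub> y = B X #>\<^bsub>Z X\<^esub> z"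
    unfolding cls_def using that
    by (intro set_of_class_inject small_coset) (auto simp: FactGroup_def intro: ZX.rcosetsI BX.subset)
  also have "\<dots> \<longleftrightarrow> y \<in> B X #>\<^bsub>Z X\<^esub> z"
    using that BX.subgroup_axioms ZX.repr_independence ZX.repr_independenceD by metis
  also have "\<dots> \<longleftrightarrow> y \<otimes>\<^bsub>Z X\<^esub> inv\<^bsub>Z X\<^esub> z \<in> B X"
    using that by (intro BX.rcos_module ZX.is_group)
  finally show ?thesis .
qed

lemma cls_eq_one_iff: "cls X z = \<one>\<^bsub>H X\<^esub> \<longleftrightarrow> z \<in> B X" if "z \<in> carrier (Z X)"
  using that cls_eq_iff[of z "\<one>\<^bsub>Z X\<^esub>"] group_hom.hom_one[OF cls_group_hom] by simp

end

lemma h_cls: "h X Y F (cls Y z) = cls X (act X Y f z)"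
  if XY: "X \<in> Ob T" "Y \<in> Ob T" and F: "F \<in> carrier (Hom T X Y)" "f \<in> F" and z: "z \<in> carrier (Z Y)"
proof -
  interpret ZX: comm_group "Z X" by (rule cocycles[OF XY(1)])
  interpret ZY: comm_group "Z Y" by (rule cocycles[OF XY(2)])
  define f' where "f' = (SOME f. f \<in> F)"
  define z' where "z' = (SOME w. w \<in> carrier (Z Y) \<and> cls Y w = cls Y z)"
  have f': "f' \<in> F" unfolding f'_def using F(2) by (rule someI)
  have z': "z' \<in> carrier (Z Y) \<and> cls Y z' = cls Y z"
    unfolding z'_def by (rule someI) (use z in simp)
  interpret f: group_hom "Z Y" "Z X" "act X Y f"
    using act_hom[OF XY F] by unfold_locales
  have "act X Y f' z' \<in> carrier (Z X)"
    using act_hom[OF XY F(1) f'] z' by (auto simp: hom_def)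
  then have "cls X (act X Y f' z') = cls X (act X Y f z')"
    using act_cong[OF XY F(1) f' F(2)] z' by (simp add: cls_eq_iff XY)
  also have "\<dots> = cls X (act X Y f z)"
  proof -
    have "z' \<otimes>\<^bsub>Z Y\<^esub> inv\<^bsub>Z Y\<^esub> z \<in> B Y" using z z' cls_eq_iff XY(2) by blast
    from act_coboundary[OF XY F this]
    have "act X Y f z' \<otimes>\<^bsub>Z X\<^esub> inv\<^bsub>Z X\<^esub> act X Y f z \<in> B X" using z z' by simp
    then show ?thesis using z z' by (simp add: cls_eq_iff XY)
  qed
  finally show ?thesis by (simp add: h_def f'_def z'_def)
qed

lemma h_hom: "h X Y F \<in> hom (H Y) (H X)"
  if XY: "X \<in> Ob T" "Y \<in> Ob T" and F: "F \<in> carrier (Hom T X Y)"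
proof -
  obtain f where f: "f \<in> F" using nonempty[OF XY F] by auto
  interpret f: group_hom "Z Y" "Z X" "act X Y f"
    using act_hom[OF XY F f] cocycles XY
    by (intro group_hom.intro group_hom_axioms.intro) (auto simp: comm_group_def)
  interpret cX: group_hom "Z X" "H X" "cls X" using XY by (intro cls_group_hom)
  interpret cY: group_hom "Z Y" "H Y" "cls Y" using XY by (intro cls_group_hom)
  note [simp] = h_cls[OF XY F f] carrier_H[OF XY(1)] carrier_H[OF XY(2)]
  show ?thesis
  proof (rule homI)
    fix c d assume "c \<in> carrier (H Y)" "d \<in> carrier (H Y)"
    then obtain y z where "y \<in> carrier (Z Y)" "c = cls Y y" "z \<in> carrier (Z Y)" "d = cls Y z" by auto
    then show "h X Y F (c \<otimes>\<^bsub>H Y\<^esub> d) = h X Y F c \<otimes>\<^bsub>H X\<^esub> h X Y F d"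
      by (simp flip: cY.hom_mult cX.hom_mult)
  qed auto
qed

lemma h_functor: "cofunctor_to_Ab T H h"
  unfolding cofunctor_to_Ab_def
proof (intro conjI ballI)
  fix X x assume X: "X \<in> Ob T" and "x \<in> carrier (H X)"
  then obtain z where z: "z \<in> carrier (Z X)" "x = cls X z" by (auto simp: carrier_H)
  obtain f where "f \<in> Id T X" "\<forall>z\<in>carrier (Z X). act X X f z = z" using act_Id[OF X] by auto
  with z h_cls[of X X "Id T X" f z] show "h X X (Id T X) x = x" using act_Id X by auto
next
  fix X Y W F G x
  assume XYW: "X \<in> Ob T" "Y \<in> Ob T" "W \<in> Ob T" and FG: "F \<in> carrier (Hom T X Y)" "G \<in> carrier (Hom T Y W)"
    and "x \<in> carrier (H W)"
  then obtain z where z: "z \<in> carrier (Z W)" "x = cls W z" by (auto simp: carrier_H)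
  obtain k f g where k: "k \<in> Comp T X Y W G F" "f \<in> F" "g \<in> G" "act X W k z = act X Y f (act Y W g z)"
    using act_Comp[OF XYW FG] z by blast
  have "act Y W g z \<in> carrier (Z Y)" using act_hom[OF XYW(2,3) FG(2) k(3)] z(1) by (auto simp: hom_def)
  then have "h X W (Comp T X Y W G F) x = h X Y F (h Y W G x)"
    using act_Comp[OF XYW FG] z k FG XYW by (simp add: h_cls[where f = f] h_cls[where f = g] h_cls[where f = k])
  then show "h X W (Comp T X Y W G F) x = h X Y F (h Y W G x)" .
qed (use H_group small_H h_hom in auto)

end


subsection \<open>Exactness\<close>

text \<open>
  The functor is contravariant: the sequence is \<open>H Z \<rightarrow> H Y \<rightarrow> H X\<close>, and the map on the left comes from
  \<open>g\<close>.
\<close>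

definition exact_at ::
  "('o \<Rightarrow> 'u monoid) \<Rightarrow> ('o \<Rightarrow> 'o \<Rightarrow> 'm \<Rightarrow> 'u \<Rightarrow> 'u) \<Rightarrow> 'o \<Rightarrow> 'o \<Rightarrow> 'o \<Rightarrow> 'm \<Rightarrow> 'm \<Rightarrow> bool" where
  "exact_at H h X Y Z f g \<longleftrightarrow>
     (\<forall>y\<in>carrier (H Y). h X Y f y = \<one>\<^bsub>H X\<^esub> \<longleftrightarrow> y \<in> h Y Z g ` carrier (H Z))"

lemma (in cocycle_functor) exact_atI:
  assumes XYW: "X \<in> Ob T" "Y \<in> Ob T" "W \<in> Ob T"
    and F: "F \<in> carrier (Hom T X Y)" "f \<in> F" and G: "G \<in> carrier (Hom T Y W)" "g \<in> G"
    and zero: "\<And>w. w \<in> carrier (Z W) \<Longrightarrow> act X Y f (act Y W g w) \<in> B X"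
    and lift: "\<And>y. \<lbrakk>y \<in> carrier (Z Y); act X Y f y \<in> B X\<rbrakk>
        \<Longrightarrow> \<exists>w\<in>carrier (Z W). y \<otimes>\<^bsub>Z Y\<^esub> inv\<^bsub>Z Y\<^esub> act Y W g w \<in> B Y"
  shows "exact_at H h X Y W F G"
  unfolding exact_at_def
proof
  fix c assume "c \<in> carrier (H Y)"
  then obtain y where y: "y \<in> carrier (Z Y)" "c = cls Y y" using carrier_H XYW by auto
  have f: "act X Y f \<in> carrier (Z Y) \<rightarrow> carrier (Z X)" and g: "act Y W g \<in> carrier (Z W) \<rightarrow> carrier (Z Y)"
    using act_hom[OF XYW(1,2) F] act_hom[OF XYW(2,3) G] by (auto simp: hom_def)
  have hc: "h X Y F (cls Y z) = \<one>\<^bsub>H X\<^esub> \<longleftrightarrow> act X Y f z \<in> B X" if "z \<in> carrier (Z Y)" for z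
    using that h_cls[OF XYW(1,2) F] cls_eq_one_iff[OF XYW(1)] f by auto
  show "h X Y F c = \<one>\<^bsub>H X\<^esub> \<longleftrightarrow> c \<in> h Y W G ` carrier (H W)"
  proof
    assume "h X Y F c = \<one>\<^bsub>H X\<^esub>"
    with lift[of y] y hc obtain w where w: "w \<in> carrier (Z W)" "y \<otimes>\<^bsub>Z Y\<^esub> inv\<^bsub>Z Y\<^esub> act Y W g w \<in> B Y"
      by blast
    then have "c = h Y W G (cls W w)"
      using y g by (simp add: h_cls[OF XYW(2,3) G] cls_eq_iff XYW Pi_iff)
    with w carrier_H XYW show "c \<in> h Y W G ` carrier (H W)" by auto
  next
    assume "c \<in> h Y W G ` carrier (H W)"
    then obtain w where w: "w \<in> carrier (Z W)" "c = h Y W G (cls W w)" using carrier_H XYW by auto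
    then have "c = cls Y (act Y W g w)" by (simp add: h_cls[OF XYW(2,3) G])
    moreover have "act Y W g w \<in> carrier (Z Y)" using w g by auto
    ultimately show "h X Y F c = \<one>\<^bsub>H X\<^esub>" using hc zero[OF w(1)] by simp
  qed
qed

lemma exact_seq_five:
  assumes "group A" "group B" "group C" "group D" "group E"
    and "f \<in> hom B A" "g \<in> hom C B" "h \<in> hom D C" "k \<in> hom E D"
    and "\<And>b. b \<in> carrier B \<Longrightarrow> f b = \<one>\<^bsub>A\<^esub> \<longleftrightarrow> b \<in> g ` carrier C"
    and "\<And>b. b \<in> carrier C \<Longrightarrow> g b = \<one>\<^bsub>B\<^esub> \<longleftrightarrow> b \<in> h ` carrier D"
    and "\<And>b. b \<in> carrier D \<Longrightarrow> h b = \<one>\<^bsub>C\<^esub> \<longleftrightarrow> b \<in> k ` carrier E"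
  shows "exact_seq ([A, B, C, D, E], [f, g, h, k])"
proof -
  have "g ` carrier C \<subseteq> carrier B" "h ` carrier D \<subseteq> carrier C" "k ` carrier E \<subseteq> carrier D"
    using assms(7-9) by (auto simp: hom_def)
  then have "kernel B A f = g ` carrier C" "kernel C B g = h ` carrier D" "kernel D C h = k ` carrier E"
    using assms(10-12) unfolding kernel_def by blast+
  with assms show ?thesis by (simp add: group_hom_def group_hom_axioms_def)
qed

lemma cofunctor_group: "\<lbrakk>cofunctor_to_Ab T H h; X \<in> Ob T\<rbrakk> \<Longrightarrow> group (H X)"
  by (simp add: cofunctor_to_Ab_def comm_group_def)

lemma cofunctor_hom:
  "\<lbrakk>cofunctor_to_Ab T H h; X \<in> Ob T; Y \<in> Ob T; f \<in> carrier (Hom T X Y)\<rbrakk> \<Longrightarrow> h X Y f \<in> hom (H Y) (H X)"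
  by (simp add: cofunctor_to_Ab_def)

lemma cofunctor_isomorphism:
  assumes H: "cofunctor_to_Ab T H h" and XY: "X \<in> Ob T" "Y \<in> Ob T" and f: "is_isomorphism T X Y f"
  shows "bij_betw (h X Y f) (carrier (H Y)) (carrier (H X))"
proof -
  obtain g where g: "g \<in> carrier (Hom T Y X)" "Comp T X Y X g f = Id T X" "Comp T Y X Y f g = Id T Y"
    using f by (auto simp: is_isomorphism_def)
  have f: "f \<in> carrier (Hom T X Y)" using f by (simp add: is_isomorphism_def)
  have id: "\<And>X x. X \<in> Ob T \<Longrightarrow> x \<in> carrier (H X) \<Longrightarrow> h X X (Id T X) x = x"
    and comp: "\<And>X Y Z f g z. X \<in> Ob T \<Longrightarrow> Y \<in> Ob T \<Longrightarrow> Z \<in> Ob T \<Longrightarrow> f \<in> carrier (Hom T X Y)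
      \<Longrightarrow> g \<in> carrier (Hom T Y Z) \<Longrightarrow> z \<in> carrier (H Z) \<Longrightarrow>
      h X Z (Comp T X Y Z g f) z = h X Y f (h Y Z g z)"
    and hom: "\<And>X Y f. X \<in> Ob T \<Longrightarrow> Y \<in> Ob T \<Longrightarrow> f \<in> carrier (Hom T X Y) \<Longrightarrow>
      h X Y f \<in> carrier (H Y) \<rightarrow> carrier (H X)"
    using H by (simp_all add: cofunctor_to_Ab_def hom_def)
  show ?thesis
  proof (rule bij_betw_byWitness[where f' = "h Y X g"])
    show "\<forall>a\<in>carrier (H Y). h Y X g (h X Y f a) = a"
      using comp[OF XY(2,1,2) g(1) f] g id XY by simp
    show "\<forall>a\<in>carrier (H X). h X Y f (h Y X g a) = a"
      using comp[OF XY(1,2,1) f g(1)] g id XY by simp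
  qed (use hom[OF XY f] hom[OF XY(2,1) g(1)] in auto)
qed

text \<open>
  The functor turns the three isomorphisms into bijections.  An equivalence is stated because
  the isomorphisms between a triangle and a cone triangle point one way in a category and the other
  way in its dual.
\<close>

lemma exact_at_transport:
  assumes H: "cofunctor_to_Ab T H h"
    and Ob: "X \<in> Ob T" "Y \<in> Ob T" "Z \<in> Ob T" "X' \<in> Ob T" "Y' \<in> Ob T" "Z' \<in> Ob T"
    and f: "f \<in> carrier (Hom T X Y)" "f' \<in> carrier (Hom T X' Y')"
    and g: "g \<in> carrier (Hom T Y Z)" "g' \<in> carrier (Hom T Y' Z')"
    and iso: "is_isomorphism T X X' a" "is_isomorphism T Y Y' b" "is_isomorphism T Z Z' c"
    and comm: "Comp T X Y Y' b f = Comp T X X' Y' f' a" "Comp T Y Z Z' c g = Comp T Y Y' Z' g' b"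
  shows "exact_at H h X Y Z f g \<longleftrightarrow> exact_at H h X' Y' Z' f' g'"
proof -
  have comp: "\<And>X Y Z f g z. X \<in> Ob T \<Longrightarrow> Y \<in> Ob T \<Longrightarrow> Z \<in> Ob T \<Longrightarrow> f \<in> carrier (Hom T X Y)
      \<Longrightarrow> g \<in> carrier (Hom T Y Z) \<Longrightarrow> z \<in> carrier (H Z) \<Longrightarrow>
      h X Z (Comp T X Y Z g f) z = h X Y f (h Y Z g z)"
    and hom: "\<And>X Y f. X \<in> Ob T \<Longrightarrow> Y \<in> Ob T \<Longrightarrow> f \<in> carrier (Hom T X Y) \<Longrightarrow>
      h X Y f \<in> hom (H Y) (H X)"
    and grp: "\<And>X. X \<in> Ob T \<Longrightarrow> group (H X)"
    using H by (simp_all add: cofunctor_to_Ab_def comm_group_def)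
  have a: "a \<in> carrier (Hom T X X')" and b: "b \<in> carrier (Hom T Y Y')" and c: "c \<in> carrier (Hom T Z Z')"
    using iso by (simp_all add: is_isomorphism_def)
  note bij = cofunctor_isomorphism[OF H Ob(1,4) iso(1)] cofunctor_isomorphism[OF H Ob(2,5) iso(2)]
    cofunctor_isomorphism[OF H Ob(3,6) iso(3)]
  have sq: "h X Y f (h Y Y' b y) = h X X' a (h X' Y' f' y)" if "y \<in> carrier (H Y')" for y
    using comp[OF Ob(1,2,5) f(1) b that] comp[OF Ob(1,4,5) a f(2) that] comm by simp
  have sq': "h Y Z g (h Z Z' c y) = h Y Y' b (h Y' Z' g' y)" if "y \<in> carrier (H Z')" for y
    using comp[OF Ob(2,3,6) g(1) c that] comp[OF Ob(2,5,6) b g(2) that] comm by simp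
  interpret a: group_hom "H X'" "H X" "h X X' a"
    using hom[OF Ob(1,4) a] grp Ob by (simp add: group_hom_def group_hom_axioms_def)
  have f': "h X' Y' f' \<in> carrier (H Y') \<rightarrow> carrier (H X')" and g': "h Y' Z' g' \<in> carrier (H Z') \<rightarrow> carrier (H Y')"
    using hom[OF Ob(4,5) f(2)] hom[OF Ob(5,6) g(2)] by (auto simp: hom_def)
  have "h X Y f (h Y Y' b y) = \<one>\<^bsub>H X\<^esub> \<longleftrightarrow> h X' Y' f' y = \<one>\<^bsub>H X'\<^esub>" if "y \<in> carrier (H Y')" for y
  proof -
    have "h X' Y' f' y \<in> carrier (H X')" using f' that by auto
    from inj_on_eq_iff[OF bij_betw_imp_inj_on[OF bij(1)] this, of "\<one>\<^bsub>H X'\<^esub>"]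
    show ?thesis using sq[OF that] grp[OF Ob(4)] by (simp add: group.is_monoid)
  qed
  moreover have "h Y Y' b y \<in> h Y Z g ` carrier (H Z) \<longleftrightarrow> y \<in> h Y' Z' g' ` carrier (H Z')" if y: "y \<in> carrier (H Y')" for y
  proof -
    have "h Y Z g ` carrier (H Z) = h Y Z g ` h Z Z' c ` carrier (H Z')"
      by (simp add: bij_betw_imp_surj_on[OF bij(3)])
    also have "\<dots> = h Y Y' b ` h Y' Z' g' ` carrier (H Z')"
      unfolding image_image by (rule image_cong) (simp_all add: sq')
    moreover have "h Y' Z' g' ` carrier (H Z') \<subseteq> carrier (H Y')" using g' by blast
    ultimately show ?thesis
      using inj_on_image_mem_iff[OF bij_betw_imp_inj_on[OF bij(2)] y] by simp
  qed
  ultimately show ?thesis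
    unfolding exact_at_def bij_betw_imp_surj_on[OF bij(2), symmetric] by auto
qed


subsection \<open>Products and representability\<close>

definition category_laws :: "('o, 'm) tricat \<Rightarrow> bool" where
  "category_laws T \<longleftrightarrow>
     (\<forall>X\<in>Ob T. Id T X \<in> carrier (Hom T X X)) \<and>
     (\<forall>X\<in>Ob T. \<forall>Y\<in>Ob T. \<forall>f\<in>carrier (Hom T X Y).
        Comp T X Y Y (Id T Y) f = f \<and> Comp T X X Y f (Id T X) = f) \<and>
     (\<forall>X\<in>Ob T. \<forall>Y\<in>Ob T. \<forall>Z\<in>Ob T. \<forall>f\<in>carrier (Hom T X Y). \<forall>g\<in>carrier (Hom T Y Z).
        Comp T X Y Z g f \<in> carrier (Hom T X Z)) \<and>
     (\<forall>X\<in>Ob T. \<forall>Y\<in>Ob T. \<forall>Z\<in>Ob T. \<forall>W\<in>Ob T.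
        \<forall>f\<in>carrier (Hom T X Y). \<forall>g\<in>carrier (Hom T Y Z). \<forall>k\<in>carrier (Hom T Z W).
        Comp T X Z W k (Comp T X Y Z g f) = Comp T X Y W (Comp T Y Z W k g) f)"

lemma category_laws_dual: "category_laws T \<Longrightarrow> category_laws (dual T)"
  unfolding category_laws_def by (auto simp: dual_def)

lemma category_laws_full_subcategory: "category_laws T \<Longrightarrow> category_laws (full_subcategory T P)"
  unfolding category_laws_def by (auto simp: full_subcategory_def)

lemma cofunctor_full_subcategory:
  "cofunctor_to_Ab T H h \<Longrightarrow> cofunctor_to_Ab (full_subcategory T P) H h"
  unfolding cofunctor_to_Ab_def by (auto simp: full_subcategory_def)

text \<open>
  In the homotopy category, the existence of the map out of a direct sum is a matter of choosing
  representatives, whereas its uniqueness would require a choice of homotopies.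
\<close>

definition is_weak_coproduct ::
  "('o, 'm) tricat \<Rightarrow> 'i set \<Rightarrow> ('i \<Rightarrow> 'o) \<Rightarrow> 'o \<Rightarrow> ('i \<Rightarrow> 'm) \<Rightarrow> bool" where
  "is_weak_coproduct T J X S \<sigma> \<longleftrightarrow>
     S \<in> Ob T \<and> (\<forall>j\<in>J. \<sigma> j \<in> carrier (Hom T (X j) S)) \<and>
     (\<forall>Y\<in>Ob T. \<forall>f. (\<forall>j\<in>J. f j \<in> carrier (Hom T (X j) Y)) \<longrightarrow>
        (\<exists>g\<in>carrier (Hom T S Y). \<forall>j\<in>J. Comp T (X j) S Y g (\<sigma> j) = f j))"

text \<open>
  An actual coproduct \<open>C\<close> is a retract of every weak coproduct \<open>S\<close>, compatibly with the inclusions.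
  So it suffices that the functor turns one weak coproduct of each family into a product.
\<close>

lemma coproducts_to_productsI:
  fixes T :: "('o, 'm) tricat" and H :: "'o \<Rightarrow> 'u::universe monoid"
  assumes T: "category_laws T" and H: "cofunctor_to_Ab T H h"
    and weak: "\<And>(J::'u set) X. \<lbrakk>small J; X ` J \<subseteq> Ob T\<rbrakk> \<Longrightarrow>
      \<exists>S \<sigma>. is_weak_coproduct T J X S \<sigma> \<and>
        (\<forall>x. (\<forall>j\<in>J. x j \<in> carrier (H (X j))) \<longrightarrow>
           (\<exists>s\<in>carrier (H S). \<forall>j\<in>J. h (X j) S (\<sigma> j) s = x j)) \<and>
        (\<forall>s\<in>carrier (H S). (\<forall>j\<in>J. h (X j) S (\<sigma> j) s = \<one>\<^bsub>H (X j)\<^esub>) \<longrightarrow> s = \<one>\<^bsub>H S\<^esub>)"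
  shows "coproducts_to_products T H h"
  unfolding coproducts_to_products_def
proof (intro allI impI, elim conjE)
  fix J :: "'u set" and X C \<iota>
  assume J: "small J" "X ` J \<subseteq> Ob T" and C: "is_coproduct T J X C \<iota>"
  have XT: "\<And>j. j \<in> J \<Longrightarrow> X j \<in> Ob T" using J(2) by auto
  have CT: "C \<in> Ob T" and \<iota>: "\<And>j. j \<in> J \<Longrightarrow> \<iota> j \<in> carrier (Hom T (X j) C)"
    and univ: "\<And>Y f. \<lbrakk>Y \<in> Ob T; \<And>j. j \<in> J \<Longrightarrow> f j \<in> carrier (Hom T (X j) Y)\<rbrakk> \<Longrightarrow>
        \<exists>!g. g \<in> carrier (Hom T C Y) \<and> (\<forall>j\<in>J. Comp T (X j) C Y g (\<iota> j) = f j)"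
    using C unfolding is_coproduct_def by auto
  have id: "\<And>X. X \<in> Ob T \<Longrightarrow> Id T X \<in> carrier (Hom T X X)"
    and idl: "\<And>X Y f. \<lbrakk>X \<in> Ob T; Y \<in> Ob T; f \<in> carrier (Hom T X Y)\<rbrakk> \<Longrightarrow> Comp T X Y Y (Id T Y) f = f"
    and closed: "\<And>X Y Z f g. \<lbrakk>X \<in> Ob T; Y \<in> Ob T; Z \<in> Ob T; f \<in> carrier (Hom T X Y); g \<in> carrier (Hom T Y Z)\<rbrakk>
      \<Longrightarrow> Comp T X Y Z g f \<in> carrier (Hom T X Z)"
    and assoc: "\<And>X Y Z W f g k. \<lbrakk>X \<in> Ob T; Y \<in> Ob T; Z \<in> Ob T; W \<in> Ob T; f \<in> carrier (Hom T X Y);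
      g \<in> carrier (Hom T Y Z); k \<in> carrier (Hom T Z W)\<rbrakk>
      \<Longrightarrow> Comp T X Z W k (Comp T X Y Z g f) = Comp T X Y W (Comp T Y Z W k g) f"
    using T unfolding category_laws_def by blast+
  have grp: "\<And>X. X \<in> Ob T \<Longrightarrow> group (H X)"
    and hom: "\<And>X Y f. \<lbrakk>X \<in> Ob T; Y \<in> Ob T; f \<in> carrier (Hom T X Y)\<rbrakk> \<Longrightarrow> h X Y f \<in> hom (H Y) (H X)"
    and h_id: "\<And>X x. \<lbrakk>X \<in> Ob T; x \<in> carrier (H X)\<rbrakk> \<Longrightarrow> h X X (Id T X) x = x"
    and h_comp: "\<And>X Y Z f g z. \<lbrakk>X \<in> Ob T; Y \<in> Ob T; Z \<in> Ob T; f \<in> carrier (Hom T X Y);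
      g \<in> carrier (Hom T Y Z); z \<in> carrier (H Z)\<rbrakk> \<Longrightarrow> h X Z (Comp T X Y Z g f) z = h X Y f (h Y Z g z)"
    using H by (simp_all add: cofunctor_to_Ab_def comm_group_def)
  obtain S \<sigma> where weak: "is_weak_coproduct T J X S \<sigma>"
    and glue: "\<forall>x. (\<forall>j\<in>J. x j \<in> carrier (H (X j))) \<longrightarrow>
           (\<exists>s\<in>carrier (H S). \<forall>j\<in>J. h (X j) S (\<sigma> j) s = x j)"
    and zero: "\<forall>s\<in>carrier (H S). (\<forall>j\<in>J. h (X j) S (\<sigma> j) s = \<one>\<^bsub>H (X j)\<^esub>) \<longrightarrow> s = \<one>\<^bsub>H S\<^esub>"
    using weak[OF J] by auto
  have S: "S \<in> Ob T" and \<sigma>: "\<And>j. j \<in> J \<Longrightarrow> \<sigma> j \<in> carrier (Hom T (X j) S)"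
    and factor: "\<And>Y f. \<lbrakk>Y \<in> Ob T; \<forall>j\<in>J. f j \<in> carrier (Hom T (X j) Y)\<rbrakk> \<Longrightarrow>
        \<exists>g\<in>carrier (Hom T S Y). \<forall>j\<in>J. Comp T (X j) S Y g (\<sigma> j) = f j"
    using weak by (simp_all add: is_weak_coproduct_def)
  obtain p where p: "p \<in> carrier (Hom T S C)" "\<And>j. j \<in> J \<Longrightarrow> Comp T (X j) S C p (\<sigma> j) = \<iota> j"
    using factor[of C \<iota>] CT \<iota> by blast
  obtain q where q: "q \<in> carrier (Hom T C S)" "\<And>j. j \<in> J \<Longrightarrow> Comp T (X j) C S q (\<iota> j) = \<sigma> j"
    using univ[of S \<sigma>] S \<sigma> by blast
  have "Comp T (X j) C C (Comp T C S C p q) (\<iota> j) = \<iota> j" if "j \<in> J" for j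
    using assoc[OF XT[OF that] CT S CT \<iota>[OF that] q(1) p(1)] p(2) q(2) that by simp
  moreover have "Comp T (X j) C C (Id T C) (\<iota> j) = \<iota> j" if "j \<in> J" for j
    using idl XT CT \<iota> that by blast
  ultimately have pq: "Comp T C S C p q = Id T C"
    using univ[of C \<iota>] \<iota> CT id closed[OF CT S CT q(1) p(1)] by blast
  have h_p: "h S C p c \<in> carrier (H S)" and h_qp: "h C S q (h S C p c) = c" if "c \<in> carrier (H C)" for c
    using that hom[OF S CT p(1)] h_comp[OF CT S CT q(1) p(1) that] h_id[OF CT that] pq by (auto simp: hom_def)
  have h_\<iota>: "h (X j) C (\<iota> j) c = h (X j) S (\<sigma> j) (h S C p c)" if "j \<in> J" "c \<in> carrier (H C)" for j c
    using h_comp[OF XT[OF that(1)] S CT \<sigma>[OF that(1)] p(1) that(2)] p(2)[OF that(1)] by simp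
  have h_\<sigma>: "h (X j) C (\<iota> j) (h C S q s) = h (X j) S (\<sigma> j) s" if "j \<in> J" "s \<in> carrier (H S)" for j s
    using h_comp[OF XT[OF that(1)] CT S \<iota>[OF that(1)] q(1) that(2)] q(2)[OF that(1)] by simp
  let ?P = "product_group J (\<lambda>j. H (X j))" and ?\<phi> = "\<lambda>x. \<lambda>j\<in>J. h (X j) C (\<iota> j) x"
  have hom_\<iota>: "h (X j) C (\<iota> j) \<in> hom (H C) (H (X j))" if "j \<in> J" for j
    using hom XT CT \<iota> that by blast
  have \<phi>: "?\<phi> \<in> hom (H C) ?P"
  proof (rule homI)
    show "?\<phi> x \<in> carrier ?P" if "x \<in> carrier (H C)" for x
      using hom_in_carrier[OF hom_\<iota> that] by (simp add: PiE_iff)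
    show "?\<phi> (x \<otimes>\<^bsub>H C\<^esub> y) = ?\<phi> x \<otimes>\<^bsub>?P\<^esub> ?\<phi> y" if "x \<in> carrier (H C)" "y \<in> carrier (H C)" for x y
      using hom_mult[OF hom_\<iota> that] by (simp cong: restrict_cong)
  qed
  have "group ?P" using grp XT by simp
  then interpret \<phi>: group_hom "H C" ?P ?\<phi>
    by (intro group_hom.intro group_hom_axioms.intro grp CT \<phi>)
  interpret q: group_hom "H S" "H C" "h C S q"
    by (intro group_hom.intro group_hom_axioms.intro grp CT S hom q(1))
  show "?\<phi> \<in> iso (H C) ?P"
    unfolding \<phi>.iso_iff
  proof (intro conjI subsetI ballI impI)
    fix x assume "x \<in> carrier ?P"
    then have "\<forall>j\<in>J. x j \<in> carrier (H (X j))" by (auto simp: PiE_iff)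
    with glue[THEN spec, of x] obtain s where
      s: "s \<in> carrier (H S)" "\<And>j. j \<in> J \<Longrightarrow> h (X j) S (\<sigma> j) s = x j"
      by blast
    have "?\<phi> (h C S q s) = x"
      using \<open>x \<in> carrier ?P\<close> s h_\<sigma> by (auto simp: fun_eq_iff restrict_def PiE_def extensional_def)
    then show "x \<in> ?\<phi> ` carrier (H C)" using s(1) by (intro image_eqI[of _ _ "h C S q s"]) auto
  next
    fix c assume c: "c \<in> carrier (H C)" and "?\<phi> c = \<one>\<^bsub>?P\<^esub>"
    then have "h (X j) C (\<iota> j) c = \<one>\<^bsub>H (X j)\<^esub>" if "j \<in> J" for j
      using that by (auto simp: fun_eq_iff restrict_def split: if_splits)
    then have "h S C p c = \<one>\<^bsub>H S\<^esub>" using zero h_p h_\<iota> c by simp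
    with h_qp[OF c] show "c = \<one>\<^bsub>H C\<^esub>" by simp
  qed
qed

text \<open>
  Yoneda: \<open>a\<close> is the element that corresponds to the identity of the representing object.
\<close>

lemma representable_universal_element:
  assumes T: "category_laws T" and H: "cofunctor_to_Ab T H h" and rep: "representable T H h"
  obtains A a where "A \<in> Ob T" "a \<in> carrier (H A)"
    "\<And>X x. \<lbrakk>X \<in> Ob T; x \<in> carrier (H X)\<rbrakk> \<Longrightarrow> \<exists>f\<in>carrier (Hom T X A). h X A f a = x"
proof -
  obtain A \<eta> where A: "A \<in> Ob T" and iso: "\<And>X. X \<in> Ob T \<Longrightarrow> \<eta> X \<in> iso (H X) (Hom T X A)"
    and nat: "\<And>X Y f y. \<lbrakk>X \<in> Ob T; Y \<in> Ob T; f \<in> carrier (Hom T X Y); y \<in> carrier (H Y)\<rbrakk> \<Longrightarrow>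
      \<eta> X (h X Y f y) = Comp T X Y A (\<eta> Y y) f"
    using rep unfolding representable_def by blast
  have id: "Id T A \<in> carrier (Hom T A A)" using T A by (simp add: category_laws_def)
  moreover have "\<eta> A ` carrier (H A) = carrier (Hom T A A)"
    using iso[OF A] by (simp add: iso_def bij_betw_def)
  ultimately have "Id T A \<in> \<eta> A ` carrier (H A)" by simp
  then obtain a where a: "a \<in> carrier (H A)" "\<eta> A a = Id T A" by (elim imageE) simp
  show thesis
  proof (rule that[OF A a(1)])
    fix X x assume X: "X \<in> Ob T" and x: "x \<in> carrier (H X)"
    define f where "f = \<eta> X x"
    have f: "f \<in> carrier (Hom T X A)" using iso[OF X] x by (auto simp: f_def iso_def hom_def)
    have "\<eta> X (h X A f a) = \<eta> X x"
    proof -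
      have "Comp T X A A (Id T A) f = f" using T X A f by (simp add: category_laws_def)
      with nat[OF X A f a(1)] a(2) show ?thesis by (simp add: f_def)
    qed
    moreover have "h X A f a \<in> carrier (H X)"
    proof -
      have "h X A f \<in> hom (H A) (H X)" using H X A f by (simp add: cofunctor_to_Ab_def)
      then show ?thesis using a(1) by (rule hom_in_carrier)
    qed
    moreover have "inj_on (\<eta> X) (carrier (H X))" using iso[OF X] by (simp add: iso_def bij_betw_def)
    ultimately have "h X A f a = x" using x by (simp add: inj_on_eq_iff)
    with f show "\<exists>f\<in>carrier (Hom T X A). h X A f a = x" by blast
  qed
qed

section \<open>The homotopy category\<close>

type_synonym 'u homotopy_cat = "('u chain_complex, 'u hclass) tricat"

lemma big_ring_cring: "cring big_ring"
  by (rule cringI)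
    (auto simp: big_ring_def algebra_simps intro!: abelian_groupI comm_monoidI exI[of _ "- x" for x])

lemma big_ring_simps [simp]:
  "carrier big_ring = UNIV" "x \<otimes>\<^bsub>big_ring\<^esub> y = x * y" "\<one>\<^bsub>big_ring\<^esub> = 1"
  "x \<oplus>\<^bsub>big_ring\<^esub> y = x + y"
  by (simp_all add: big_ring_def)

lemma small_moduleI:
  assumes "abelian_group M" "small (carrier M)"
    and "\<And>r x. x \<in> carrier M \<Longrightarrow> r \<odot>\<^bsub>M\<^esub> x \<in> carrier M"
    and "\<And>r s x. x \<in> carrier M \<Longrightarrow> (r + s) \<odot>\<^bsub>M\<^esub> x = r \<odot>\<^bsub>M\<^esub> x \<oplus>\<^bsub>M\<^esub> s \<odot>\<^bsub>M\<^esub> x"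
    and "\<And>r x y. \<lbrakk>x \<in> carrier M; y \<in> carrier M\<rbrakk> \<Longrightarrow> r \<odot>\<^bsub>M\<^esub> (x \<oplus>\<^bsub>M\<^esub> y) = r \<odot>\<^bsub>M\<^esub> x \<oplus>\<^bsub>M\<^esub> r \<odot>\<^bsub>M\<^esub> y"
    and "\<And>r s x. x \<in> carrier M \<Longrightarrow> (r * s) \<odot>\<^bsub>M\<^esub> x = r \<odot>\<^bsub>M\<^esub> (s \<odot>\<^bsub>M\<^esub> x)"
    and "\<And>x. x \<in> carrier M \<Longrightarrow> 1 \<odot>\<^bsub>M\<^esub> x = x"
  shows "small_module M"
  unfolding small_module_def using assms by (auto intro!: moduleI big_ring_cring)

lemma small_moduleD:
  assumes "small_module M"
  shows "module big_ring M" "abelian_group M" "small (carrier M)"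
  using assms by (auto simp: small_module_def module_def)

lemma small_module_smult:
  assumes "small_module M" "x \<in> carrier M"
  shows "r \<odot>\<^bsub>M\<^esub> x \<in> carrier M"
  using module.smult_closed[OF small_moduleD(1)[OF assms(1)] _ assms(2)] by simp

lemma module_homI:
  assumes "\<And>x. x \<in> carrier M \<Longrightarrow> f x \<in> carrier N"
    and "\<And>x y. \<lbrakk>x \<in> carrier M; y \<in> carrier M\<rbrakk> \<Longrightarrow> f (x \<oplus>\<^bsub>M\<^esub> y) = f x \<oplus>\<^bsub>N\<^esub> f y"
    and "\<And>r x. x \<in> carrier M \<Longrightarrow> f (r \<odot>\<^bsub>M\<^esub> x) = r \<odot>\<^bsub>N\<^esub> f x"
  shows "f \<in> module_hom M N"
  using assms by (auto simp: module_hom_def)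

lemma module_homD:
  assumes "f \<in> module_hom M N" "x \<in> carrier M"
  shows "f x \<in> carrier N"
    and "y \<in> carrier M \<Longrightarrow> f (x \<oplus>\<^bsub>M\<^esub> y) = f x \<oplus>\<^bsub>N\<^esub> f y"
    and "f (r \<odot>\<^bsub>M\<^esub> x) = r \<odot>\<^bsub>N\<^esub> f x"
  using assms by (auto simp: module_hom_def)

lemma module_hom_zero:
  assumes "small_module M" "small_module N" "f \<in> module_hom M N"
  shows "f \<zero>\<^bsub>M\<^esub> = \<zero>\<^bsub>N\<^esub>"
proof -
  interpret M: abelian_group M using assms by (simp add: small_moduleD)
  interpret N: abelian_group N using assms by (simp add: small_moduleD)
  have "f \<zero>\<^bsub>M\<^esub> \<oplus>\<^bsub>N\<^esub> f \<zero>\<^bsub>M\<^esub> = f \<zero>\<^bsub>M\<^esub>"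
    using module_homD(2)[OF assms(3) M.zero_closed M.zero_closed] by simp
  then show ?thesis using module_homD(1)[OF assms(3) M.zero_closed] by (simp add: N.add.r_cancel_one')
qed

lemma module_hom_minus:
  assumes "small_module M" "small_module N" "f \<in> module_hom M N" "x \<in> carrier M"
  shows "f (\<ominus>\<^bsub>M\<^esub> x) = \<ominus>\<^bsub>N\<^esub> f x"
proof -
  interpret M: abelian_group M using assms by (simp add: small_moduleD)
  interpret N: abelian_group N using assms by (simp add: small_moduleD)
  have "f (\<ominus>\<^bsub>M\<^esub> x) \<oplus>\<^bsub>N\<^esub> f x = \<zero>\<^bsub>N\<^esub>"
    using module_homD(2)[OF assms(3) M.a_inv_closed[OF assms(4)] assms(4)] assms(4)
      module_hom_zero[OF assms(1-3)] by (simp add: M.l_neg)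
  then show ?thesis using module_homD(1)[OF assms(3)] assms(4) by (simp add: N.minus_equality)
qed

lemma module_hom_comp: "\<lbrakk>f \<in> module_hom M N; g \<in> module_hom N P\<rbrakk> \<Longrightarrow> g \<circ> f \<in> module_hom M P"
  by (auto simp: module_hom_def Pi_iff)

lemma module_hom_zero_map:
  assumes "small_module N"
  shows "(\<lambda>x. \<zero>\<^bsub>N\<^esub>) \<in> module_hom M N"
proof -
  interpret N: module big_ring N using assms by (rule small_moduleD)
  show ?thesis by (rule module_homI) auto
qed

lemma module_hom_add:
  assumes "small_module N" "f \<in> module_hom M N" "g \<in> module_hom M N"
  shows "(\<lambda>x. f x \<oplus>\<^bsub>N\<^esub> g x) \<in> module_hom M N"
proof -
  interpret N: module big_ring N using assms by (intro small_moduleD)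
  show ?thesis
    using assms(2,3) by (intro module_homI) (simp_all add: module_homD N.a_ac N.smult_r_distr)
qed

lemma module_hom_uminus:
  assumes "small_module N" "f \<in> module_hom M N"
  shows "(\<lambda>x. \<ominus>\<^bsub>N\<^esub> f x) \<in> module_hom M N"
proof -
  interpret N: module big_ring N using assms by (intro small_moduleD)
  show ?thesis
    using assms(2) by (intro module_homI) (simp_all add: module_homD N.minus_add N.smult_r_minus)
qed

lemma complexD:
  assumes "X \<in> chain_complexes"
  shows "small_module (cmod X k)" "abelian_group (cmod X k)"
    and "cdiff X k \<in> module_hom (cmod X k) (cmod X (k - 1))"
    and "cdiff X k \<in> extensional (carrier (cmod X k))"
    and "x \<in> carrier (cmod X k) \<Longrightarrow> cdiff X (k - 1) (cdiff X k x) = \<zero>\<^bsub>cmod X (k - 2)\<^esub>"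
  using assms by (auto simp: chain_complexes_def small_moduleD)

lemma complex_diff_from_above:
  assumes "X \<in> chain_complexes"
  shows "cdiff X (k + 1) \<in> module_hom (cmod X (k + 1)) (cmod X k)"
    and "x \<in> carrier (cmod X (k + 1)) \<Longrightarrow> cdiff X k (cdiff X (k + 1) x) = \<zero>\<^bsub>cmod X (k - 1)\<^esub>"
  using complexD(3)[OF assms, of "k + 1"] complexD(5)[OF assms, of x "k + 1"] by simp_all

lemma complex_diff_closed:
  assumes "X \<in> chain_complexes"
  shows "x \<in> carrier (cmod X k) \<Longrightarrow> cdiff X k x \<in> carrier (cmod X (k - 1))"
    and "x \<in> carrier (cmod X (k + 1)) \<Longrightarrow> cdiff X (k + 1) x \<in> carrier (cmod X k)"
  using complexD(3)[OF assms] complex_diff_from_above(1)[OF assms] by (auto dest: module_homD(1))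

lemma chain_mapI:
  assumes "\<And>k. f k \<in> module_hom (cmod X k) (cmod Y k)"
    and "\<And>k x. x \<in> carrier (cmod X k) \<Longrightarrow> cdiff Y k (f k x) = f (k - 1) (cdiff X k x)"
  shows "f \<in> chain_maps X Y"
  using assms by (auto simp: chain_maps_def)

lemma chain_mapD:
  assumes "f \<in> chain_maps X Y"
  shows "f k \<in> module_hom (cmod X k) (cmod Y k)"
    and "x \<in> carrier (cmod X k) \<Longrightarrow> f k x \<in> carrier (cmod Y k)"
    and "x \<in> carrier (cmod X k) \<Longrightarrow> cdiff Y k (f k x) = f (k - 1) (cdiff X k x)"
    and "x \<in> carrier (cmod X (k + 1)) \<Longrightarrow> cdiff Y (k + 1) (f (k + 1) x) = f k (cdiff X (k + 1) x)"
proof -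
  have *: "\<And>k. f k \<in> module_hom (cmod X k) (cmod Y k)"
      "\<And>k x. x \<in> carrier (cmod X k) \<Longrightarrow> cdiff Y k (f k x) = f (k - 1) (cdiff X k x)"
    using assms by (auto simp: chain_maps_def)
  then show "f k \<in> module_hom (cmod X k) (cmod Y k)"
    "x \<in> carrier (cmod X k) \<Longrightarrow> f k x \<in> carrier (cmod Y k)"
    "x \<in> carrier (cmod X k) \<Longrightarrow> cdiff Y k (f k x) = f (k - 1) (cdiff X k x)"
    by (auto dest: module_homD(1))
  show "x \<in> carrier (cmod X (k + 1)) \<Longrightarrow> cdiff Y (k + 1) (f (k + 1) x) = f k (cdiff X (k + 1) x)"
    using *(2)[of x "k + 1"] by simp
qed

lemma chain_map_id: "(\<lambda>k x. x) \<in> chain_maps X X"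
  by (auto simp: chain_maps_def module_hom_def)

lemma chain_map_comp:
  assumes "f \<in> chain_maps X Y" "g \<in> chain_maps Y Z"
  shows "(\<lambda>k. g k \<circ> f k) \<in> chain_maps X Z"
proof (rule chain_mapI)
  show "g k \<circ> f k \<in> module_hom (cmod X k) (cmod Z k)" for k
    using chain_mapD(1)[OF assms(1)] chain_mapD(1)[OF assms(2)] by (rule module_hom_comp)
qed (use assms in \<open>simp add: chain_mapD\<close>)

text \<open>
  The equation \<open>f - g = d s + s d\<close> is solved for \<open>f\<close>, so that homotopies can be added and composed by
  associativity and commutativity alone.
\<close>

definition homotopy ::
  "'u::universe chain_complex \<Rightarrow> 'u chain_complex \<Rightarrow> (int \<Rightarrow> 'u \<Rightarrow> 'u) \<Rightarrow> (int \<Rightarrow> 'u \<Rightarrow> 'u)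
    \<Rightarrow> (int \<Rightarrow> 'u \<Rightarrow> 'u) \<Rightarrow> bool" where
  "homotopy X Y s f g \<longleftrightarrow> (\<forall>k. s k \<in> module_hom (cmod X k) (cmod Y (k + 1)) \<and>
     (\<forall>x\<in>carrier (cmod X k). f k x = g k x \<oplus>\<^bsub>cmod Y k\<^esub>
        (cdiff Y (k + 1) (s k x) \<oplus>\<^bsub>cmod Y k\<^esub> s (k - 1) (cdiff X k x))))"

lemma homotopyI:
  assumes "\<And>k. s k \<in> module_hom (cmod X k) (cmod Y (k + 1))"
    and "\<And>k x. x \<in> carrier (cmod X k) \<Longrightarrow> f k x = g k x \<oplus>\<^bsub>cmod Y k\<^esub>
        (cdiff Y (k + 1) (s k x) \<oplus>\<^bsub>cmod Y k\<^esub> s (k - 1) (cdiff X k x))"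
  shows "homotopy X Y s f g"
  using assms by (auto simp: homotopy_def)

lemma homotopyD:
  assumes "homotopy X Y s f g"
  shows "s k \<in> module_hom (cmod X k) (cmod Y (k + 1))"
    and "s (k - 1) \<in> module_hom (cmod X (k - 1)) (cmod Y k)"
    and "x \<in> carrier (cmod X k) \<Longrightarrow> f k x = g k x \<oplus>\<^bsub>cmod Y k\<^esub>
        (cdiff Y (k + 1) (s k x) \<oplus>\<^bsub>cmod Y k\<^esub> s (k - 1) (cdiff X k x))"
proof -
  have *: "\<And>k. s k \<in> module_hom (cmod X k) (cmod Y (k + 1))"
    using assms by (auto simp: homotopy_def)
  show "s k \<in> module_hom (cmod X k) (cmod Y (k + 1))" by (rule *)
  show "s (k - 1) \<in> module_hom (cmod X (k - 1)) (cmod Y k)" using *[of "k - 1"] by simp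
  show "x \<in> carrier (cmod X k) \<Longrightarrow> f k x = g k x \<oplus>\<^bsub>cmod Y k\<^esub>
        (cdiff Y (k + 1) (s k x) \<oplus>\<^bsub>cmod Y k\<^esub> s (k - 1) (cdiff X k x))"
    using assms by (auto simp: homotopy_def)
qed

lemma homotopy_closed:
  assumes "X \<in> chain_complexes" "Y \<in> chain_complexes" "homotopy X Y s f g" "x \<in> carrier (cmod X k)"
  shows "s k x \<in> carrier (cmod Y (k + 1))"
    and "s (k - 1) (cdiff X k x) \<in> carrier (cmod Y k)"
    and "cdiff Y (k + 1) (s k x) \<in> carrier (cmod Y k)"
proof -
  show s: "s k x \<in> carrier (cmod Y (k + 1))"
    using homotopyD(1)[OF assms(3)] assms(4) by (rule module_homD(1))
  show "s (k - 1) (cdiff X k x) \<in> carrier (cmod Y k)"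
    using homotopyD(2)[OF assms(3)] complex_diff_closed(1)[OF assms(1,4)] by (rule module_homD(1))
  show "cdiff Y (k + 1) (s k x) \<in> carrier (cmod Y k)"
    using assms(2) s by (rule complex_diff_closed(2))
qed

lemma (in abelian_group) uminus_zero [simp]: "\<ominus> \<zero> = \<zero>"
  by (rule minus_equality) simp_all

lemma (in abelian_group) add_eq_zero_iff:
  "\<lbrakk>a \<in> carrier G; b \<in> carrier G\<rbrakk> \<Longrightarrow> a \<oplus> b = \<zero> \<longleftrightarrow> b = \<ominus> a"
  using minus_equality[of b a] a_comm[of a b] r_neg[of a] by auto

lemma (in abelian_group) minus_eq_iff:
  "\<lbrakk>a \<in> carrier G; b \<in> carrier G; c \<in> carrier G\<rbrakk> \<Longrightarrow> a \<ominus> b = c \<longleftrightarrow> a = b \<oplus> c"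
  by (metis a_comm a_minus_def add.inv_solve_right')

lemma chain_homotopic_iff:
  assumes "X \<in> chain_complexes" "Y \<in> chain_complexes" "f \<in> chain_maps X Y" "g \<in> chain_maps X Y"
  shows "chain_homotopic X Y f g \<longleftrightarrow> (\<exists>s. homotopy X Y s f g)"
proof -
  have "f k x \<ominus>\<^bsub>cmod Y k\<^esub> g k x = cdiff Y (k + 1) (s k x) \<oplus>\<^bsub>cmod Y k\<^esub> s (k - 1) (cdiff X k x) \<longleftrightarrow>
      f k x = g k x \<oplus>\<^bsub>cmod Y k\<^esub> (cdiff Y (k + 1) (s k x) \<oplus>\<^bsub>cmod Y k\<^esub> s (k - 1) (cdiff X k x))"
    if s: "\<And>k. s k \<in> module_hom (cmod X k) (cmod Y (k + 1))" and x: "x \<in> carrier (cmod X k)" for s k x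
  proof -
    interpret Yk: abelian_group "cmod Y k" using assms(2) by (rule complexD)
    have "s (k - 1) (cdiff X k x) \<in> carrier (cmod Y k)"
      using module_homD(1)[OF s[of "k - 1"]] x assms by (simp add: complex_diff_closed)
    moreover have "cdiff Y (k + 1) (s k x) \<in> carrier (cmod Y k)"
      using module_homD(1)[OF s[of k]] x assms by (simp add: complex_diff_closed)
    ultimately show ?thesis using assms x by (intro Yk.minus_eq_iff) (auto simp: chain_mapD)
  qed
  then show ?thesis
    unfolding chain_homotopic_def homotopy_def by (intro ex_cong1) meson
qed

context
  fixes X Y :: "'u::universe chain_complex"
  assumes X: "X \<in> chain_complexes" and Y: "Y \<in> chain_complexes"
begin

lemma homotopy_refl:
  assumes "f \<in> chain_maps X Y"
  shows "homotopy X Y (\<lambda>k x. \<zero>\<^bsub>cmod Y (k + 1)\<^esub>) f f"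
proof (rule homotopyI)
  fix k x assume x: "x \<in> carrier (cmod X k)"
  interpret Yk: abelian_group "cmod Y k" using Y by (rule complexD)
  have "cdiff Y (k + 1) \<zero>\<^bsub>cmod Y (k + 1)\<^esub> = \<zero>\<^bsub>cmod Y k\<^esub>"
    using module_hom_zero[OF complexD(1)[OF Y] complexD(1)[OF Y] complex_diff_from_above(1)[OF Y]] .
  then show "f k x = f k x \<oplus>\<^bsub>cmod Y k\<^esub>
      (cdiff Y (k + 1) \<zero>\<^bsub>cmod Y (k + 1)\<^esub> \<oplus>\<^bsub>cmod Y k\<^esub> \<zero>\<^bsub>cmod Y (k - 1 + 1)\<^esub>)"
    using chain_mapD(2)[OF assms x] by simp
qed (intro module_hom_zero_map complexD Y)

lemma homotopy_sym:
  assumes "homotopy X Y s f g" "g \<in> chain_maps X Y"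
  shows "homotopy X Y (\<lambda>k x. \<ominus>\<^bsub>cmod Y (k + 1)\<^esub> s k x) g f"
proof (rule homotopyI)
  fix k x assume x: "x \<in> carrier (cmod X k)"
  interpret Yk: abelian_group "cmod Y k" using Y by (rule complexD)
  note c = homotopy_closed[OF X Y assms(1) x] chain_mapD(2)[OF assms(2) x]
  have "cdiff Y (k + 1) (\<ominus>\<^bsub>cmod Y (k + 1)\<^esub> s k x) = \<ominus>\<^bsub>cmod Y k\<^esub> cdiff Y (k + 1) (s k x)"
    using module_hom_minus[OF complexD(1)[OF Y] complexD(1)[OF Y] complex_diff_from_above(1)[OF Y] c(1)] .
  then show "g k x = f k x \<oplus>\<^bsub>cmod Y k\<^esub> (cdiff Y (k + 1) (\<ominus>\<^bsub>cmod Y (k + 1)\<^esub> s k x)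
      \<oplus>\<^bsub>cmod Y k\<^esub> \<ominus>\<^bsub>cmod Y (k - 1 + 1)\<^esub> s (k - 1) (cdiff X k x))"
    using c homotopyD(3)[OF assms(1) x] by (simp add: Yk.a_assoc Yk.r_neg flip: Yk.minus_add)
qed (intro module_hom_uminus complexD Y homotopyD(1)[OF assms(1)])

lemma homotopy_trans:
  assumes "homotopy X Y s f g" "homotopy X Y t g e" "e \<in> chain_maps X Y"
  shows "homotopy X Y (\<lambda>k x. s k x \<oplus>\<^bsub>cmod Y (k + 1)\<^esub> t k x) f e"
proof (rule homotopyI)
  fix k x assume x: "x \<in> carrier (cmod X k)"
  interpret Yk: abelian_group "cmod Y k" using Y by (rule complexD)
  note c = homotopy_closed[OF X Y assms(1) x] homotopy_closed[OF X Y assms(2) x] chain_mapD(2)[OF assms(3) x]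
  show "f k x = e k x \<oplus>\<^bsub>cmod Y k\<^esub> (cdiff Y (k + 1) (s k x \<oplus>\<^bsub>cmod Y (k + 1)\<^esub> t k x)
      \<oplus>\<^bsub>cmod Y k\<^esub> (s (k - 1) (cdiff X k x) \<oplus>\<^bsub>cmod Y (k - 1 + 1)\<^esub> t (k - 1) (cdiff X k x)))"
    using c homotopyD(3)[OF assms(1) x] homotopyD(3)[OF assms(2) x]
      module_homD(2)[OF complex_diff_from_above(1)[OF Y] c(1,4)] by (simp add: Yk.a_ac)
qed (intro module_hom_add complexD Y homotopyD(1)[OF assms(1)] homotopyD(1)[OF assms(2)])

lemma mem_homotopy_class:
  "f \<in> chain_maps X Y \<Longrightarrow> g \<in> homotopy_class X Y f \<longleftrightarrow> g \<in> chain_maps X Y \<and> (\<exists>s. homotopy X Y s f g)"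
  using chain_homotopic_iff[OF X Y] by (auto simp: homotopy_class_def)

lemma homotopy_class_eq:
  assumes "f \<in> chain_maps X Y" "g \<in> chain_maps X Y" "homotopy X Y s f g"
  shows "homotopy_class X Y f = homotopy_class X Y g"
proof (rule Set.set_eqI)
  fix e
  show "e \<in> homotopy_class X Y f \<longleftrightarrow> e \<in> homotopy_class X Y g"
    unfolding mem_homotopy_class[OF assms(1)] mem_homotopy_class[OF assms(2)]
    using homotopy_trans[OF assms(3), of _ e] homotopy_trans[OF homotopy_sym[OF assms(3,2)], of _ e] by blast
qed

lemma mem_homotopy_class_self: "f \<in> chain_maps X Y \<Longrightarrow> f \<in> homotopy_class X Y f"
  using homotopy_refl mem_homotopy_class by blast

lemma homotopy_class_in_K_Hom: "f \<in> chain_maps X Y \<Longrightarrow> homotopy_class X Y f \<in> carrier (K_Hom X Y)"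
  by (simp add: K_Hom_def)

lemma K_HomE:
  assumes "F \<in> carrier (K_Hom X Y)"
  obtains f where "f \<in> chain_maps X Y" "F = homotopy_class X Y f"
  using assms by (auto simp: K_Hom_def)

lemma K_Hom_memD:
  assumes F: "F \<in> carrier (K_Hom X Y)" and f: "f \<in> F"
  shows "f \<in> chain_maps X Y" "F = homotopy_class X Y f"
proof -
  obtain e where e: "e \<in> chain_maps X Y" "F = homotopy_class X Y e" using F by (rule K_HomE)
  with f obtain s where s: "f \<in> chain_maps X Y" "homotopy X Y s e f" by (auto simp: mem_homotopy_class)
  then show "f \<in> chain_maps X Y" by simp
  show "F = homotopy_class X Y f" using homotopy_class_eq[OF e(1) s] e(2) by simp
qed

lemma K_Hom_homotopy:
  assumes F: "F \<in> carrier (K_Hom X Y)" and fg: "f \<in> F" "g \<in> F"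
  obtains s where "homotopy X Y s f g"
proof -
  have "g \<in> homotopy_class X Y f" using K_Hom_memD(2)[OF F fg(1)] fg(2) by simp
  then show ?thesis using that by (auto simp: mem_homotopy_class[OF K_Hom_memD(1)[OF F fg(1)]])
qed

end

text \<open>
  One factor is changed at a time, because both \<open>g s\<close> and \<open>t f'\<close> are homotopies.
\<close>

lemma homotopy_comp:
  assumes XYZ: "X \<in> chain_complexes" "Y \<in> chain_complexes" "Z \<in> chain_complexes"
    and f: "f \<in> chain_maps X Y" "f' \<in> chain_maps X Y" "homotopy X Y s f f'"
    and g: "g \<in> chain_maps Y Z" "g' \<in> chain_maps Y Z" "homotopy Y Z t g g'"
  shows "homotopy_class X Z (\<lambda>k. g k \<circ> f k) = homotopy_class X Z (\<lambda>k. g' k \<circ> f' k)"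
proof -
  have "homotopy X Z (\<lambda>k. g (k + 1) \<circ> s k) (\<lambda>k. g k \<circ> f k) (\<lambda>k. g k \<circ> f' k)"
  proof (rule homotopyI)
    fix k x assume x: "x \<in> carrier (cmod X k)"
    note c = homotopy_closed[OF XYZ(1,2) f(3) x] chain_mapD(2)[OF f(2) x]
    interpret Yk: abelian_group "cmod Y k" using XYZ(2) by (rule complexD)
    show "(g k \<circ> f k) x = (g k \<circ> f' k) x \<oplus>\<^bsub>cmod Z k\<^esub> (cdiff Z (k + 1) ((g (k + 1) \<circ> s k) x)
        \<oplus>\<^bsub>cmod Z k\<^esub> (g (k - 1 + 1) \<circ> s (k - 1)) (cdiff X k x))"
      using c homotopyD(3)[OF f(3) x] chain_mapD(4)[OF g(1) c(1)] by (simp add: module_homD(2)[OF chain_mapD(1)[OF g(1)]])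
  qed (rule module_hom_comp[OF homotopyD(1)[OF f(3)] chain_mapD(1)[OF g(1)]])
  moreover have "homotopy X Z (\<lambda>k. t k \<circ> f' k) (\<lambda>k. g k \<circ> f' k) (\<lambda>k. g' k \<circ> f' k)"
  proof (rule homotopyI)
    fix k x assume x: "x \<in> carrier (cmod X k)"
    show "(g k \<circ> f' k) x = (g' k \<circ> f' k) x \<oplus>\<^bsub>cmod Z k\<^esub> (cdiff Z (k + 1) ((t k \<circ> f' k) x)
        \<oplus>\<^bsub>cmod Z k\<^esub> (t (k - 1) \<circ> f' (k - 1)) (cdiff X k x))"
      using homotopyD(3)[OF g(3) chain_mapD(2)[OF f(2) x]] chain_mapD(3)[OF f(2) x] by simp
  qed (rule module_hom_comp[OF chain_mapD(1)[OF f(2)] homotopyD(1)[OF g(3)]])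
  ultimately show ?thesis
    using homotopy_class_eq[OF XYZ(1,3)] chain_map_comp[OF f(1) g(1)] chain_map_comp[OF f(2) g(1)]
      chain_map_comp[OF f(2) g(2)] by simp
qed

text \<open>
  The union that defines the composite ranges over representatives that all give the same class.
\<close>

lemma K_Comp_homotopy_class:
  assumes XYZ: "X \<in> chain_complexes" "Y \<in> chain_complexes" "Z \<in> chain_complexes"
    and f: "f \<in> chain_maps X Y" and g: "g \<in> chain_maps Y Z"
  shows "K_Comp X Y Z (homotopy_class Y Z g) (homotopy_class X Y f) = homotopy_class X Z (\<lambda>k. g k \<circ> f k)"
proof -
  have "homotopy_class X Z (\<lambda>k. g' k \<circ> f' k) = homotopy_class X Z (\<lambda>k. g k \<circ> f k)"
    if f': "f' \<in> homotopy_class X Y f" and g': "g' \<in> homotopy_class Y Z g" for f' g'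
  proof -
    obtain s t where s: "f' \<in> chain_maps X Y" "homotopy X Y s f f'" and t: "g' \<in> chain_maps Y Z" "homotopy Y Z t g g'"
      using f' g' mem_homotopy_class[OF XYZ(1,2) f] mem_homotopy_class[OF XYZ(2,3) g] by auto
    then show ?thesis using homotopy_comp[OF XYZ f s g t] by simp
  qed
  then have "K_Comp X Y Z (homotopy_class Y Z g) (homotopy_class X Y f) =
      (\<Union>g'\<in>homotopy_class Y Z g. \<Union>f'\<in>homotopy_class X Y f. homotopy_class X Z (\<lambda>k. g k \<circ> f k))"
    unfolding K_Comp_def by (intro SUP_cong refl)
  moreover have "homotopy_class X Y f \<noteq> {}" "homotopy_class Y Z g \<noteq> {}"
    using mem_homotopy_class_self[OF XYZ(1,2) f] mem_homotopy_class_self[OF XYZ(2,3) g] by auto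
  ultimately show ?thesis by simp
qed

lemma K_cat_simps [simp]:
  "Ob K_cat_without_triangles = chain_complexes" "Hom K_cat_without_triangles = K_Hom"
  "Comp K_cat_without_triangles = K_Comp" "Id K_cat_without_triangles = K_Id"
  "Ob K_cat = chain_complexes" "Hom K_cat = K_Hom" "Comp K_cat = K_Comp" "Id K_cat = K_Id"
  "Shift K_cat = shift_complex" "ShiftHom K_cat = K_ShiftHom" "Triangles K_cat = K_Triangles"
  by (simp_all add: K_cat_def K_cat_without_triangles_def)

lemma is_isomorphism_K_cat: "is_isomorphism K_cat_without_triangles = is_isomorphism K_cat"
  by (simp add: is_isomorphism_def fun_eq_iff)

lemma K_category_laws: "category_laws K_cat"
  unfolding category_laws_def K_cat_simps
proof (intro conjI ballI)
  fix X Y F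
  assume XY: "X \<in> chain_complexes" "Y \<in> chain_complexes" and "F \<in> carrier (K_Hom X Y)"
  then obtain f where f: "f \<in> chain_maps X Y" "F = homotopy_class X Y f" using K_HomE by blast
  show "K_Comp X Y Y (K_Id Y) F = F" "K_Comp X X Y F (K_Id X) = F"
    using K_Comp_homotopy_class[OF XY(1,2,2) f(1) chain_map_id]
      K_Comp_homotopy_class[OF XY(1,1,2) chain_map_id f(1)] by (simp_all add: K_Id_def f(2) comp_def)
next
  fix X Y Z F G
  assume XYZ: "X \<in> chain_complexes" "Y \<in> chain_complexes" "Z \<in> chain_complexes"
    and "F \<in> carrier (K_Hom X Y)" "G \<in> carrier (K_Hom Y Z)"
  then obtain f g where "f \<in> chain_maps X Y" "F = homotopy_class X Y f"
    "g \<in> chain_maps Y Z" "G = homotopy_class Y Z g" by (metis K_HomE)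
  then show "K_Comp X Y Z G F \<in> carrier (K_Hom X Z)"
    using XYZ by (simp add: K_Comp_homotopy_class homotopy_class_in_K_Hom chain_map_comp)
next
  fix X Y Z W F G K
  assume XYZ: "X \<in> chain_complexes" "Y \<in> chain_complexes" "Z \<in> chain_complexes" "W \<in> chain_complexes"
    and FGK: "F \<in> carrier (K_Hom X Y)" "G \<in> carrier (K_Hom Y Z)" "K \<in> carrier (K_Hom Z W)"
  obtain f g k where "f \<in> chain_maps X Y" "F = homotopy_class X Y f"
    "g \<in> chain_maps Y Z" "G = homotopy_class Y Z g" "k \<in> chain_maps Z W" "K = homotopy_class Z W k"
    using XYZ FGK by (metis K_HomE)
  then show "K_Comp X Z W K (K_Comp X Y Z G F) = K_Comp X Y W (K_Comp Y Z W K G) F"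
    using XYZ by (simp add: K_Comp_homotopy_class chain_map_comp o_assoc)
qed (simp add: K_Id_def homotopy_class_in_K_Hom chain_map_id)

subsection \<open>Shifts\<close>

lemma complexI:
  assumes "\<And>k. small_module (cmod X k)"
    and "\<And>k. cdiff X k \<in> module_hom (cmod X k) (cmod X (k - 1))"
    and "\<And>k. cdiff X k \<in> extensional (carrier (cmod X k))"
    and "\<And>k x. x \<in> carrier (cmod X k) \<Longrightarrow> cdiff X (k - 1) (cdiff X k x) = \<zero>\<^bsub>cmod X (k - 2)\<^esub>"
  shows "X \<in> chain_complexes"
  using assms by (simp add: chain_complexes_def)

lemma cmod_shift [simp]: "cmod (shift_complex n X) k = cmod X (k - n)"
  by (simp add: shift_complex_def)

lemma cdiff_shift: "cdiff (shift_complex n X) k x =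
    (if even n then cdiff X (k - n) x else \<ominus>\<^bsub>cmod X (k - n - 1)\<^esub> cdiff X (k - n) x)"
  if "x \<in> carrier (cmod X (k - n))"
  using that by (simp add: shift_complex_def)

lemma shift_complex_closed:
  assumes X: "X \<in> chain_complexes"
  shows "shift_complex n X \<in> chain_complexes"
proof (rule complexI)
  fix k
  have idx: "k - 1 - n = k - n - 1" "k - 2 - n = k - n - 2" "k - n - 1 - 1 = k - n - 2" by simp_all
  show "small_module (cmod (shift_complex n X) k)" using X by (simp add: complexD)
  show "cdiff (shift_complex n X) k \<in> extensional (carrier (cmod (shift_complex n X) k))"
    by (simp add: shift_complex_def)
  have d: "cdiff (shift_complex n X) k x \<in> carrier (cmod X (k - n - 1))" if "x \<in> carrier (cmod X (k - n))" for x
    using that complex_diff_closed(1)[OF X that] abelian_group.a_inv_closed[OF complexD(2)[OF X]]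
    by (simp add: cdiff_shift)
  show "cdiff (shift_complex n X) k \<in> module_hom (cmod (shift_complex n X) k) (cmod (shift_complex n X) (k - 1))"
  proof -
    interpret Xk: module big_ring "cmod X (k - n)" using X by (intro small_moduleD complexD)
    have "(\<lambda>x. if even n then cdiff X (k - n) x else \<ominus>\<^bsub>cmod X (k - n - 1)\<^esub> cdiff X (k - n) x)
        \<in> module_hom (cmod X (k - n)) (cmod X (k - n - 1))"
      using module_hom_uminus[OF complexD(1)[OF X] complexD(3)[OF X]] complexD(3)[OF X, of "k - n"]
      by (cases "even n") simp_all
    then show ?thesis
      by (simp add: module_hom_def cdiff_shift idx Xk.smult_closed Pi_iff)
  qed
  fix x assume "x \<in> carrier (cmod (shift_complex n X) k)"
  then have x: "x \<in> carrier (cmod X (k - n))" by simp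
  have z: "cdiff X (k - n - 1) (cdiff X (k - n) x) = \<zero>\<^bsub>cmod X (k - n - 2)\<^esub>"
    using complexD(5)[OF X x] .
  interpret N: abelian_group "cmod X (k - n - 2)" using X by (rule complexD)
  have d1: "cdiff X (k - n - 1) \<in> module_hom (cmod X (k - n - 1)) (cmod X (k - n - 2))"
    using complexD(3)[OF X, of "k - n - 1"] by (simp add: idx)
  have "cdiff X (k - n - 1) (\<ominus>\<^bsub>cmod X (k - n - 1)\<^esub> cdiff X (k - n) x) = \<zero>\<^bsub>cmod X (k - n - 2)\<^esub>"
    using module_hom_minus[OF complexD(1)[OF X] complexD(1)[OF X] d1 complex_diff_closed(1)[OF X x]] z by simp
  then show "cdiff (shift_complex n X) (k - 1) (cdiff (shift_complex n X) k x) = \<zero>\<^bsub>cmod (shift_complex n X) (k - 2)\<^esub>"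
    using cdiff_shift[of "cdiff (shift_complex n X) k x" X "k - 1" n] d[OF x] z
    by (simp add: idx cdiff_shift[OF x])
qed

text \<open>
  Equality on the nose: the two signs cancel, and differentials are determined by their values on
  the modules.  It is what makes sense of reading a triangle backwards: the desuspension of its last
  object, suspended again, has to be that object.
\<close>

lemma shift_complex_inverse:
  assumes X: "X \<in> chain_complexes"
  shows "shift_complex 1 (shift_complex (- 1) X) = X"
proof -
  have "cdiff (shift_complex 1 (shift_complex (- 1) X)) k = cdiff X k" for k
  proof
    fix x
    show "cdiff (shift_complex 1 (shift_complex (- 1) X)) k x = cdiff X k x"
    proof (cases "x \<in> carrier (cmod X k)")
      case True
      interpret N: abelian_group "cmod X (k - 1)" using X by (rule complexD)
      show ?thesis
        using True complex_diff_closed(1)[OF X True] by (simp add: cdiff_shift N.minus_minus)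
    next
      case False
      then show ?thesis
        using complexD(4)[OF X, of k] by (simp add: shift_complex_def extensional_def)
    qed
  qed
  then show ?thesis
    by (intro chain_complex.equality) (auto simp: fun_eq_iff)
qed

lemma shift_chain_map:
  assumes XY: "X \<in> chain_complexes" "Y \<in> chain_complexes" and f: "f \<in> chain_maps X Y"
  shows "(\<lambda>k. f (k - n)) \<in> chain_maps (shift_complex n X) (shift_complex n Y)"
proof (rule chain_mapI)
  fix k
  show "f (k - n) \<in> module_hom (cmod (shift_complex n X) k) (cmod (shift_complex n Y) k)"
    using chain_mapD(1)[OF f] by simp
  fix x assume "x \<in> carrier (cmod (shift_complex n X) k)"
  then have x: "x \<in> carrier (cmod X (k - n))" by simp
  have idx: "k - 1 - n = k - n - 1" by simp
  show "cdiff (shift_complex n Y) k (f (k - n) x) = f (k - 1 - n) (cdiff (shift_complex n X) k x)"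
    unfolding idx using x chain_mapD(2,3)[OF f x]
      module_hom_minus[OF complexD(1)[OF XY(1)] complexD(1)[OF XY(2)] chain_mapD(1)[OF f] complex_diff_closed(1)[OF XY(1) x]]
    by (simp add: cdiff_shift)
qed

text \<open>
  An odd shift changes the sign of both differentials, so the homotopy has to change its sign.
\<close>

lemma shift_homotopy:
  assumes XY: "X \<in> chain_complexes" "Y \<in> chain_complexes"
    and f: "f \<in> chain_maps X Y" "g \<in> chain_maps X Y" and s: "homotopy X Y s f g"
  shows "homotopy (shift_complex n X) (shift_complex n Y)
    (\<lambda>k x. if even n then s (k - n) x else \<ominus>\<^bsub>cmod Y (k - n + 1)\<^esub> s (k - n) x)
    (\<lambda>k. f (k - n)) (\<lambda>k. g (k - n))"
proof (rule homotopyI)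
  fix k
  have idx: "k + 1 - n = k - n + 1" "k - 1 - n = k - n - 1" "k - n - 1 + 1 = k - n" "k - n + 1 - 1 = k - n" by simp_all
  show "(\<lambda>x. if even n then s (k - n) x else \<ominus>\<^bsub>cmod Y (k - n + 1)\<^esub> s (k - n) x)
      \<in> module_hom (cmod (shift_complex n X) k) (cmod (shift_complex n Y) (k + 1))"
    using homotopyD(1)[OF s, of "k - n"] module_hom_uminus[OF complexD(1)[OF XY(2)]]
    by (cases "even n") (simp_all add: idx)
  fix x assume "x \<in> carrier (cmod (shift_complex n X) k)"
  then have x: "x \<in> carrier (cmod X (k - n))" by simp
  note c = homotopy_closed[OF XY s x] complex_diff_closed(1)[OF XY(1) x]
  interpret N: abelian_group "cmod Y (k - n)" using XY(2) by (rule complexD)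
  interpret N': abelian_group "cmod Y (k - n + 1)" using XY(2) by (rule complexD)
  have 1: "s (k - n - 1) (\<ominus>\<^bsub>cmod X (k - n - 1)\<^esub> cdiff X (k - n) x) = \<ominus>\<^bsub>cmod Y (k - n)\<^esub> s (k - n - 1) (cdiff X (k - n) x)"
    using module_hom_minus[OF complexD(1)[OF XY(1)] complexD(1)[OF XY(2)] homotopyD(2)[OF s] c(4)] .
  have 2: "cdiff Y (k - n + 1) (\<ominus>\<^bsub>cmod Y (k - n + 1)\<^esub> s (k - n) x) = \<ominus>\<^bsub>cmod Y (k - n)\<^esub> cdiff Y (k - n + 1) (s (k - n) x)"
    using module_hom_minus[OF complexD(1)[OF XY(2)] complexD(1)[OF XY(2)] complex_diff_from_above(1)[OF XY(2)] c(1)] .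
  show "f (k - n) x = g (k - n) x \<oplus>\<^bsub>cmod (shift_complex n Y) k\<^esub>
      (cdiff (shift_complex n Y) (k + 1) (if even n then s (k - n) x else \<ominus>\<^bsub>cmod Y (k - n + 1)\<^esub> s (k - n) x)
       \<oplus>\<^bsub>cmod (shift_complex n Y) k\<^esub>
       (if even n then s (k - 1 - n) (cdiff (shift_complex n X) k x)
        else \<ominus>\<^bsub>cmod Y (k - 1 - n + 1)\<^esub> s (k - 1 - n) (cdiff (shift_complex n X) k x)))"
    using homotopyD(3)[OF s x] c x 1 2 by (simp add: idx cdiff_shift N.minus_minus)
qed

lemma K_ShiftHom_homotopy_class:
  assumes XY: "X \<in> chain_complexes" "Y \<in> chain_complexes" and f: "f \<in> chain_maps X Y"
  shows "K_ShiftHom n X Y (homotopy_class X Y f) =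
    homotopy_class (shift_complex n X) (shift_complex n Y) (\<lambda>k. f (k - n))"
proof -
  have "homotopy_class (shift_complex n X) (shift_complex n Y) (\<lambda>k. g (k - n)) =
      homotopy_class (shift_complex n X) (shift_complex n Y) (\<lambda>k. f (k - n))"
    if g: "g \<in> homotopy_class X Y f" for g
  proof -
    obtain s where s: "g \<in> chain_maps X Y" "homotopy X Y s f g"
      using g mem_homotopy_class[OF XY f] by auto
    show ?thesis
      by (rule homotopy_class_eq[OF shift_complex_closed[OF XY(1)] shift_complex_closed[OF XY(2)]
          shift_chain_map[OF XY f] shift_chain_map[OF XY s(1)] shift_homotopy[OF XY f s], symmetric])
  qed
  then have "K_ShiftHom n X Y (homotopy_class X Y f) = (\<Union>g\<in>homotopy_class X Y f.
      homotopy_class (shift_complex n X) (shift_complex n Y) (\<lambda>k. f (k - n)))"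
    unfolding K_ShiftHom_def by (intro SUP_cong refl)
  moreover have "homotopy_class X Y f \<noteq> {}" using mem_homotopy_class_self[OF XY f] by auto
  ultimately show ?thesis by simp
qed

lemma K_ShiftHom_closed:
  assumes XY: "X \<in> chain_complexes" "Y \<in> chain_complexes" and F: "F \<in> carrier (K_Hom X Y)"
  shows "K_ShiftHom n X Y F \<in> carrier (K_Hom (shift_complex n X) (shift_complex n Y))"
proof -
  obtain f where "f \<in> chain_maps X Y" "F = homotopy_class X Y f" using K_HomE[OF XY F] .
  then show ?thesis
    using XY by (simp add: K_ShiftHom_homotopy_class homotopy_class_in_K_Hom shift_chain_map shift_complex_closed)
qed

lemma K_ShiftHom_Comp:
  assumes XYZ: "X \<in> chain_complexes" "Y \<in> chain_complexes" "Z \<in> chain_complexes"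
    and F: "F \<in> carrier (K_Hom X Y)" and G: "G \<in> carrier (K_Hom Y Z)"
  shows "K_ShiftHom n X Z (K_Comp X Y Z G F) =
    K_Comp (shift_complex n X) (shift_complex n Y) (shift_complex n Z) (K_ShiftHom n Y Z G) (K_ShiftHom n X Y F)"
proof -
  obtain f where f: "f \<in> chain_maps X Y" "F = homotopy_class X Y f" using K_HomE[OF XYZ(1,2) F] .
  obtain g where g: "g \<in> chain_maps Y Z" "G = homotopy_class Y Z g" using K_HomE[OF XYZ(2,3) G] .
  show ?thesis
    using f g XYZ by (simp add: K_ShiftHom_homotopy_class K_Comp_homotopy_class shift_chain_map shift_complex_closed chain_map_comp)
qed

lemma K_ShiftHom_isomorphism:
  assumes XY: "X \<in> chain_complexes" "Y \<in> chain_complexes" and F: "is_isomorphism K_cat X Y F"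
  shows "is_isomorphism K_cat (shift_complex n X) (shift_complex n Y) (K_ShiftHom n X Y F)"
proof -
  obtain G where G: "F \<in> carrier (K_Hom X Y)" "G \<in> carrier (K_Hom Y X)"
    "K_Comp X Y X G F = K_Id X" "K_Comp Y X Y F G = K_Id Y"
    using F by (auto simp: is_isomorphism_def)
  have id: "K_ShiftHom n X X (K_Id X) = K_Id (shift_complex n X)" if "X \<in> chain_complexes" for X
    unfolding K_Id_def using K_ShiftHom_homotopy_class[OF that that chain_map_id] .
  show ?thesis
    using K_ShiftHom_Comp[OF XY(1,2,1) G(1,2), of n] K_ShiftHom_Comp[OF XY(2,1,2) G(2,1), of n] G XY
      K_ShiftHom_closed[OF XY G(1)] K_ShiftHom_closed[OF XY(2,1) G(2)]
    by (auto simp: is_isomorphism_def id)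
qed


subsection \<open>Mapping cones and triangles\<close>

lemma direct_sum_simps [simp]:
  "carrier (direct_sum M N) = {vpair x y | x y. x \<in> carrier M \<and> y \<in> carrier N}"
  "\<zero>\<^bsub>direct_sum M N\<^esub> = vpair \<zero>\<^bsub>M\<^esub> \<zero>\<^bsub>N\<^esub>"
  "vpair x y \<oplus>\<^bsub>direct_sum M N\<^esub> vpair x' y' = vpair (x \<oplus>\<^bsub>M\<^esub> x') (y \<oplus>\<^bsub>N\<^esub> y')"
  "r \<odot>\<^bsub>direct_sum M N\<^esub> vpair x y = vpair (r \<odot>\<^bsub>M\<^esub> x) (r \<odot>\<^bsub>N\<^esub> y)"
  by (simp_all add: direct_sum_def)

lemma direct_sum_small_module:
  assumes "small_module M" "small_module N"
  shows "small_module (direct_sum M N)"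
proof -
  interpret M: module big_ring M using assms by (intro small_moduleD)
  interpret N: module big_ring N using assms by (intro small_moduleD)
  have "abelian_group (direct_sum M N)"
  proof (rule abelian_groupI)
    fix p assume "p \<in> carrier (direct_sum M N)"
    then obtain x y where p: "p = vpair x y" "x \<in> carrier M" "y \<in> carrier N" by auto
    then show "\<exists>q\<in>carrier (direct_sum M N). q \<oplus>\<^bsub>direct_sum M N\<^esub> p = \<zero>\<^bsub>direct_sum M N\<^esub>"
      by (intro bexI[of _ "vpair (\<ominus>\<^bsub>M\<^esub> x) (\<ominus>\<^bsub>N\<^esub> y)"]) (auto simp: M.l_neg N.l_neg)
  qed (auto simp: M.a_ac N.a_ac)
  then show ?thesis
    using small_vpairs[of "carrier M" "carrier N"] assms small_moduleD(3)
    by (intro small_moduleI)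
      (auto simp: small_module_smult M.smult_l_distr[simplified] N.smult_l_distr[simplified]
        M.smult_r_distr N.smult_r_distr M.smult_assoc1[simplified] N.smult_assoc1[simplified]
        M.smult_one[simplified] N.smult_one[simplified])
qed

lemma cmod_cone [simp]: "cmod (mapping_cone X Y f) k = direct_sum (cmod Y k) (cmod X (k - 1))"
  by (simp add: mapping_cone_def)

lemma cdiff_cone: "cdiff (mapping_cone X Y f) k (vpair y x) =
    vpair (cdiff Y k y \<oplus>\<^bsub>cmod Y (k - 1)\<^esub> f (k - 1) x) (\<ominus>\<^bsub>cmod X (k - 2)\<^esub> cdiff X (k - 1) x)"
  if "y \<in> carrier (cmod Y k)" "x \<in> carrier (cmod X (k - 1))"
  using that by (simp add: mapping_cone_def)

context
  fixes X Y :: "'u::universe chain_complex" and f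
  assumes X: "X \<in> chain_complexes" and Y: "Y \<in> chain_complexes" and f: "f \<in> chain_maps X Y"
begin

lemma mapping_cone_closed: "mapping_cone X Y f \<in> chain_complexes"
proof (rule complexI)
  fix k
  interpret Y1: module big_ring "cmod Y (k - 1)" using Y by (intro small_moduleD complexD)
  interpret X2: module big_ring "cmod X (k - 2)" using X by (intro small_moduleD complexD)
  interpret Y2: abelian_group "cmod Y (k - 2)" using Y by (intro complexD)
  interpret X3: abelian_group "cmod X (k - 3)" using X by (intro complexD)
  show "small_module (cmod (mapping_cone X Y f) k)" by (simp add: direct_sum_small_module complexD X Y)
  show "cdiff (mapping_cone X Y f) k \<in> extensional (carrier (cmod (mapping_cone X Y f) k))"
    by (simp add: mapping_cone_def)
  have dX: "cdiff X (k - 1) \<in> module_hom (cmod X (k - 1)) (cmod X (k - 2))"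
    using complexD(3)[OF X, of "k - 1"] by simp
  note dY = complexD(3)[OF Y, of k]
  note f1 = chain_mapD(1)[OF f, of "k - 1"]
  note hom = module_homD[OF dX] module_homD[OF dY] module_homD[OF f1]
  have ops: "r \<odot>\<^bsub>cmod Y k\<^esub> y \<in> carrier (cmod Y k)" "r \<odot>\<^bsub>cmod X (k - 1)\<^esub> x \<in> carrier (cmod X (k - 1))"
    "y \<oplus>\<^bsub>cmod Y k\<^esub> y' \<in> carrier (cmod Y k)" "x \<oplus>\<^bsub>cmod X (k - 1)\<^esub> x' \<in> carrier (cmod X (k - 1))"
    if "y \<in> carrier (cmod Y k)" "x \<in> carrier (cmod X (k - 1))" "y' \<in> carrier (cmod Y k)" "x' \<in> carrier (cmod X (k - 1))" for r x y x' y'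
    using that X Y by (auto intro!: small_module_smult complexD abelian_monoid.a_closed abelian_group.axioms(1))
  show "cdiff (mapping_cone X Y f) k \<in> module_hom (cmod (mapping_cone X Y f) k) (cmod (mapping_cone X Y f) (k - 1))"
    by (rule module_homI)
      (auto simp: cdiff_cone ops hom Y1.a_ac X2.minus_add Y1.smult_r_distr X2.smult_r_minus)
  fix p assume "p \<in> carrier (cmod (mapping_cone X Y f) k)"
  then obtain x y where p: "p = vpair y x" and y: "y \<in> carrier (cmod Y k)" and x: "x \<in> carrier (cmod X (k - 1))" by auto
  let ?y = "cdiff Y k y \<oplus>\<^bsub>cmod Y (k - 1)\<^esub> f (k - 1) x" and ?x = "\<ominus>\<^bsub>cmod X (k - 2)\<^esub> cdiff X (k - 1) x"
  have f2: "f (k - 2) \<in> module_hom (cmod X (k - 2)) (cmod Y (k - 2))"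
    and dX2: "cdiff X (k - 2) \<in> module_hom (cmod X (k - 2)) (cmod X (k - 3))"
    and dY1: "cdiff Y (k - 1) \<in> module_hom (cmod Y (k - 1)) (cmod Y (k - 2))"
    using chain_mapD(1)[OF f] complexD(3)[OF X, of "k - 2"] complexD(3)[OF Y, of "k - 1"] by simp_all
  have closed: "?y \<in> carrier (cmod Y (k - 1))" "?x \<in> carrier (cmod X (k - 2))"
    using hom(1)[OF x] hom(4)[OF y] hom(7)[OF x] by auto
  have fd: "cdiff Y (k - 1) (f (k - 1) x) = f (k - 2) (cdiff X (k - 1) x)"
    using chain_mapD(3)[OF f x] by simp
  have "cdiff Y (k - 1) ?y \<oplus>\<^bsub>cmod Y (k - 2)\<^esub> f (k - 2) ?x = \<zero>\<^bsub>cmod Y (k - 2)\<^esub>"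
    using module_homD(2)[OF dY1 hom(4)[OF y] hom(7)[OF x]] module_homD(1)[OF f2 hom(1)[OF x]] complexD(5)[OF Y y]
      module_hom_minus[OF complexD(1)[OF X] complexD(1)[OF Y] f2 hom(1)[OF x]] by (simp add: fd Y2.r_neg)
  moreover have "cdiff X (k - 2) ?x = \<zero>\<^bsub>cmod X (k - 3)\<^esub>"
    using module_hom_minus[OF complexD(1)[OF X] complexD(1)[OF X] dX2 hom(1)[OF x]] complexD(5)[OF X x] by simp
  ultimately show "cdiff (mapping_cone X Y f) (k - 1) (cdiff (mapping_cone X Y f) k p) = \<zero>\<^bsub>cmod (mapping_cone X Y f) (k - 2)\<^esub>"
    using cdiff_cone[of ?y Y "k - 1" ?x X f] closed by (simp add: p cdiff_cone[OF y x])
qed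

lemma cone_inclusion_chain_map: "(\<lambda>k y. vpair y \<zero>\<^bsub>cmod X (k - 1)\<^esub>) \<in> chain_maps Y (mapping_cone X Y f)"
proof (rule chain_mapI)
  fix k
  interpret X1: module big_ring "cmod X (k - 1)" using X by (intro small_moduleD complexD)
  interpret X2: abelian_group "cmod X (k - 2)" using X by (intro complexD)
  interpret Y1: abelian_group "cmod Y (k - 1)" using Y by (intro complexD)
  show "(\<lambda>y. vpair y \<zero>\<^bsub>cmod X (k - 1)\<^esub>) \<in> module_hom (cmod Y k) (cmod (mapping_cone X Y f) k)"
    by (rule module_homI) (use X1.smult_r_null in auto)
  fix y assume y: "y \<in> carrier (cmod Y k)"
  have "f (k - 1) \<zero>\<^bsub>cmod X (k - 1)\<^esub> = \<zero>\<^bsub>cmod Y (k - 1)\<^esub>"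
    using module_hom_zero[OF complexD(1)[OF X] complexD(1)[OF Y] chain_mapD(1)[OF f]] .
  moreover have "cdiff X (k - 1) \<zero>\<^bsub>cmod X (k - 1)\<^esub> = \<zero>\<^bsub>cmod X (k - 2)\<^esub>"
    using module_hom_zero[OF complexD(1)[OF X] complexD(1)[OF X] complexD(3)[OF X], of "k - 1"] by simp
  ultimately show "cdiff (mapping_cone X Y f) k (vpair y \<zero>\<^bsub>cmod X (k - 1)\<^esub>) =
      vpair (cdiff Y k y) \<zero>\<^bsub>cmod X (k - 1 - 1)\<^esub>"
    using y complex_diff_closed(1)[OF Y y] by (simp add: cdiff_cone)
qed

lemma cone_projection_chain_map: "(\<lambda>k. vsnd) \<in> chain_maps (mapping_cone X Y f) (shift_complex 1 X)"
  by (rule chain_mapI) (auto simp: module_hom_def cdiff_cone cdiff_shift)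

end

abbreviation susp :: "'u::universe chain_complex \<Rightarrow> 'u chain_complex" where
  "susp \<equiv> shift_complex 1"

context
  fixes X Y :: "'u::universe chain_complex" and f
  assumes X: "X \<in> chain_complexes" and Y: "Y \<in> chain_complexes" and f: "f \<in> chain_maps X Y"
begin

lemma cone_objects: "mapping_cone X Y f \<in> chain_complexes" "susp X \<in> chain_complexes" "susp Y \<in> chain_complexes"
  by (auto intro: mapping_cone_closed shift_complex_closed X Y f)

lemma cone_maps:
  "f \<in> homotopy_class X Y f" "homotopy_class X Y f \<in> carrier (K_Hom X Y)"
  "(\<lambda>k y. vpair y \<zero>\<^bsub>cmod X (k - 1)\<^esub>) \<in> cone_inclusion X Y f" "cone_inclusion X Y f \<in> carrier (K_Hom Y (mapping_cone X Y f))"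
  "(\<lambda>k. vsnd) \<in> cone_projection X Y f" "cone_projection X Y f \<in> carrier (K_Hom (mapping_cone X Y f) (susp X))"
  "(\<lambda>k. f (k - 1)) \<in> K_ShiftHom 1 X Y (homotopy_class X Y f)"
  "K_ShiftHom 1 X Y (homotopy_class X Y f) \<in> carrier (K_Hom (susp X) (susp Y))"
  unfolding cone_inclusion_def cone_projection_def K_ShiftHom_homotopy_class[OF X Y f]
  by (intro mem_homotopy_class_self homotopy_class_in_K_Hom X Y f cone_objects cone_inclusion_chain_map
      cone_projection_chain_map shift_chain_map)+

end

text \<open>
  Exactness concerns two consecutive maps.  The three pairs of consecutive maps of a triangle are
  each isomorphic to a pair of a cone triangle, with the third pair involving the suspension of the
  first map.
\<close>

definition isomorphic_pairs ::
  "('o, 'm) tricat \<Rightarrow> 'o \<Rightarrow> 'o \<Rightarrow> 'o \<Rightarrow> 'm \<Rightarrow> 'm \<Rightarrow> 'o \<Rightarrow> 'o \<Rightarrow> 'o \<Rightarrow> 'm \<Rightarrow> 'm \<Rightarrow> bool" where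
  "isomorphic_pairs T X Y Z f g X' Y' Z' f' g' \<longleftrightarrow>
     {X, Y, Z, X', Y', Z'} \<subseteq> Ob T \<and>
     f \<in> carrier (Hom T X Y) \<and> g \<in> carrier (Hom T Y Z) \<and>
     f' \<in> carrier (Hom T X' Y') \<and> g' \<in> carrier (Hom T Y' Z') \<and>
     (\<exists>a b c. is_isomorphism T X X' a \<and> is_isomorphism T Y Y' b \<and> is_isomorphism T Z Z' c \<and>
       Comp T X Y Y' b f = Comp T X X' Y' f' a \<and> Comp T Y Z Z' c g = Comp T Y Y' Z' g' b)"

lemma exact_at_isomorphic_pairs:
  assumes "cofunctor_to_Ab T H h" "isomorphic_pairs T X Y Z f g X' Y' Z' f' g'" "exact_at H h X' Y' Z' f' g'"
  shows "exact_at H h X Y Z f g"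
proof -
  obtain a b c where "is_isomorphism T X X' a" "is_isomorphism T Y Y' b" "is_isomorphism T Z Z' c"
    "Comp T X Y Y' b f = Comp T X X' Y' f' a" "Comp T Y Z Z' c g = Comp T Y Y' Z' g' b"
    using assms(2) by (auto simp: isomorphic_pairs_def)
  from exact_at_transport[OF assms(1) _ _ _ _ _ _ _ _ _ _ this] assms(2,3)
  show ?thesis by (simp add: isomorphic_pairs_def)
qed

lemma is_isomorphism_dual: "is_isomorphism (dual T) X Y f \<longleftrightarrow> is_isomorphism T Y X f"
  by (auto simp: is_isomorphism_def dual_def)

lemma exact_at_isomorphic_pairs_dual:
  assumes "cofunctor_to_Ab (dual T) H h" "isomorphic_pairs T X Y Z f g X' Y' Z' f' g'" "exact_at H h Z' Y' X' g' f'"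
  shows "exact_at H h Z Y X g f"
proof -
  obtain a b c where "is_isomorphism T X X' a" "is_isomorphism T Y Y' b" "is_isomorphism T Z Z' c"
    and comm: "Comp T X Y Y' b f = Comp T X X' Y' f' a" "Comp T Y Z Z' c g = Comp T Y Y' Z' g' b"
    using assms(2) by (auto simp: isomorphic_pairs_def)
  then have iso: "is_isomorphism (dual T) Z' Z c" "is_isomorphism (dual T) Y' Y b" "is_isomorphism (dual T) X' X a"
    by (simp_all add: is_isomorphism_dual)
  have "Comp (dual T) Z' Y' Y b g' = Comp (dual T) Z' Z Y g c"
    "Comp (dual T) Y' X' X a f' = Comp (dual T) Y' Y X f b"
    using comm by (simp_all add: dual_def)
  from exact_at_transport[OF assms(1) _ _ _ _ _ _ _ _ _ _ iso this] assms(2,3)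
  show ?thesis by (simp add: isomorphic_pairs_def dual_def)
qed

lemma K_TrianglesE:
  assumes "(X, Y, Z, u, v, w) \<in> K_Triangles"
  obtains X' Y' f where "X' \<in> chain_complexes" "Y' \<in> chain_complexes" "f \<in> chain_maps X' Y'"
    "isomorphic_pairs K_cat X Y Z u v
       X' Y' (mapping_cone X' Y' f) (homotopy_class X' Y' f) (cone_inclusion X' Y' f)"
    "isomorphic_pairs K_cat Y Z (shift_complex 1 X) v w
       Y' (mapping_cone X' Y' f) (shift_complex 1 X') (cone_inclusion X' Y' f) (cone_projection X' Y' f)"
    "isomorphic_pairs K_cat Z (shift_complex 1 X) (shift_complex 1 Y) w (K_ShiftHom 1 X Y u)
       (mapping_cone X' Y' f) (shift_complex 1 X') (shift_complex 1 Y') (cone_projection X' Y' f)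
       (K_ShiftHom 1 X' Y' (homotopy_class X' Y' f))"
proof -
  from assms obtain X' Y' f a b c where
    XYZ: "X \<in> chain_complexes" "Y \<in> chain_complexes" "Z \<in> chain_complexes"
    and uvw: "u \<in> carrier (K_Hom X Y)" "v \<in> carrier (K_Hom Y Z)" "w \<in> carrier (K_Hom Z (shift_complex 1 X))"
    and XY': "X' \<in> chain_complexes" "Y' \<in> chain_complexes" and f: "f \<in> chain_maps X' Y'"
    and iso: "is_isomorphism K_cat X X' a" "is_isomorphism K_cat Y Y' b" "is_isomorphism K_cat Z (mapping_cone X' Y' f) c"
    and comm: "K_Comp X Y Y' b u = K_Comp X X' Y' (homotopy_class X' Y' f) a"
      "K_Comp Y Z (mapping_cone X' Y' f) c v = K_Comp Y Y' (mapping_cone X' Y' f) (cone_inclusion X' Y' f) b"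
      "K_Comp Z (shift_complex 1 X) (shift_complex 1 X') (K_ShiftHom 1 X X' a) w =
          K_Comp Z (mapping_cone X' Y' f) (shift_complex 1 X') (cone_projection X' Y' f) c"
    unfolding K_Triangles_def Let_def is_isomorphism_K_cat by blast
  let ?Z' = "mapping_cone X' Y' f"
  have Z': "?Z' \<in> chain_complexes" using XY' f by (rule mapping_cone_closed)
  have F: "homotopy_class X' Y' f \<in> carrier (K_Hom X' Y')" using XY' f by (rule homotopy_class_in_K_Hom)
  have i: "cone_inclusion X' Y' f \<in> carrier (K_Hom Y' ?Z')"
    unfolding cone_inclusion_def
    by (intro homotopy_class_in_K_Hom XY' Z' cone_inclusion_chain_map f)
  have p: "cone_projection X' Y' f \<in> carrier (K_Hom ?Z' (shift_complex 1 X'))"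
    unfolding cone_projection_def
    by (intro homotopy_class_in_K_Hom XY' Z' cone_projection_chain_map f shift_complex_closed)
  have ab: "a \<in> carrier (K_Hom X X')" "b \<in> carrier (K_Hom Y Y')"
    using iso by (simp_all add: is_isomorphism_def)
  have sq: "K_Comp (shift_complex 1 X) (shift_complex 1 Y) (shift_complex 1 Y') (K_ShiftHom 1 Y Y' b) (K_ShiftHom 1 X Y u)
      = K_Comp (shift_complex 1 X) (shift_complex 1 X') (shift_complex 1 Y')
          (K_ShiftHom 1 X' Y' (homotopy_class X' Y' f)) (K_ShiftHom 1 X X' a)"
    using K_ShiftHom_Comp[OF XYZ(1,2) XY'(2) uvw(1) ab(2), of 1] K_ShiftHom_Comp[OF XYZ(1) XY' ab(1) F, of 1]
      comm(1) by simp
  note S = shift_complex_closed[where n = 1]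
  note siso = K_ShiftHom_isomorphism[OF XYZ(1) XY'(1) iso(1), of 1] K_ShiftHom_isomorphism[OF XYZ(2) XY'(2) iso(2), of 1]
  show thesis
  proof (rule that[OF XY' f])
    show "isomorphic_pairs K_cat X Y Z u v X' Y' ?Z' (homotopy_class X' Y' f) (cone_inclusion X' Y' f)"
      unfolding isomorphic_pairs_def using XYZ XY' Z' uvw F i iso comm by auto
    show "isomorphic_pairs K_cat Y Z (shift_complex 1 X) v w
       Y' ?Z' (shift_complex 1 X') (cone_inclusion X' Y' f) (cone_projection X' Y' f)"
      unfolding isomorphic_pairs_def using XYZ XY' Z' uvw i p iso siso comm S by auto
    show "isomorphic_pairs K_cat Z (shift_complex 1 X) (shift_complex 1 Y) w (K_ShiftHom 1 X Y u)
       ?Z' (shift_complex 1 X') (shift_complex 1 Y') (cone_projection X' Y' f)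
       (K_ShiftHom 1 X' Y' (homotopy_class X' Y' f))"
      unfolding isomorphic_pairs_def
      using XYZ XY' Z' uvw p iso siso comm sq S K_ShiftHom_closed[OF XYZ(1,2) uvw(1)] K_ShiftHom_closed[OF XY' F] by auto
  qed
qed

section \<open>Homology of invariants\<close>

definition var :: "'u::universe ordinal \<Rightarrow> 'u big_poly" where
  "var i = Poly_Mapping.single (Poly_Mapping.single i 1) 1"

definition invariants :: "'u::universe big_module \<Rightarrow> 'u set" where
  "invariants M = {x \<in> carrier M. \<forall>i. var i \<odot>\<^bsub>M\<^esub> x = \<zero>\<^bsub>M\<^esub>}"

definition inv_cycles :: "int \<Rightarrow> 'u::universe chain_complex \<Rightarrow> 'u monoid" where
  "inv_cycles m X = \<lparr>carrier = {x \<in> invariants (cmod X m). cdiff X m x = \<zero>\<^bsub>cmod X (m - 1)\<^esub>},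
     mult = add (cmod X m), one = zero (cmod X m)\<rparr>"

definition inv_boundaries :: "int \<Rightarrow> 'u::universe chain_complex \<Rightarrow> 'u set" where
  "inv_boundaries m X = cdiff X (m + 1) ` invariants (cmod X (m + 1))"

abbreviation inv_H :: "int \<Rightarrow> 'u::universe chain_complex \<Rightarrow> 'u monoid" where
  "inv_H m \<equiv> cocycle_functor.H (inv_cycles m) (inv_boundaries m)"

abbreviation inv_h :: "int \<Rightarrow> 'u::universe chain_complex \<Rightarrow> 'u chain_complex \<Rightarrow> 'u hclass \<Rightarrow> 'u \<Rightarrow> 'u" where
  "inv_h m \<equiv> cocycle_functor.h (inv_cycles m) (inv_boundaries m) (\<lambda>X Y f. f m)"

lemma invariants_carrier: "x \<in> invariants M \<Longrightarrow> x \<in> carrier M"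
  by (simp add: invariants_def)

lemma invariants_hom:
  assumes "small_module M" "small_module N" "f \<in> module_hom M N" "x \<in> invariants M"
  shows "f x \<in> invariants N"
  using assms(4) module_homD[OF assms(3)] module_hom_zero[OF assms(1-3)]
  by (auto simp: invariants_def simp flip: module_homD(3)[OF assms(3)])

lemma invariants_add:
  assumes "small_module M" "x \<in> invariants M" "y \<in> invariants M"
  shows "x \<oplus>\<^bsub>M\<^esub> y \<in> invariants M"
proof -
  interpret M: module big_ring M using assms(1) by (rule small_moduleD)
  show ?thesis using assms(2,3) by (simp add: invariants_def M.smult_r_distr)
qed

lemma invariants_minus:
  assumes "small_module M" "x \<in> invariants M"
  shows "\<ominus>\<^bsub>M\<^esub> x \<in> invariants M"
proof -
  interpret M: module big_ring M using assms(1) by (rule small_moduleD)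
  show ?thesis using assms(2) by (simp add: invariants_def M.smult_r_minus)
qed

lemma invariants_zero: "small_module M \<Longrightarrow> \<zero>\<^bsub>M\<^esub> \<in> invariants M"
proof -
  assume "small_module M"
  then interpret M: module big_ring M by (rule small_moduleD)
  show ?thesis using M.smult_r_null by (simp add: invariants_def)
qed

lemma invariants_direct_sum:
  "vpair x y \<in> invariants (direct_sum M N) \<longleftrightarrow> x \<in> invariants M \<and> y \<in> invariants N"
  by (auto simp: invariants_def)

context
  fixes X :: "'u::universe chain_complex" assumes X: "X \<in> chain_complexes"
begin

interpretation M: abelian_group "cmod X k" for k using X by (rule complexD)

lemma diff_zero: "cdiff X k \<zero>\<^bsub>cmod X k\<^esub> = \<zero>\<^bsub>cmod X (k - 1)\<^esub>"
  using module_hom_zero[OF complexD(1)[OF X] complexD(1)[OF X] complexD(3)[OF X]] .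

lemma diff_minus: "x \<in> carrier (cmod X k) \<Longrightarrow> cdiff X k (\<ominus>\<^bsub>cmod X k\<^esub> x) = \<ominus>\<^bsub>cmod X (k - 1)\<^esub> cdiff X k x"
  using module_hom_minus[OF complexD(1)[OF X] complexD(1)[OF X] complexD(3)[OF X]] .

lemma diff_minus': "x \<in> carrier (cmod X (k + 1)) \<Longrightarrow>
    cdiff X (k + 1) (\<ominus>\<^bsub>cmod X (k + 1)\<^esub> x) = \<ominus>\<^bsub>cmod X k\<^esub> cdiff X (k + 1) x"
  using diff_minus[of x "k + 1"] by simp

lemma inv_cycles_comm_group: "comm_group (inv_cycles m X)"
proof (rule comm_groupI)
  fix x assume "x \<in> carrier (inv_cycles m X)"
  then show "\<exists>y\<in>carrier (inv_cycles m X). y \<otimes>\<^bsub>inv_cycles m X\<^esub> x = \<one>\<^bsub>inv_cycles m X\<^esub>"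
    using invariants_minus[OF complexD(1)[OF X]]
    by (intro bexI[of _ "\<ominus>\<^bsub>cmod X m\<^esub> x"]) (auto simp: inv_cycles_def diff_minus invariants_carrier M.l_neg)
qed (auto simp: inv_cycles_def invariants_carrier M.a_ac invariants_add invariants_zero complexD(1)[OF X]
       module_homD(2)[OF complexD(3)[OF X]] diff_zero)

lemma inv_inv_cycles:
  assumes "x \<in> carrier (inv_cycles m X)"
  shows "inv\<^bsub>inv_cycles m X\<^esub> x = \<ominus>\<^bsub>cmod X m\<^esub> x"
proof -
  interpret Z: comm_group "inv_cycles m X" by (rule inv_cycles_comm_group)
  show ?thesis
    using assms invariants_minus[OF complexD(1)[OF X]]
    by (intro Z.inv_equality) (auto simp: inv_cycles_def diff_minus invariants_carrier M.l_neg)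
qed

lemma inv_boundaries_subset: "inv_boundaries m X \<subseteq> carrier (inv_cycles m X)"
  using invariants_hom[OF complexD(1)[OF X] complexD(1)[OF X] complex_diff_from_above(1)[OF X]]
    complex_diff_from_above(2)[OF X]
  by (auto simp: inv_boundaries_def inv_cycles_def invariants_carrier)

lemma inv_boundaries_subgroup: "subgroup (inv_boundaries m X) (inv_cycles m X)"
proof -
  interpret Z: comm_group "inv_cycles m X" by (rule inv_cycles_comm_group)
  show ?thesis
  proof (rule Z.subgroupI)
    show "inv_boundaries m X \<noteq> {}"
      using invariants_zero[OF complexD(1)[OF X]] by (auto simp: inv_boundaries_def)
    fix a assume a: "a \<in> inv_boundaries m X"
    then obtain x where x: "x \<in> invariants (cmod X (m + 1))" "a = cdiff X (m + 1) x" by (auto simp: inv_boundaries_def)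
    have "\<ominus>\<^bsub>cmod X m\<^esub> a = cdiff X (m + 1) (\<ominus>\<^bsub>cmod X (m + 1)\<^esub> x)"
      using x by (simp add: diff_minus' invariants_carrier)
    moreover have "a \<in> carrier (inv_cycles m X)" using a inv_boundaries_subset by blast
    ultimately show "inv\<^bsub>inv_cycles m X\<^esub> a \<in> inv_boundaries m X"
      using invariants_minus[OF complexD(1)[OF X] x(1)] by (simp add: inv_inv_cycles inv_boundaries_def)
    fix b assume "b \<in> inv_boundaries m X"
    then obtain y where y: "y \<in> invariants (cmod X (m + 1))" "b = cdiff X (m + 1) y" by (auto simp: inv_boundaries_def)
    have "a \<oplus>\<^bsub>cmod X m\<^esub> b = cdiff X (m + 1) (x \<oplus>\<^bsub>cmod X (m + 1)\<^esub> y)"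
      using x y by (simp add: module_homD(2)[OF complex_diff_from_above(1)[OF X]] invariants_carrier)
    then show "a \<otimes>\<^bsub>inv_cycles m X\<^esub> b \<in> inv_boundaries m X"
      using invariants_add[OF complexD(1)[OF X] x(1) y(1)] by (auto simp: inv_cycles_def inv_boundaries_def)
  qed (rule inv_boundaries_subset)
qed

text \<open>
  Homotopies and mapping cones produce the difference of two cycles in this form, as an explicit
  boundary.
\<close>

lemma inv_cycles_differ:
  assumes "y \<in> carrier (inv_cycles m X)" "b \<in> invariants (cmod X (m + 1))" "x = y \<oplus>\<^bsub>cmod X m\<^esub> cdiff X (m + 1) b"
  shows "x \<otimes>\<^bsub>inv_cycles m X\<^esub> inv\<^bsub>inv_cycles m X\<^esub> y \<in> inv_boundaries m X"
proof -
  interpret Z: comm_group "inv_cycles m X" by (rule inv_cycles_comm_group)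
  have b: "cdiff X (m + 1) b \<in> inv_boundaries m X" using assms(2) by (simp add: inv_boundaries_def)
  then have "cdiff X (m + 1) b \<in> carrier (inv_cycles m X)" using inv_boundaries_subset by blast
  moreover have "x = y \<otimes>\<^bsub>inv_cycles m X\<^esub> cdiff X (m + 1) b" using assms(3) by (simp add: inv_cycles_def)
  ultimately have "x \<otimes>\<^bsub>inv_cycles m X\<^esub> inv\<^bsub>inv_cycles m X\<^esub> y = cdiff X (m + 1) b"
    using assms(1) by (simp add: Z.m_comm[of y] Z.m_assoc)
  with b show ?thesis by simp
qed

end

lemma inv_cycles_chain_map:
  assumes XY: "X \<in> chain_complexes" "Y \<in> chain_complexes" and f: "f \<in> chain_maps X Y"
  shows "x \<in> carrier (inv_cycles m X) \<Longrightarrow> f m x \<in> carrier (inv_cycles m Y)"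
    and "x \<in> inv_boundaries m X \<Longrightarrow> f m x \<in> inv_boundaries m Y"
proof -
  note fi = invariants_hom[OF complexD(1)[OF XY(1)] complexD(1)[OF XY(2)] chain_mapD(1)[OF f]]
  have "f (m - 1) \<zero>\<^bsub>cmod X (m - 1)\<^esub> = \<zero>\<^bsub>cmod Y (m - 1)\<^esub>"
    using module_hom_zero[OF complexD(1)[OF XY(1)] complexD(1)[OF XY(2)] chain_mapD(1)[OF f]] .
  then show "x \<in> carrier (inv_cycles m X) \<Longrightarrow> f m x \<in> carrier (inv_cycles m Y)"
    using fi chain_mapD(3)[OF f] by (auto simp: inv_cycles_def invariants_carrier)
  show "x \<in> inv_boundaries m X \<Longrightarrow> f m x \<in> inv_boundaries m Y"
    using fi[of _ "m + 1"] by (auto simp: inv_boundaries_def invariants_carrier simp flip: chain_mapD(4)[OF f])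
qed

lemma dual_simps [simp]:
  "Ob (dual T) = Ob T" "Hom (dual T) X Y = Hom T Y X" "Id (dual T) = Id T"
  "Comp (dual T) X Y Z g f = Comp T Z Y X f g" "Shift (dual T) n = Shift T (- n)"
  "ShiftHom (dual T) n X Y = ShiftHom T (- n) Y X"
  by (simp_all add: dual_def)

lemma K_Hom_nonempty: "\<lbrakk>X \<in> chain_complexes; Y \<in> chain_complexes; F \<in> carrier (K_Hom X Y)\<rbrakk> \<Longrightarrow> F \<noteq> {}"
  by (erule K_HomE[rotated 2]) (use mem_homotopy_class_self in blast)+

lemma inv_cocycle_functor:
  "cocycle_functor (dual K_cat) (inv_cycles m) (inv_boundaries m) (\<lambda>X Y f. f m)"
proof (rule cocycle_functor.intro, unfold dual_simps K_cat_simps)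
  fix X :: "'u::universe chain_complex" assume X: "X \<in> chain_complexes"
  show "comm_group (inv_cycles m X)" "subgroup (inv_boundaries m X) (inv_cycles m X)"
    using X by (rule inv_cycles_comm_group inv_boundaries_subgroup)+
  have "carrier (inv_cycles m X) \<subseteq> carrier (cmod X m)" by (auto simp: inv_cycles_def invariants_carrier)
  then show "small (carrier (inv_cycles m X))" using small_subset small_moduleD(3) complexD(1)[OF X] by blast
  show "K_Id X \<in> carrier (K_Hom X X) \<and> (\<exists>f\<in>K_Id X. \<forall>z\<in>carrier (inv_cycles m X). f m z = z)"
    using homotopy_class_in_K_Hom[OF X X chain_map_id] mem_homotopy_class_self[OF X X chain_map_id]
    unfolding K_Id_def by (intro conjI bexI[of _ "\<lambda>k x. x"]) simp_all
next
  fix X Y :: "'u::universe chain_complex" and F f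
  assume XY: "X \<in> chain_complexes" "Y \<in> chain_complexes" and F: "F \<in> carrier (K_Hom Y X)"
  show "F \<noteq> {}" using K_Hom_nonempty XY F by blast
  assume fF: "f \<in> F"
  note f = K_Hom_memD(1)[OF XY(2,1) F fF]
  show "f m \<in> hom (inv_cycles m Y) (inv_cycles m X)"
    using inv_cycles_chain_map(1)[OF XY(2,1) f] module_homD(2)[OF chain_mapD(1)[OF f]]
    by (intro homI) (simp_all add: inv_cycles_def invariants_carrier)
  show "f m z \<in> inv_boundaries m X" if "z \<in> inv_boundaries m Y" for z
    using that inv_cycles_chain_map(2)[OF XY(2,1) f] by simp
  fix g z assume gF: "g \<in> F" and z: "z \<in> carrier (inv_cycles m Y)"
  note g = K_Hom_memD(1)[OF XY(2,1) F gF]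
  obtain s where s: "homotopy Y X s f g" using K_Hom_homotopy[OF XY(2,1) F fF gF] .
  interpret M: abelian_group "cmod X m" using XY(1) by (rule complexD)
  have "s (m - 1) \<zero>\<^bsub>cmod Y (m - 1)\<^esub> = \<zero>\<^bsub>cmod X m\<^esub>"
    using module_hom_zero[OF complexD(1)[OF XY(2)] complexD(1)[OF XY(1)] homotopyD(2)[OF s]] .
  then have "f m z = g m z \<oplus>\<^bsub>cmod X m\<^esub> cdiff X (m + 1) (s m z)"
    using z homotopyD(3)[OF s, of z m] homotopy_closed(3)[OF XY(2,1) s, of z m]
    by (simp add: inv_cycles_def invariants_carrier)
  moreover have "s m z \<in> invariants (cmod X (m + 1))"
    using z invariants_hom[OF complexD(1)[OF XY(2)] complexD(1)[OF XY(1)] homotopyD(1)[OF s]] by (simp add: inv_cycles_def)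
  ultimately show "f m z \<otimes>\<^bsub>inv_cycles m X\<^esub> inv\<^bsub>inv_cycles m X\<^esub> g m z \<in> inv_boundaries m X"
    by (intro inv_cycles_differ[OF XY(1)] inv_cycles_chain_map(1)[OF XY(2,1) g z])
next
  fix X Y W :: "'u::universe chain_complex" and F G
  assume XYW: "X \<in> chain_complexes" "Y \<in> chain_complexes" "W \<in> chain_complexes"
    and F: "F \<in> carrier (K_Hom Y X)" and G: "G \<in> carrier (K_Hom W Y)"
  obtain f where f: "f \<in> chain_maps Y X" "F = homotopy_class Y X f" using K_HomE[OF XYW(2,1) F] .
  obtain g where g: "g \<in> chain_maps W Y" "G = homotopy_class W Y g" using K_HomE[OF XYW(3,2) G] .
  have K: "K_Comp W Y X F G = homotopy_class W X (\<lambda>k. f k \<circ> g k)"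
    using K_Comp_homotopy_class[OF XYW(3,2,1) g(1) f(1)] f g by simp
  have "f \<in> F" "g \<in> G" "(\<lambda>k. f k \<circ> g k) \<in> K_Comp W Y X F G"
    unfolding K using f g by (simp_all add: mem_homotopy_class_self XYW chain_map_comp)
  moreover have "K_Comp W Y X F G \<in> carrier (K_Hom W X)"
    unfolding K using f g by (simp add: homotopy_class_in_K_Hom XYW chain_map_comp)
  ultimately show "K_Comp W Y X F G \<in> carrier (K_Hom W X) \<and>
      (\<exists>k\<in>K_Comp W Y X F G. \<exists>f\<in>F. \<exists>g\<in>G. \<forall>z\<in>carrier (inv_cycles m W). k m z = f m (g m z))"
    by (intro conjI bexI[of _ f] bexI[of _ g] bexI[of _ "\<lambda>k. f k \<circ> g k"]) simp_all
qed

text \<open>Shifting reindexes the homology; the signs in the differential change neither cycles nor boundaries.\<close>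

lemma inv_shift:
  assumes X: "X \<in> chain_complexes"
  shows "inv_cycles m (shift_complex n X) = inv_cycles (m - n) X"
    and "inv_boundaries m (shift_complex n X) = inv_boundaries (m - n) X"
proof -
  have idx: "m - 1 - n = m - n - 1" "m + 1 - n = m - n + 1" "m - n + 1 - 1 = m - n" by simp_all
  interpret M: abelian_group "cmod X k" for k using X by (rule complexD)
  have "cdiff (shift_complex n X) m x = \<zero>\<^bsub>cmod X (m - n - 1)\<^esub> \<longleftrightarrow> cdiff X (m - n) x = \<zero>\<^bsub>cmod X (m - n - 1)\<^esub>"
    if "x \<in> carrier (cmod X (m - n))" for x
    using complex_diff_closed(1)[OF X that] M.add.inv_eq_1_iff by (simp add: cdiff_shift that)
  then show "inv_cycles m (shift_complex n X) = inv_cycles (m - n) X"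
    by (auto simp: inv_cycles_def idx invariants_carrier)
  have "cdiff (shift_complex n X) (m + 1) ` invariants (cmod X (m - n + 1)) = cdiff X (m - n + 1) ` invariants (cmod X (m - n + 1))"
  proof (cases "even n")
    case True
    then show ?thesis by (intro image_cong) (auto simp: cdiff_shift idx invariants_carrier)
  next
    case False
    have "cdiff (shift_complex n X) (m + 1) x = cdiff X (m - n + 1) (\<ominus>\<^bsub>cmod X (m - n + 1)\<^esub> x)"
      "cdiff X (m - n + 1) x = cdiff (shift_complex n X) (m + 1) (\<ominus>\<^bsub>cmod X (m - n + 1)\<^esub> x)"
      if "x \<in> invariants (cmod X (m - n + 1))" for x
      using False that complex_diff_closed(2)[OF X, of x "m - n"]
      by (simp_all add: cdiff_shift idx invariants_carrier diff_minus'[OF X] M.minus_minus)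
    then show ?thesis
      using invariants_minus[OF complexD(1)[OF X]] by (intro equalityI image_subsetI) (metis imageI)+
  qed
  then show "inv_boundaries m (shift_complex n X) = inv_boundaries (m - n) X"
    by (simp add: inv_boundaries_def idx)
qed

lemma inv_H_shift: "inv_H m (shift_complex n X) = inv_H (m - n) X" if "X \<in> chain_complexes"
  for X :: "'u::universe chain_complex"
proof -
  interpret co: cocycle_functor "dual K_cat :: 'u homotopy_cat" "inv_cycles k" "inv_boundaries k" "\<lambda>X Y f. f k" for k
    by (rule inv_cocycle_functor)
  show ?thesis using that by (simp add: co.H_def inv_shift)
qed

lemma inv_h_shift:
  fixes X Y :: "'u::universe chain_complex"
  assumes XY: "X \<in> chain_complexes" "Y \<in> chain_complexes" and F: "F \<in> carrier (K_Hom Y X)"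
    and c: "c \<in> carrier (inv_H (m - n) Y)"
  shows "inv_h m (shift_complex n X) (shift_complex n Y) (K_ShiftHom n Y X F) c = inv_h (m - n) X Y F c"
proof -
  interpret co: cocycle_functor "dual K_cat :: 'u homotopy_cat" "inv_cycles k" "inv_boundaries k" "\<lambda>X Y f. f k" for k
    by (rule inv_cocycle_functor)
  obtain f where f: "f \<in> chain_maps Y X" "F = homotopy_class Y X f" using K_HomE[OF XY(2,1) F] .
  have "c \<in> co.cls (m - n) Y ` carrier (inv_cycles (m - n) Y)" using c XY by (simp add: co.carrier_H)
  then obtain z where z: "z \<in> carrier (inv_cycles (m - n) Y)" "c = co.cls (m - n) Y z" by blast
  have cls: "co.cls m (shift_complex n W) w = co.cls (m - n) W w" if "W \<in> chain_complexes" for W w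
    using that by (simp add: co.cls_def inv_shift)
  have "co.h m (shift_complex n X) (shift_complex n Y) (K_ShiftHom n Y X F) (co.cls m (shift_complex n Y) z)
      = co.cls m (shift_complex n X) (f (m - n) z)"
    using co.h_cls[of "shift_complex n X" "shift_complex n Y" "K_ShiftHom n Y X F" "\<lambda>k. f (k - n)" z m]
      XY f z K_ShiftHom_closed[OF XY(2,1) F] mem_homotopy_class_self[OF _ _ shift_chain_map[OF XY(2,1) f(1)]]
    by (simp add: shift_complex_closed inv_shift K_ShiftHom_homotopy_class)
  moreover have "co.h (m - n) X Y F c = co.cls (m - n) X (f (m - n) z)"
    using co.h_cls[of X Y F f z "m - n"] XY f z F mem_homotopy_class_self[OF XY(2,1) f(1)] by simp
  ultimately show ?thesis using z XY by (simp add: cls)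
qed

context
  fixes X Y :: "'u::universe chain_complex" and f
  assumes X: "X \<in> chain_complexes" and Y: "Y \<in> chain_complexes" and f: "f \<in> chain_maps X Y"
begin

interpretation co: cocycle_functor "dual K_cat :: 'u homotopy_cat" "inv_cycles k" "inv_boundaries k" "\<lambda>X Y f. f k" for k
  by (rule inv_cocycle_functor)

interpretation X: abelian_group "cmod X k" for k using X by (rule complexD)
interpretation Y: abelian_group "cmod Y k" for k using Y by (rule complexD)


private lemmas objects = cone_objects[OF X Y f]
private lemmas maps = cone_maps[OF X Y f]

private lemma cycles_cone: "vpair y x \<in> carrier (inv_cycles m (mapping_cone X Y f)) \<longleftrightarrow>
    y \<in> invariants (cmod Y m) \<and> x \<in> invariants (cmod X (m - 1)) \<and>
    cdiff Y m y \<oplus>\<^bsub>cmod Y (m - 1)\<^esub> f (m - 1) x = \<zero>\<^bsub>cmod Y (m - 1)\<^esub> \<and> cdiff X (m - 1) x = \<zero>\<^bsub>cmod X (m - 2)\<^esub>"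
proof -
  have "\<ominus>\<^bsub>cmod X (m - 2)\<^esub> cdiff X (m - 1) x = \<zero>\<^bsub>cmod X (m - 2)\<^esub> \<longleftrightarrow> cdiff X (m - 1) x = \<zero>\<^bsub>cmod X (m - 2)\<^esub>"
    if "x \<in> carrier (cmod X (m - 1))"
    using complex_diff_closed(1)[OF X that] X.add.inv_eq_1_iff by simp
  then show ?thesis
    by (auto simp: inv_cycles_def invariants_direct_sum cdiff_cone invariants_carrier)
qed

private lemma cycles_coneE:
  assumes "p \<in> carrier (inv_cycles m (mapping_cone X Y f))"
  obtains y x where "p = vpair y x"
proof -
  have "p \<in> invariants (cmod (mapping_cone X Y f) m)" using assms unfolding inv_cycles_def by simp
  from invariants_carrier[OF this] that show ?thesis by auto
qed

text \<open>
  If \<open>(y, 0) = d (a, b)\<close>, then \<open>b\<close> is a cycle and \<open>y = f b + d a\<close>.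
\<close>

lemma inv_exact_cone_1: "exact_at (inv_H m) (inv_h m) (mapping_cone X Y f) Y X (cone_inclusion X Y f) (homotopy_class X Y f)"
proof (rule co.exact_atI[of "mapping_cone X Y f" Y X _ "\<lambda>k y. vpair y \<zero>\<^bsub>cmod X (k - 1)\<^esub>" _ f])
  fix x assume x: "x \<in> carrier (inv_cycles m X)"
  have "vpair (f m x) \<zero>\<^bsub>cmod X (m - 1)\<^esub> = cdiff (mapping_cone X Y f) (m + 1) (vpair \<zero>\<^bsub>cmod Y (m + 1)\<^esub> x)"
    using x chain_mapD(2)[OF f, of x m] diff_zero[OF Y, of "m + 1"]
    by (simp add: cdiff_cone inv_cycles_def invariants_carrier)
  moreover have "vpair \<zero>\<^bsub>cmod Y (m + 1)\<^esub> x \<in> invariants (cmod (mapping_cone X Y f) (m + 1))"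
    using x by (simp add: invariants_direct_sum invariants_zero complexD(1)[OF Y] inv_cycles_def)
  ultimately show "vpair (f m x) \<zero>\<^bsub>cmod X (m - 1)\<^esub> \<in> inv_boundaries m (mapping_cone X Y f)"
    unfolding inv_boundaries_def by blast
next
  fix y assume y: "y \<in> carrier (inv_cycles m Y)" and "vpair y \<zero>\<^bsub>cmod X (m - 1)\<^esub> \<in> inv_boundaries m (mapping_cone X Y f)"
  then obtain p where p: "p \<in> invariants (cmod (mapping_cone X Y f) (m + 1))" "vpair y \<zero>\<^bsub>cmod X (m - 1)\<^esub> = cdiff (mapping_cone X Y f) (m + 1) p"
    unfolding inv_boundaries_def by blast
  from invariants_carrier[OF p(1)] obtain a b where ab: "p = vpair a b" by auto
  then have inv: "a \<in> invariants (cmod Y (m + 1))" "b \<in> invariants (cmod X m)"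
    using p(1) by (simp_all add: invariants_direct_sum)
  note c = invariants_carrier[OF inv(1)] invariants_carrier[OF inv(2)]
  have eq: "y = cdiff Y (m + 1) a \<oplus>\<^bsub>cmod Y m\<^esub> f m b" "\<ominus>\<^bsub>cmod X (m - 1)\<^esub> cdiff X m b = \<zero>\<^bsub>cmod X (m - 1)\<^esub>"
    using p(2) c by (simp_all add: ab cdiff_cone)
  have "cdiff X m b = \<zero>\<^bsub>cmod X (m - 1)\<^esub>"
    using eq(2) complex_diff_closed(1)[OF X c(2)] X.add.inv_eq_1_iff by simp
  then have b: "b \<in> carrier (inv_cycles m X)" using inv by (simp add: inv_cycles_def)
  have "y = f m b \<oplus>\<^bsub>cmod Y m\<^esub> cdiff Y (m + 1) a"
    using eq(1) complex_diff_closed(2)[OF Y c(1)] chain_mapD(2)[OF f c(2)] by (simp add: Y.a_comm)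
  from inv_cycles_differ[OF Y inv_cycles_chain_map(1)[OF X Y f b] inv(1) this] b
  show "\<exists>b\<in>carrier (inv_cycles m X). y \<otimes>\<^bsub>inv_cycles m Y\<^esub> inv\<^bsub>inv_cycles m Y\<^esub> f m b \<in> inv_boundaries m Y" by blast
qed (simp_all add: maps objects X Y)

text \<open>
  If \<open>x\<close> bounds in the suspension, \<open>x = - d b\<close>, then \<open>(y, x)\<close> differs from \<open>(y - f b, 0)\<close> by the
  boundary \<open>d (0, b)\<close>.
\<close>

lemma inv_exact_cone_2:
  "exact_at (inv_H m) (inv_h m) (susp X) (mapping_cone X Y f) Y (cone_projection X Y f) (cone_inclusion X Y f)"
proof (rule co.exact_atI[of "susp X" "mapping_cone X Y f" Y _ "\<lambda>k. vsnd" _ "\<lambda>k y. vpair y \<zero>\<^bsub>cmod X (k - 1)\<^esub>"])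
  interpret B: subgroup "inv_boundaries m (susp X)" "inv_cycles m (susp X)"
    using inv_boundaries_subgroup objects by blast
  fix y show "vsnd (vpair y \<zero>\<^bsub>cmod X (m - 1)\<^esub>) \<in> inv_boundaries m (susp X)"
    using B.one_closed by (simp add: inv_cycles_def)
next
  fix p assume p: "p \<in> carrier (inv_cycles m (mapping_cone X Y f))" and "vsnd p \<in> inv_boundaries m (susp X)"
  moreover obtain y x where yx: "p = vpair y x" using p by (rule cycles_coneE)
  ultimately obtain b where b: "b \<in> invariants (cmod X m)" "x = \<ominus>\<^bsub>cmod X (m - 1)\<^esub> cdiff X m b"
    by (auto simp: inv_boundaries_def cdiff_shift invariants_carrier)
  have y: "y \<in> invariants (cmod Y m)" and yx0: "cdiff Y m y \<oplus>\<^bsub>cmod Y (m - 1)\<^esub> f (m - 1) x = \<zero>\<^bsub>cmod Y (m - 1)\<^esub>"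
    using p yx cycles_cone by auto
  note c = invariants_carrier[OF y] invariants_carrier[OF b(1)]
  note d = complex_diff_closed(1)[OF X c(2)] complex_diff_closed(1)[OF Y c(1)] chain_mapD(2)[OF f c(2)]
  define w where "w = y \<oplus>\<^bsub>cmod Y m\<^esub> \<ominus>\<^bsub>cmod Y m\<^esub> f m b"
  have fb: "f m b \<in> invariants (cmod Y m)"
    using invariants_hom[OF complexD(1)[OF X] complexD(1)[OF Y] chain_mapD(1)[OF f] b(1)] .
  have w: "w \<in> invariants (cmod Y m)"
    unfolding w_def using invariants_add invariants_minus complexD(1)[OF Y] y fb by blast
  have "cdiff Y m w = cdiff Y m y \<oplus>\<^bsub>cmod Y (m - 1)\<^esub> f (m - 1) x"
    using c d module_homD(2)[OF complexD(3)[OF Y] c(1) Y.a_inv_closed[OF d(3)]] diff_minus[OF Y d(3)]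
      module_hom_minus[OF complexD(1)[OF X] complexD(1)[OF Y] chain_mapD(1)[OF f] d(1)] chain_mapD(3)[OF f c(2)]
    by (simp add: w_def b(2))
  with yx0 w have wZ: "w \<in> carrier (inv_cycles m Y)" by (simp add: inv_cycles_def)
  have "p = vpair w \<zero>\<^bsub>cmod X (m - 1)\<^esub> \<oplus>\<^bsub>cmod (mapping_cone X Y f) m\<^esub> cdiff (mapping_cone X Y f) (m + 1) (vpair \<zero>\<^bsub>cmod Y (m + 1)\<^esub> b)"
    using c d diff_zero[OF Y, of "m + 1"] by (simp add: yx cdiff_cone b(2) w_def Y.a_assoc Y.l_neg)
  moreover have "vpair \<zero>\<^bsub>cmod Y (m + 1)\<^esub> b \<in> invariants (cmod (mapping_cone X Y f) (m + 1))"
    using b(1) by (simp add: invariants_direct_sum invariants_zero complexD(1)[OF Y])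
  ultimately have "p \<otimes>\<^bsub>inv_cycles m (mapping_cone X Y f)\<^esub> inv\<^bsub>inv_cycles m (mapping_cone X Y f)\<^esub> vpair w \<zero>\<^bsub>cmod X (m - 1)\<^esub> \<in> inv_boundaries m (mapping_cone X Y f)"
    using inv_cycles_differ[OF objects(1) inv_cycles_chain_map(1)[OF Y objects(1) cone_inclusion_chain_map[OF X Y f] wZ]]
    by blast
  with wZ show "\<exists>w\<in>carrier (inv_cycles m Y). p \<otimes>\<^bsub>inv_cycles m (mapping_cone X Y f)\<^esub>
      inv\<^bsub>inv_cycles m (mapping_cone X Y f)\<^esub> vpair w \<zero>\<^bsub>cmod X (m - 1)\<^esub> \<in> inv_boundaries m (mapping_cone X Y f)" by blast
qed (simp_all add: maps objects Y)

text \<open>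
  That \<open>f x = - d y\<close> for a cycle \<open>x\<close> says precisely that \<open>(y, x)\<close> is a cycle of the cone.
\<close>

lemma inv_exact_cone_3:
  "exact_at (inv_H m) (inv_h m) (susp Y) (susp X) (mapping_cone X Y f) (K_ShiftHom 1 X Y (homotopy_class X Y f)) (cone_projection X Y f)"
proof (rule co.exact_atI[of "susp Y" "susp X" "mapping_cone X Y f" _ "\<lambda>k. f (k - 1)" _ "\<lambda>k. vsnd"])
  have dSY: "cdiff (susp Y) (m + 1) y = \<ominus>\<^bsub>cmod Y (m - 1)\<^esub> cdiff Y m y" if "y \<in> carrier (cmod Y m)" for y
    using that by (simp add: cdiff_shift)
  {
    fix p assume p: "p \<in> carrier (inv_cycles m (mapping_cone X Y f))"
    then obtain y x where yx: "p = vpair y x" by (rule cycles_coneE)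
    then have "y \<in> invariants (cmod Y m)" "f (m - 1) x = cdiff (susp Y) (m + 1) y"
      using p cycles_cone Y.add_eq_zero_iff complex_diff_closed(1)[OF Y] chain_mapD(2)[OF f] by (auto simp: invariants_carrier dSY)
    then show "f (m - 1) (vsnd p) \<in> inv_boundaries m (susp Y)" by (simp add: yx inv_boundaries_def)
  next
    fix x assume x: "x \<in> carrier (inv_cycles m (susp X))" and "f (m - 1) x \<in> inv_boundaries m (susp Y)"
    then obtain y where y: "y \<in> invariants (cmod Y m)" "f (m - 1) x = cdiff (susp Y) (m + 1) y"
      by (auto simp: inv_boundaries_def)
    have "x \<in> invariants (cmod X (m - 1))" "cdiff X (m - 1) x = \<zero>\<^bsub>cmod X (m - 2)\<^esub>"
      using x unfolding inv_shift[OF X] by (simp_all add: inv_cycles_def)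
    then have "vpair y x \<in> carrier (inv_cycles m (mapping_cone X Y f))"
      using y Y.add_eq_zero_iff complex_diff_closed(1)[OF Y] chain_mapD(2)[OF f] cycles_cone by (simp add: invariants_carrier dSY)
    moreover have "x \<otimes>\<^bsub>inv_cycles m (susp X)\<^esub> inv\<^bsub>inv_cycles m (susp X)\<^esub> x \<in> inv_boundaries m (susp X)"
    proof -
      interpret Z: comm_group "inv_cycles m (susp X)" by (rule inv_cycles_comm_group[OF objects(2)])
      interpret B: subgroup "inv_boundaries m (susp X)" "inv_cycles m (susp X)" by (rule inv_boundaries_subgroup[OF objects(2)])
      show ?thesis using x B.one_closed by simp
    qed
    ultimately show "\<exists>p\<in>carrier (inv_cycles m (mapping_cone X Y f)). x \<otimes>\<^bsub>inv_cycles m (susp X)\<^esub> inv\<^bsub>inv_cycles m (susp X)\<^esub> vsnd p \<in> inv_boundaries m (susp X)"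
      by (intro bexI[of _ "vpair y x"]) simp_all
  }
qed (simp_all add: maps objects)

end

lemma inv_functor: "cofunctor_to_Ab (dual K_cat) (inv_H m) (inv_h m)"
  by (rule cocycle_functor.h_functor[OF inv_cocycle_functor])

lemma inv_exact_triangle:
  assumes "(X, Y, Z, u, v, w) \<in> K_Triangles"
  shows "exact_at (inv_H m) (inv_h m) Z Y X v u"
    and "exact_at (inv_H m) (inv_h m) (shift_complex 1 X) Z Y w v"
    and "exact_at (inv_H m) (inv_h m) (shift_complex 1 Y) (shift_complex 1 X) Z (K_ShiftHom 1 X Y u) w"
  by (rule K_TrianglesE[OF assms], rule exact_at_isomorphic_pairs_dual[OF inv_functor], assumption,
      rule inv_exact_cone_1 inv_exact_cone_2 inv_exact_cone_3; assumption)+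

lemma inv_exact_shift:
  assumes ABC: "A \<in> chain_complexes" "B \<in> chain_complexes" "C \<in> chain_complexes"
    and FG: "F \<in> carrier (K_Hom B A)" "G \<in> carrier (K_Hom C B)"
  shows "exact_at (inv_H m) (inv_h m) (shift_complex n A) (shift_complex n B) (shift_complex n C)
      (K_ShiftHom n B A F) (K_ShiftHom n C B G) \<longleftrightarrow> exact_at (inv_H (m - n)) (inv_h (m - n)) A B C F G"
  unfolding exact_at_def inv_H_shift[OF ABC(1)] inv_H_shift[OF ABC(2)] inv_H_shift[OF ABC(3)]
  using inv_h_shift[OF ABC(1,2) FG(1)] inv_h_shift[OF ABC(2,3) FG(2)] by (simp cong: image_cong)

lemma K_ShiftHom_inverse:
  assumes "X \<in> chain_complexes" "Y \<in> chain_complexes" "F \<in> carrier (K_Hom X Y)"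
  shows "K_ShiftHom 1 (shift_complex (- 1) X) (shift_complex (- 1) Y) (K_ShiftHom (- 1) X Y F) = F"
proof -
  obtain f where f: "f \<in> chain_maps X Y" "F = homotopy_class X Y f" using K_HomE[OF assms] .
  show ?thesis
    using shift_chain_map[OF assms(1,2) f(1), of "- 1"] assms(1,2) f
    by (simp add: K_ShiftHom_homotopy_class shift_complex_closed shift_complex_inverse)
qed

text \<open>
  A triangle of the dual is a triangle read backwards, which starts at the desuspension of its first
  object.  Two of the three exactness conditions are those of that triangle; the third one
  is its third condition one degree higher, because suspension and desuspension only reindex the
  homology.
\<close>

lemma inv_homological: "homological (dual K_cat) (inv_H m) (inv_h m)"
  unfolding homological_def
proof (intro ballI, clarify, unfold Let_def dual_simps K_cat_simps)
  fix X Y Z :: "'u::universe chain_complex" and u v w and n :: int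
  let ?S = "shift_complex (- n)" and ?D = "shift_complex (- 1)" and ?N = "m + n"
  let ?Du = "K_ShiftHom (- 1) Y X u"
  assume "(X, Y, Z, u, v, w) \<in> Triangles (dual K_cat)"
  then have XYZ: "X \<in> chain_complexes" "Y \<in> chain_complexes" "Z \<in> chain_complexes"
    and tri: "(?D X, Z, Y, w, v, u) \<in> K_Triangles" by (simp_all add: dual_def)
  have DD: "shift_complex 1 (?D X) = X" "shift_complex 1 (?D Y) = Y"
    using XYZ by (simp_all add: shift_complex_inverse)
  have hom: "u \<in> carrier (K_Hom Y X)" "v \<in> carrier (K_Hom Z Y)" "w \<in> carrier (K_Hom (?D X) Z)"
    using tri DD by (auto simp: K_Triangles_def)
  have D: "?D X \<in> chain_complexes" "?D Y \<in> chain_complexes" "?Du \<in> carrier (K_Hom (?D Y) (?D X))"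
    using XYZ hom by (simp_all add: shift_complex_closed K_ShiftHom_closed)
  note ex = inv_exact_triangle[OF tri, unfolded DD]
  have 3: "exact_at (inv_H ?N) (inv_h ?N) Z (?D X) (?D Y) w ?Du"
    using inv_exact_shift[OF XYZ(3) D(1,2) hom(3) D(3), of "?N + 1" 1] ex(3)[of "?N + 1"]
    by (simp add: DD K_ShiftHom_inverse XYZ hom)
  have exact:
    "exact_at (inv_H m) (inv_h m) (?S X) (?S Y) (?S Z) (K_ShiftHom (- n) Y X u) (K_ShiftHom (- n) Z Y v)"
    "exact_at (inv_H m) (inv_h m) (?S Y) (?S Z) (?S (?D X)) (K_ShiftHom (- n) Z Y v) (K_ShiftHom (- n) (?D X) Z w)"
    "exact_at (inv_H m) (inv_h m) (?S Z) (?S (?D X)) (?S (?D Y)) (K_ShiftHom (- n) (?D X) Z w) (K_ShiftHom (- n) (?D Y) (?D X) ?Du)"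
    using ex(1,2)[of ?N] 3 by (simp_all add: inv_exact_shift XYZ D hom)
  have grp: "group (inv_H m (?S W))" if "W \<in> chain_complexes" for W
    by (rule cofunctor_group[OF inv_functor]) (simp add: shift_complex_closed that)
  have h_hom: "inv_h m (?S V) (?S W) (K_ShiftHom (- n) W V F) \<in> hom (inv_H m (?S W)) (inv_H m (?S V))"
    if "V \<in> chain_complexes" "W \<in> chain_complexes" "F \<in> carrier (K_Hom W V)" for V W F
    by (rule cofunctor_hom[OF inv_functor]) (simp_all add: shift_complex_closed K_ShiftHom_closed that)
  show "exact_seq
      ([inv_H m (?S X), inv_H m (?S Y), inv_H m (?S Z), inv_H m (?S (?D X)), inv_H m (?S (?D Y))],
       [inv_h m (?S X) (?S Y) (K_ShiftHom (- n) Y X u), inv_h m (?S Y) (?S Z) (K_ShiftHom (- n) Z Y v),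
        inv_h m (?S Z) (?S (?D X)) (K_ShiftHom (- n) (?D X) Z w),
        inv_h m (?S (?D X)) (?S (?D Y)) (K_ShiftHom (- n) (?D Y) (?D X) ?Du)])"
    by (rule exact_seq_five[OF grp[OF XYZ(1)] grp[OF XYZ(2)] grp[OF XYZ(3)] grp[OF D(1)] grp[OF D(2)]
          h_hom[OF XYZ(1,2) hom(1)] h_hom[OF XYZ(2,3) hom(2)] h_hom[OF XYZ(3) D(1) hom(3)] h_hom[OF D]])
      (use exact in \<open>simp_all add: exact_at_def\<close>)
qed

section \<open>Cohomology of functionals\<close>

text \<open>
  Predicates stand for functions with values in \<open>F\<^sub>2\<close>, and addition in \<open>F\<^sub>2\<close> is exclusive or.
\<close>

definition functional :: "'u::universe big_module \<Rightarrow> ('u \<Rightarrow> bool) \<Rightarrow> bool" where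
  "functional M P \<longleftrightarrow> (\<forall>x\<in>carrier M. \<forall>y\<in>carrier M. P (x \<oplus>\<^bsub>M\<^esub> y) \<longleftrightarrow> P x \<noteq> P y) \<and>
     (\<forall>i. \<forall>x\<in>carrier M. \<not> P (var i \<odot>\<^bsub>M\<^esub> x))"

text \<open>
  A functional on a small module is coded by the set of the elements where it takes the value \<open>1\<close>.
\<close>

definition extent :: "'u::universe big_module \<Rightarrow> ('u \<Rightarrow> bool) \<Rightarrow> 'u" where
  "extent M P = set_of_class {x \<in> carrier M. P x}"

definition functionals :: "'u::universe big_module \<Rightarrow> 'u set" where
  "functionals M = {p. elts p \<subseteq> carrier M \<and> functional M (\<lambda>x. x \<in> elts p)}"

definition func_cocycles :: "int \<Rightarrow> 'u::universe chain_complex \<Rightarrow> 'u monoid" where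
  "func_cocycles m X =
     \<lparr>carrier = {p \<in> functionals (cmod X m). \<forall>x\<in>carrier (cmod X (m + 1)). cdiff X (m + 1) x \<notin> elts p},
      mult = (\<lambda>p q. extent (cmod X m) (\<lambda>x. x \<in> elts p \<longleftrightarrow> x \<notin> elts q)),
      one = extent (cmod X m) (\<lambda>x. False)\<rparr>"

definition func_coboundaries :: "int \<Rightarrow> 'u::universe chain_complex \<Rightarrow> 'u set" where
  "func_coboundaries m X =
     (\<lambda>q. extent (cmod X m) (\<lambda>x. cdiff X m x \<in> elts q)) ` functionals (cmod X (m - 1))"

definition func_pullback ::
  "int \<Rightarrow> 'u::universe chain_complex \<Rightarrow> 'u chain_complex \<Rightarrow> (int \<Rightarrow> 'u \<Rightarrow> 'u) \<Rightarrow> 'u \<Rightarrow> 'u" where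
  "func_pullback m X Y f p = extent (cmod X m) (\<lambda>x. f m x \<in> elts p)"

abbreviation func_H :: "int \<Rightarrow> 'u::universe chain_complex \<Rightarrow> 'u monoid" where
  "func_H m \<equiv> cocycle_functor.H (func_cocycles m) (func_coboundaries m)"

abbreviation func_h :: "int \<Rightarrow> 'u::universe chain_complex \<Rightarrow> 'u chain_complex \<Rightarrow> 'u hclass \<Rightarrow> 'u \<Rightarrow> 'u" where
  "func_h m \<equiv> cocycle_functor.h (func_cocycles m) (func_coboundaries m) (func_pullback m)"

lemma func_cocycles_ops:
  "p \<otimes>\<^bsub>func_cocycles m X\<^esub> q = extent (cmod X m) (\<lambda>x. x \<in> elts p \<longleftrightarrow> x \<notin> elts q)"
  "\<one>\<^bsub>func_cocycles m X\<^esub> = extent (cmod X m) (\<lambda>x. False)"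
  by (simp_all add: func_cocycles_def)

lemma elts_extent: "elts (extent M P) = {x \<in> carrier M. P x}" if "small_module M"
  unfolding extent_def
  by (rule elts_set_of_class, rule small_subset[OF small_moduleD(3)[OF that]]) auto

lemma extent_cong: "(\<And>x. x \<in> carrier M \<Longrightarrow> P x \<longleftrightarrow> Q x) \<Longrightarrow> extent M P = extent M Q"
  unfolding extent_def by (rule arg_cong[of _ _ set_of_class]) auto

lemma extent_elts:
  assumes "p \<in> functionals M"
  shows "extent M (\<lambda>x. x \<in> elts p) = p"
proof -
  have "{x \<in> carrier M. x \<in> elts p} = elts p" using assms by (auto simp: functionals_def)
  then show ?thesis by (simp add: extent_def)
qed

lemma functional_cong:
  assumes "small_module M" "\<And>x. x \<in> carrier M \<Longrightarrow> P x \<longleftrightarrow> Q x"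
  shows "functional M P \<longleftrightarrow> functional M Q"
proof -
  interpret M: abelian_group M using assms(1) by (rule small_moduleD)
  show ?thesis by (simp add: functional_def assms(2) small_module_smult[OF assms(1)])
qed

lemma extent_in_functionals: "small_module M \<Longrightarrow> extent M P \<in> functionals M \<longleftrightarrow> functional M P"
  using functional_cong[of M "\<lambda>x. x \<in> carrier M \<and> P x" P] by (auto simp: functionals_def elts_extent)

lemma functionalsD: "p \<in> functionals M \<Longrightarrow> functional M (\<lambda>x. x \<in> elts p)"
  by (simp add: functionals_def)

lemma functional_add:
  "\<lbrakk>functional M P; x \<in> carrier M; y \<in> carrier M\<rbrakk> \<Longrightarrow> P (x \<oplus>\<^bsub>M\<^esub> y) \<longleftrightarrow> P x \<noteq> P y"
  by (simp add: functional_def)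

lemma functional_zero:
  assumes "functional M P" "small_module M"
  shows "\<not> P \<zero>\<^bsub>M\<^esub>"
proof -
  interpret M: abelian_group M using assms(2) by (rule small_moduleD)
  show ?thesis using functional_add[OF assms(1), of "\<zero>\<^bsub>M\<^esub>" "\<zero>\<^bsub>M\<^esub>"] by simp
qed

lemma functional_minus:
  assumes "functional M P" "small_module M" "x \<in> carrier M"
  shows "P (\<ominus>\<^bsub>M\<^esub> x) \<longleftrightarrow> P x"
proof -
  interpret M: abelian_group M using assms(2) by (rule small_moduleD)
  show ?thesis
    using functional_add[OF assms(1), of x "\<ominus>\<^bsub>M\<^esub> x"] functional_zero[OF assms(1,2)] assms(3) by (simp add: M.r_neg)
qed

lemma functional_comp:
  assumes "functional N P" "f \<in> module_hom M N"
  shows "functional M (\<lambda>x. P (f x))"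
  using assms(1) module_homD[OF assms(2)] by (simp add: functional_def)

lemma functional_xor: "\<lbrakk>functional M P; functional M Q\<rbrakk> \<Longrightarrow> functional M (\<lambda>x. P x \<longleftrightarrow> \<not> Q x)"
  by (auto simp: functional_def)

lemma functional_False: "functional M (\<lambda>x. False)"
  by (simp add: functional_def)

lemma functional_direct_sum:
  "\<lbrakk>functional M P; functional N Q\<rbrakk> \<Longrightarrow> functional (direct_sum M N) (\<lambda>z. P (vfst z) \<longleftrightarrow> \<not> Q (vsnd z))"
  by (auto simp: functional_def)

lemma functional_on_direct_sum:
  assumes MN: "small_module M" "small_module N" and R: "functional (direct_sum M N) R"
  shows "functional M (\<lambda>x. R (vpair x \<zero>\<^bsub>N\<^esub>))" "functional N (\<lambda>y. R (vpair \<zero>\<^bsub>M\<^esub> y))"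
    and "\<lbrakk>x \<in> carrier M; y \<in> carrier N\<rbrakk> \<Longrightarrow> R (vpair x y) \<longleftrightarrow> R (vpair x \<zero>\<^bsub>N\<^esub>) \<noteq> R (vpair \<zero>\<^bsub>M\<^esub> y)"
proof -
  interpret M: module big_ring M using MN by (intro small_moduleD)
  interpret N: module big_ring N using MN by (intro small_moduleD)
  show "functional M (\<lambda>x. R (vpair x \<zero>\<^bsub>N\<^esub>))"
    by (rule functional_comp[OF R]) (auto intro!: module_homI simp: N.smult_r_null)
  show "functional N (\<lambda>y. R (vpair \<zero>\<^bsub>M\<^esub> y))"
    by (rule functional_comp[OF R]) (auto intro!: module_homI simp: M.smult_r_null)
  show "R (vpair x y) \<longleftrightarrow> R (vpair x \<zero>\<^bsub>N\<^esub>) \<noteq> R (vpair \<zero>\<^bsub>M\<^esub> y)" if "x \<in> carrier M" "y \<in> carrier N"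
    using functional_add[OF R, of "vpair x \<zero>\<^bsub>N\<^esub>" "vpair \<zero>\<^bsub>M\<^esub> y"] that by simp
qed

lemma func_cocyclesD:
  assumes "p \<in> carrier (func_cocycles m X)"
  shows "p \<in> functionals (cmod X m)" "functional (cmod X m) (\<lambda>x. x \<in> elts p)"
    and "x \<in> carrier (cmod X (m + 1)) \<Longrightarrow> cdiff X (m + 1) x \<notin> elts p"
  using assms by (simp_all add: func_cocycles_def functionalsD)

context
  fixes X :: "'u::universe chain_complex" assumes X: "X \<in> chain_complexes"
begin

lemma elts_extent_complex: "elts (extent (cmod X k) P) = {x \<in> carrier (cmod X k). P x}"
  by (rule elts_extent[OF complexD(1)[OF X]])

lemma func_cocyclesI:
  assumes "functional (cmod X m) P" "\<And>x. x \<in> carrier (cmod X (m + 1)) \<Longrightarrow> \<not> P (cdiff X (m + 1) x)"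
  shows "extent (cmod X m) P \<in> carrier (func_cocycles m X)"
  using assms by (simp add: func_cocycles_def extent_in_functionals complexD(1)[OF X] elts_extent_complex)

lemma func_coboundariesI:
  assumes "functional (cmod X (m - 1)) Q"
    and "\<And>x. x \<in> carrier (cmod X m) \<Longrightarrow> P x \<longleftrightarrow> Q (cdiff X m x)"
  shows "extent (cmod X m) P \<in> func_coboundaries m X"
proof -
  have "extent (cmod X m) P = extent (cmod X m) (\<lambda>x. cdiff X m x \<in> elts (extent (cmod X (m - 1)) Q))"
    using assms(2) complex_diff_closed(1)[OF X] by (intro extent_cong) (simp add: elts_extent_complex)
  then show ?thesis
    using assms(1) by (simp add: func_coboundaries_def extent_in_functionals complexD(1)[OF X])
qed

lemma func_coboundariesE:
  assumes "extent (cmod X m) P \<in> func_coboundaries m X"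
  obtains Q where "functional (cmod X (m - 1)) Q"
    "\<And>x. x \<in> carrier (cmod X m) \<Longrightarrow> P x \<longleftrightarrow> Q (cdiff X m x)"
proof -
  obtain q where q: "q \<in> functionals (cmod X (m - 1))"
    "extent (cmod X m) P = extent (cmod X m) (\<lambda>x. cdiff X m x \<in> elts q)"
    using assms unfolding func_coboundaries_def by blast
  then have "{x \<in> carrier (cmod X m). P x} = {x \<in> carrier (cmod X m). cdiff X m x \<in> elts q}"
    using elts_extent_complex by metis
  then show ?thesis using functionalsD[OF q(1)] by (intro that) auto
qed

lemma func_cocycles_comm_group: "comm_group (func_cocycles m X)"
proof (rule comm_groupI)
  show "\<one>\<^bsub>func_cocycles m X\<^esub> \<in> carrier (func_cocycles m X)"
    using func_cocyclesI[OF functional_False] by (simp add: func_cocycles_ops)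
  fix p q assume p: "p \<in> carrier (func_cocycles m X)" and q: "q \<in> carrier (func_cocycles m X)"
  show "p \<otimes>\<^bsub>func_cocycles m X\<^esub> q \<in> carrier (func_cocycles m X)"
    using func_cocyclesI[OF functional_xor[OF func_cocyclesD(2)[OF p] func_cocyclesD(2)[OF q]]]
      func_cocyclesD(3)[OF p] func_cocyclesD(3)[OF q] by (simp add: func_cocycles_ops)
  show "p \<otimes>\<^bsub>func_cocycles m X\<^esub> q = q \<otimes>\<^bsub>func_cocycles m X\<^esub> p"
    by (auto simp: func_cocycles_ops intro: extent_cong)
  show "\<one>\<^bsub>func_cocycles m X\<^esub> \<otimes>\<^bsub>func_cocycles m X\<^esub> p = p"
    using extent_elts[OF func_cocyclesD(1)[OF p]] by (simp add: func_cocycles_ops elts_extent_complex)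
  show "\<exists>q\<in>carrier (func_cocycles m X). q \<otimes>\<^bsub>func_cocycles m X\<^esub> p = \<one>\<^bsub>func_cocycles m X\<^esub>"
    using p by (intro bexI[of _ p]) (simp_all add: func_cocycles_ops)
  fix r assume "r \<in> carrier (func_cocycles m X)"
  show "p \<otimes>\<^bsub>func_cocycles m X\<^esub> q \<otimes>\<^bsub>func_cocycles m X\<^esub> r = p \<otimes>\<^bsub>func_cocycles m X\<^esub> (q \<otimes>\<^bsub>func_cocycles m X\<^esub> r)"
    by (auto simp: func_cocycles_ops elts_extent_complex intro!: extent_cong)
qed

lemma func_inverse: "p \<in> carrier (func_cocycles m X) \<Longrightarrow> inv\<^bsub>func_cocycles m X\<^esub> p = p"
  by (rule group.inv_equality)
    (use func_cocycles_comm_group in \<open>auto simp: comm_group_def func_cocycles_ops\<close>)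

lemma func_coboundaries_subset: "func_coboundaries m X \<subseteq> carrier (func_cocycles m X)"
proof
  fix b assume "b \<in> func_coboundaries m X"
  then obtain q where q: "q \<in> functionals (cmod X (m - 1))" "b = extent (cmod X m) (\<lambda>x. cdiff X m x \<in> elts q)"
    unfolding func_coboundaries_def by blast
  have "functional (cmod X m) (\<lambda>x. cdiff X m x \<in> elts q)"
    using functionalsD[OF q(1)] complexD(3)[OF X] by (rule functional_comp)
  then show "b \<in> carrier (func_cocycles m X)"
    using functional_zero[OF functionalsD[OF q(1)] complexD(1)[OF X]] complex_diff_from_above(2)[OF X]
    unfolding q(2) by (intro func_cocyclesI) auto
qed

lemma func_coboundaries_subgroup: "subgroup (func_coboundaries m X) (func_cocycles m X)"
proof -
  interpret Z: comm_group "func_cocycles m X" by (rule func_cocycles_comm_group)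
  show ?thesis
  proof (rule Z.subgroupI)
    show "func_coboundaries m X \<noteq> {}"
      using func_coboundariesI[OF functional_False] by auto
    show "inv\<^bsub>func_cocycles m X\<^esub> a \<in> func_coboundaries m X" if "a \<in> func_coboundaries m X" for a
      using that subsetD[OF func_coboundaries_subset that] by (simp add: func_inverse)
    fix a b assume "a \<in> func_coboundaries m X" "b \<in> func_coboundaries m X"
    then obtain p q where p: "p \<in> functionals (cmod X (m - 1))" "a = extent (cmod X m) (\<lambda>x. cdiff X m x \<in> elts p)"
      and q: "q \<in> functionals (cmod X (m - 1))" "b = extent (cmod X m) (\<lambda>x. cdiff X m x \<in> elts q)"
      unfolding func_coboundaries_def by blast
    have "extent (cmod X m) (\<lambda>x. x \<in> elts a \<longleftrightarrow> x \<notin> elts b) \<in> func_coboundaries m X"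
      by (rule func_coboundariesI[OF functional_xor[OF functionalsD[OF p(1)] functionalsD[OF q(1)]]])
        (simp add: p(2) q(2) elts_extent_complex)
    then show "a \<otimes>\<^bsub>func_cocycles m X\<^esub> b \<in> func_coboundaries m X" by (simp add: func_cocycles_ops)
  qed (rule func_coboundaries_subset)
qed

lemma func_cocycles_differ:
  assumes "q \<in> carrier (func_cocycles m X)" and "functional (cmod X (m - 1)) R"
    and "\<And>x. x \<in> carrier (cmod X m) \<Longrightarrow> x \<in> elts p \<longleftrightarrow> (x \<in> elts q) \<noteq> R (cdiff X m x)"
  shows "p \<otimes>\<^bsub>func_cocycles m X\<^esub> inv\<^bsub>func_cocycles m X\<^esub> q \<in> func_coboundaries m X"
proof -
  have "extent (cmod X m) (\<lambda>x. x \<in> elts p \<longleftrightarrow> x \<notin> elts q) \<in> func_coboundaries m X"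
    using assms(3) by (intro func_coboundariesI[OF assms(2)]) auto
  then show ?thesis unfolding func_inverse[OF assms(1)] by (simp add: func_cocycles_ops)
qed

end

lemma func_pullback_chain_map:
  assumes XY: "X \<in> chain_complexes" "Y \<in> chain_complexes" and f: "f \<in> chain_maps X Y"
  shows "p \<in> carrier (func_cocycles m Y) \<Longrightarrow> func_pullback m X Y f p \<in> carrier (func_cocycles m X)"
    and "p \<in> func_coboundaries m Y \<Longrightarrow> func_pullback m X Y f p \<in> func_coboundaries m X"
proof -
  assume p: "p \<in> carrier (func_cocycles m Y)"
  have "f m (cdiff X (m + 1) x) \<notin> elts p" if "x \<in> carrier (cmod X (m + 1))" for x
    using func_cocyclesD(3)[OF p chain_mapD(2)[OF f that]] chain_mapD(4)[OF f that] by simp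
  then show "func_pullback m X Y f p \<in> carrier (func_cocycles m X)"
    unfolding func_pullback_def
    by (intro func_cocyclesI XY functional_comp[OF func_cocyclesD(2)[OF p] chain_mapD(1)[OF f]])
next
  assume "p \<in> func_coboundaries m Y"
  then obtain q where q: "q \<in> functionals (cmod Y (m - 1))" "p = extent (cmod Y m) (\<lambda>x. cdiff Y m x \<in> elts q)"
    unfolding func_coboundaries_def by blast
  show "func_pullback m X Y f p \<in> func_coboundaries m X"
    unfolding func_pullback_def
    by (rule func_coboundariesI[OF XY(1) functional_comp[OF functionalsD[OF q(1)] chain_mapD(1)[OF f]]])
      (simp add: q(2) elts_extent_complex[OF XY(2)] chain_mapD(2,3)[OF f])
qed

lemma func_cocycle_functor:
  "cocycle_functor K_cat (func_cocycles m) (func_coboundaries m) (func_pullback m)"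
proof (rule cocycle_functor.intro, unfold K_cat_simps)
  fix X :: "'u::universe chain_complex" assume X: "X \<in> chain_complexes"
  show "comm_group (func_cocycles m X)" "subgroup (func_coboundaries m X) (func_cocycles m X)"
    using X by (rule func_cocycles_comm_group func_coboundaries_subgroup)+
  have "carrier (func_cocycles m X) \<subseteq> {p. elts p \<subseteq> carrier (cmod X m)}"
    by (auto simp: func_cocycles_def functionals_def)
  then show "small (carrier (func_cocycles m X))"
    using small_subset small_codes_of_subsets small_moduleD(3) complexD(1)[OF X] by metis
  have "func_pullback m X X (\<lambda>k x. x) p = p" if "p \<in> carrier (func_cocycles m X)" for p
    using extent_elts[OF func_cocyclesD(1)[OF that]] by (simp add: func_pullback_def)
  then show "K_Id X \<in> carrier (K_Hom X X) \<and> (\<exists>f\<in>K_Id X. \<forall>z\<in>carrier (func_cocycles m X). func_pullback m X X f z = z)"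
    using homotopy_class_in_K_Hom[OF X X chain_map_id] mem_homotopy_class_self[OF X X chain_map_id]
    unfolding K_Id_def by (intro conjI bexI[of _ "\<lambda>k x. x"]) simp_all
next
  fix X Y :: "'u::universe chain_complex" and F f
  assume XY: "X \<in> chain_complexes" "Y \<in> chain_complexes" and F: "F \<in> carrier (K_Hom X Y)"
  show "F \<noteq> {}" using K_Hom_nonempty XY F by blast
  assume fF: "f \<in> F"
  note f = K_Hom_memD(1)[OF XY F fF]
  show "func_pullback m X Y f \<in> hom (func_cocycles m Y) (func_cocycles m X)"
  proof (rule homI)
    fix p q assume pq: "p \<in> carrier (func_cocycles m Y)" "q \<in> carrier (func_cocycles m Y)"
    show "func_pullback m X Y f (p \<otimes>\<^bsub>func_cocycles m Y\<^esub> q) =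
        func_pullback m X Y f p \<otimes>\<^bsub>func_cocycles m X\<^esub> func_pullback m X Y f q"
      by (auto simp: func_cocycles_ops func_pullback_def elts_extent_complex XY chain_mapD(2)[OF f] intro!: extent_cong)
  qed (rule func_pullback_chain_map(1)[OF XY f])
  show "func_pullback m X Y f z \<in> func_coboundaries m X" if "z \<in> func_coboundaries m Y" for z
    using that by (rule func_pullback_chain_map(2)[OF XY f])
  fix g p assume gF: "g \<in> F" and p: "p \<in> carrier (func_cocycles m Y)"
  note g = K_Hom_memD(1)[OF XY F gF]
  obtain s where s: "homotopy X Y s f g" using K_Hom_homotopy[OF XY F fF gF] .
  interpret M: abelian_group "cmod Y m" using XY(2) by (rule complexD)
  show "func_pullback m X Y f p \<otimes>\<^bsub>func_cocycles m X\<^esub> inv\<^bsub>func_cocycles m X\<^esub> func_pullback m X Y g p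
      \<in> func_coboundaries m X"
  proof (rule func_cocycles_differ[OF XY(1) func_pullback_chain_map(1)[OF XY g p]])
    show "functional (cmod X (m - 1)) (\<lambda>x. s (m - 1) x \<in> elts p)"
      by (rule functional_comp[OF func_cocyclesD(2)[OF p] homotopyD(2)[OF s]])
    fix x assume x: "x \<in> carrier (cmod X m)"
    note c = homotopy_closed[OF XY s x] chain_mapD(2)[OF g x]
    have "f m x \<in> elts p \<longleftrightarrow> (g m x \<in> elts p) \<noteq> (s (m - 1) (cdiff X m x) \<in> elts p)"
      using homotopyD(3)[OF s x] c func_cocyclesD(3)[OF p c(1)] by (simp add: functional_add[OF func_cocyclesD(2)[OF p]])
    with x show "x \<in> elts (func_pullback m X Y f p) \<longleftrightarrow>
        (x \<in> elts (func_pullback m X Y g p)) \<noteq> (s (m - 1) (cdiff X m x) \<in> elts p)"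
      by (simp add: func_pullback_def elts_extent_complex XY)
  qed
next
  fix X Y W :: "'u::universe chain_complex" and F G
  assume XYW: "X \<in> chain_complexes" "Y \<in> chain_complexes" "W \<in> chain_complexes"
    and F: "F \<in> carrier (K_Hom X Y)" and G: "G \<in> carrier (K_Hom Y W)"
  obtain f where f: "f \<in> chain_maps X Y" "F = homotopy_class X Y f" using K_HomE[OF XYW(1,2) F] .
  obtain g where g: "g \<in> chain_maps Y W" "G = homotopy_class Y W g" using K_HomE[OF XYW(2,3) G] .
  have K: "K_Comp X Y W G F = homotopy_class X W (\<lambda>k. g k \<circ> f k)"
    using K_Comp_homotopy_class[OF XYW f(1) g(1)] f g by simp
  have "f \<in> F" "g \<in> G" "(\<lambda>k. g k \<circ> f k) \<in> K_Comp X Y W G F"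
    unfolding K using f g by (simp_all add: mem_homotopy_class_self XYW chain_map_comp)
  moreover have "K_Comp X Y W G F \<in> carrier (K_Hom X W)"
    unfolding K using f g by (simp add: homotopy_class_in_K_Hom XYW chain_map_comp)
  moreover have "func_pullback m X W (\<lambda>k. g k \<circ> f k) z = func_pullback m X Y f (func_pullback m Y W g z)" for z
    by (auto simp: func_pullback_def elts_extent_complex XYW chain_mapD(2)[OF f(1)] intro!: extent_cong)
  ultimately show "K_Comp X Y W G F \<in> carrier (K_Hom X W) \<and>
      (\<exists>k\<in>K_Comp X Y W G F. \<exists>f\<in>F. \<exists>g\<in>G. \<forall>z\<in>carrier (func_cocycles m W).
        func_pullback m X W k z = func_pullback m X Y f (func_pullback m Y W g z))"
    by blast
qed

lemma func_shift:
  assumes X: "X \<in> chain_complexes"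
  shows "func_cocycles m (shift_complex n X) = func_cocycles (m - n) X"
    and "func_coboundaries m (shift_complex n X) = func_coboundaries (m - n) X"
proof -
  have idx: "m - 1 - n = m - n - 1" "m + 1 - n = m - n + 1" "m - n + 1 - 1 = m - n" by simp_all
  have "cdiff (shift_complex n X) (m + 1) x \<in> elts p \<longleftrightarrow> cdiff X (m - n + 1) x \<in> elts p"
    if "x \<in> carrier (cmod X (m - n + 1))" "p \<in> functionals (cmod X (m - n))" for x p
    using functional_minus[OF functionalsD[OF that(2)] complexD(1)[OF X] complex_diff_closed(2)[OF X that(1)]] that(1)
    by (simp add: cdiff_shift idx)
  then show "func_cocycles m (shift_complex n X) = func_cocycles (m - n) X"
    by (auto simp: func_cocycles_def idx)
  have "cdiff (shift_complex n X) m x \<in> elts p \<longleftrightarrow> cdiff X (m - n) x \<in> elts p"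
    if "x \<in> carrier (cmod X (m - n))" "p \<in> functionals (cmod X (m - n - 1))" for x p
    using functional_minus[OF functionalsD[OF that(2)] complexD(1)[OF X] complex_diff_closed(1)[OF X that(1)]] that(1)
    by (simp add: cdiff_shift idx)
  then show "func_coboundaries m (shift_complex n X) = func_coboundaries (m - n) X"
    unfolding func_coboundaries_def by (auto simp: idx intro!: image_cong extent_cong)
qed

lemma func_H_shift: "func_H m (shift_complex n X) = func_H (m - n) X" if "X \<in> chain_complexes"
  for X :: "'u::universe chain_complex"
proof -
  interpret contra: cocycle_functor "K_cat :: 'u homotopy_cat"
    "func_cocycles k" "func_coboundaries k" "func_pullback k" for k
    by (rule func_cocycle_functor)
  show ?thesis using that by (simp add: contra.H_def func_shift)
qed

lemma func_h_shift:
  fixes X Y :: "'u::universe chain_complex"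
  assumes XY: "X \<in> chain_complexes" "Y \<in> chain_complexes" and F: "F \<in> carrier (K_Hom X Y)"
    and c: "c \<in> carrier (func_H (m - n) Y)"
  shows "func_h m (shift_complex n X) (shift_complex n Y) (K_ShiftHom n X Y F) c = func_h (m - n) X Y F c"
proof -
  interpret contra: cocycle_functor "K_cat :: 'u homotopy_cat"
    "func_cocycles k" "func_coboundaries k" "func_pullback k" for k
    by (rule func_cocycle_functor)
  obtain f where f: "f \<in> chain_maps X Y" "F = homotopy_class X Y f" using K_HomE[OF XY F] .
  have "c \<in> contra.cls (m - n) Y ` carrier (func_cocycles (m - n) Y)" using c XY by (simp add: contra.carrier_H)
  then obtain z where z: "z \<in> carrier (func_cocycles (m - n) Y)" "c = contra.cls (m - n) Y z" by blast
  have cls: "contra.cls m (shift_complex n W) w = contra.cls (m - n) W w" if "W \<in> chain_complexes" for W w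
    using that by (simp add: contra.cls_def func_shift)
  have "contra.h m (shift_complex n X) (shift_complex n Y) (K_ShiftHom n X Y F) (contra.cls m (shift_complex n Y) z)
      = contra.cls m (shift_complex n X) (func_pullback (m - n) X Y f z)"
    using contra.h_cls[of "shift_complex n X" "shift_complex n Y" "K_ShiftHom n X Y F" "\<lambda>k. f (k - n)" z m]
      XY f z K_ShiftHom_closed[OF XY F] mem_homotopy_class_self[OF _ _ shift_chain_map[OF XY f(1)]]
    by (simp add: shift_complex_closed func_shift K_ShiftHom_homotopy_class func_pullback_def)
  moreover have "contra.h (m - n) X Y F c = contra.cls (m - n) X (func_pullback (m - n) X Y f z)"
    using contra.h_cls[of X Y F f z "m - n"] XY f z F mem_homotopy_class_self[OF XY f(1)] by simp
  ultimately show ?thesis using z XY by (simp add: cls)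
qed

context
  fixes X Y :: "'u::universe chain_complex" and f
  assumes X: "X \<in> chain_complexes" and Y: "Y \<in> chain_complexes" and f: "f \<in> chain_maps X Y"
begin

interpretation contra: cocycle_functor "K_cat :: 'u homotopy_cat"
    "func_cocycles k" "func_coboundaries k" "func_pullback k" for k
  by (rule func_cocycle_functor)

interpretation X: abelian_group "cmod X k" for k using X by (rule complexD)
interpretation Y: abelian_group "cmod Y k" for k using Y by (rule complexD)


private lemmas objects' = cone_objects[OF X Y f]
private lemmas maps' = cone_maps[OF X Y f]
private lemmas diff_closed = complex_diff_closed[OF X] complex_diff_closed[OF Y]
private lemmas f_closed = chain_mapD(2)[OF f]
private lemmas elts_extents = elts_extent_complex[OF X] elts_extent_complex[OF Y] 
  elts_extent_complex[OF objects'(1), unfolded cmod_cone]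

private lemma functional_cone:
  assumes R: "functional (cmod (mapping_cone X Y f) k) R"
  shows "functional (cmod Y k) (\<lambda>y. R (vpair y \<zero>\<^bsub>cmod X (k - 1)\<^esub>))"
    and "functional (cmod X (k - 1)) (\<lambda>x. R (vpair \<zero>\<^bsub>cmod Y k\<^esub> x))"
    and "\<lbrakk>y \<in> carrier (cmod Y k); x \<in> carrier (cmod X (k - 1))\<rbrakk> \<Longrightarrow>
      R (vpair y x) \<longleftrightarrow> R (vpair y \<zero>\<^bsub>cmod X (k - 1)\<^esub>) \<noteq> R (vpair \<zero>\<^bsub>cmod Y k\<^esub> x)"
  using functional_on_direct_sum[OF complexD(1)[OF Y] complexD(1)[OF X]] R by simp_all

text \<open>
  The functional \<open>R\<close> is the sum of its components \<open>P\<close> and \<open>Q\<close> on the two summands of the cone, and its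
  differential has the components \<open>P d\<close> and \<open>P f + Q d\<close>; signs disappear modulo \<open>2\<close>.
\<close>

private lemma functional_cone_diff:
  assumes R: "functional (cmod (mapping_cone X Y f) k) R" and y: "y \<in> carrier (cmod Y (k + 1))" and x: "x \<in> carrier (cmod X k)"
  shows "R (cdiff (mapping_cone X Y f) (k + 1) (vpair y x)) \<longleftrightarrow>
    (R (vpair (cdiff Y (k + 1) y) \<zero>\<^bsub>cmod X (k - 1)\<^esub>) \<noteq> R (vpair (f k x) \<zero>\<^bsub>cmod X (k - 1)\<^esub>)) \<noteq>
    R (vpair \<zero>\<^bsub>cmod Y k\<^esub> (cdiff X k x))"
  using functional_cone(3)[OF R, of "cdiff Y (k + 1) y \<oplus>\<^bsub>cmod Y k\<^esub> f k x" "\<ominus>\<^bsub>cmod X (k - 1)\<^esub> cdiff X k x"]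
    functional_add[OF functional_cone(1)[OF R] diff_closed(4)[OF y] f_closed[OF x]]
    functional_minus[OF functional_cone(2)[OF R] complexD(1)[OF X] diff_closed(1)[OF x]]
    y x diff_closed(4)[OF y] diff_closed(1)[OF x] f_closed[OF x]
  by (simp add: cdiff_cone)

private lemma cocycle_cone:
  assumes r: "r \<in> carrier (func_cocycles m (mapping_cone X Y f))"
  shows "y \<in> carrier (cmod Y (m + 1)) \<Longrightarrow> vpair (cdiff Y (m + 1) y) \<zero>\<^bsub>cmod X (m - 1)\<^esub> \<notin> elts r"
    and "x \<in> carrier (cmod X m) \<Longrightarrow>
      vpair (f m x) \<zero>\<^bsub>cmod X (m - 1)\<^esub> \<in> elts r \<longleftrightarrow> vpair \<zero>\<^bsub>cmod Y m\<^esub> (cdiff X m x) \<in> elts r"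
proof -
  note R = func_cocyclesD(2)[OF r]
  have R0: "cdiff (mapping_cone X Y f) (m + 1) (vpair y x) \<notin> elts r" if "y \<in> carrier (cmod Y (m + 1))" "x \<in> carrier (cmod X m)" for x y
    using func_cocyclesD(3)[OF r, of "vpair y x"] that by simp
  have zeros: "f m \<zero>\<^bsub>cmod X m\<^esub> = \<zero>\<^bsub>cmod Y m\<^esub>" "cdiff X m \<zero>\<^bsub>cmod X m\<^esub> = \<zero>\<^bsub>cmod X (m - 1)\<^esub>"
    "cdiff Y (m + 1) \<zero>\<^bsub>cmod Y (m + 1)\<^esub> = \<zero>\<^bsub>cmod Y m\<^esub>"
    using module_hom_zero[OF complexD(1)[OF X] complexD(1)[OF Y] chain_mapD(1)[OF f]] diff_zero[OF X]
      diff_zero[OF Y, of "m + 1"] by simp_all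
  have R00: "vpair \<zero>\<^bsub>cmod Y m\<^esub> \<zero>\<^bsub>cmod X (m - 1)\<^esub> \<notin> elts r"
    using functional_zero[OF R complexD(1)[OF objects'(1)]] by simp
  show "vpair (cdiff Y (m + 1) y) \<zero>\<^bsub>cmod X (m - 1)\<^esub> \<notin> elts r" if "y \<in> carrier (cmod Y (m + 1))"
    using functional_cone_diff[OF R that X.zero_closed] R0[OF that X.zero_closed] R00 by (simp add: zeros)
  show "vpair (f m x) \<zero>\<^bsub>cmod X (m - 1)\<^esub> \<in> elts r \<longleftrightarrow> vpair \<zero>\<^bsub>cmod Y m\<^esub> (cdiff X m x) \<in> elts r" if "x \<in> carrier (cmod X m)"
    using functional_cone_diff[OF R Y.zero_closed that] R0[OF Y.zero_closed that] R00 by (simp add: zeros)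
qed

private lemma cocycle_coneI:
  assumes P: "functional (cmod Y m) P" and Q: "functional (cmod X (m - 1)) Q"
    and "\<And>y. y \<in> carrier (cmod Y (m + 1)) \<Longrightarrow> \<not> P (cdiff Y (m + 1) y)"
    and "\<And>x. x \<in> carrier (cmod X m) \<Longrightarrow> P (f m x) \<longleftrightarrow> Q (cdiff X m x)"
  shows "extent (cmod (mapping_cone X Y f) m) (\<lambda>z. P (vfst z) \<longleftrightarrow> \<not> Q (vsnd z)) \<in> carrier (func_cocycles m (mapping_cone X Y f))"
proof (rule func_cocyclesI[OF objects'(1)])
  show R: "functional (cmod (mapping_cone X Y f) m) (\<lambda>z. P (vfst z) \<longleftrightarrow> \<not> Q (vsnd z))"
    using functional_direct_sum[OF P Q] by simp
  fix z assume "z \<in> carrier (cmod (mapping_cone X Y f) (m + 1))"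
  then obtain y x where z: "z = vpair y x" "y \<in> carrier (cmod Y (m + 1))" "x \<in> carrier (cmod X m)" by auto
  show "\<not> (P (vfst (cdiff (mapping_cone X Y f) (m + 1) z)) \<longleftrightarrow> \<not> Q (vsnd (cdiff (mapping_cone X Y f) (m + 1) z)))"
    using functional_cone_diff[OF R z(2,3)] assms(3)[OF z(2)] assms(4)[OF z(3)]
      functional_zero[OF P complexD(1)[OF Y]] functional_zero[OF Q complexD(1)[OF X]] by (simp add: z(1))
qed

text \<open>
  If \<open>p f = Q d\<close>, then \<open>p\<close> and \<open>Q\<close> are the components of a cocycle of the cone.
\<close>

lemma func_exact_cone_1: "exact_at (func_H m) (func_h m) X Y (mapping_cone X Y f) (homotopy_class X Y f) (cone_inclusion X Y f)"
proof (rule contra.exact_atI[of X Y "mapping_cone X Y f" _ f _ "\<lambda>k y. vpair y \<zero>\<^bsub>cmod X (k - 1)\<^esub>"])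
  fix r assume r: "r \<in> carrier (func_cocycles m (mapping_cone X Y f))"
  show "func_pullback m X Y f (func_pullback m Y (mapping_cone X Y f) (\<lambda>k y. vpair y \<zero>\<^bsub>cmod X (k - 1)\<^esub>) r) \<in> func_coboundaries m X"
    unfolding func_pullback_def
    by (rule func_coboundariesI[OF X functional_cone(2)[OF func_cocyclesD(2)[OF r]]])
      (simp add: elts_extents f_closed cocycle_cone(2)[OF r])
next
  fix p assume p: "p \<in> carrier (func_cocycles m Y)" and "func_pullback m X Y f p \<in> func_coboundaries m X"
  then obtain Q where Q: "functional (cmod X (m - 1)) Q" "\<And>x. x \<in> carrier (cmod X m) \<Longrightarrow> f m x \<in> elts p \<longleftrightarrow> Q (cdiff X m x)"
    unfolding func_pullback_def using func_coboundariesE[OF X] by blast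
  let ?r = "extent (cmod (mapping_cone X Y f) m) (\<lambda>z. vfst z \<in> elts p \<longleftrightarrow> \<not> Q (vsnd z))"
  have r: "?r \<in> carrier (func_cocycles m (mapping_cone X Y f))"
    by (rule cocycle_coneI[OF func_cocyclesD(2)[OF p] Q(1) func_cocyclesD(3)[OF p] Q(2)])
  show "\<exists>r\<in>carrier (func_cocycles m (mapping_cone X Y f)). p \<otimes>\<^bsub>func_cocycles m Y\<^esub>
      inv\<^bsub>func_cocycles m Y\<^esub> func_pullback m Y (mapping_cone X Y f) (\<lambda>k y. vpair y \<zero>\<^bsub>cmod X (k - 1)\<^esub>) r \<in> func_coboundaries m Y"
  proof (rule bexI[OF _ r], rule func_cocycles_differ[OF Y _ functional_False])
    show "func_pullback m Y (mapping_cone X Y f) (\<lambda>k y. vpair y \<zero>\<^bsub>cmod X (k - 1)\<^esub>) ?r \<in> carrier (func_cocycles m Y)"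
      by (rule func_pullback_chain_map(1)[OF Y objects'(1) cone_inclusion_chain_map[OF X Y f] r])
  qed (use functional_zero[OF Q(1) complexD(1)[OF X]] in \<open>simp add: func_pullback_def elts_extents\<close>)
qed (simp_all add: maps' objects' X Y)

text \<open>
  If the first component of \<open>r\<close> is \<open>S d\<close>, then subtracting the differential of the pair \<open>(S, 0)\<close> leaves
  a cocycle whose first component vanishes.
\<close>

lemma func_exact_cone_2:
  "exact_at (func_H m) (func_h m) Y (mapping_cone X Y f) (susp X) (cone_inclusion X Y f) (cone_projection X Y f)"
proof (rule contra.exact_atI[of Y "mapping_cone X Y f" "susp X" _ "\<lambda>k y. vpair y \<zero>\<^bsub>cmod X (k - 1)\<^esub>" _ "\<lambda>k. vsnd"])
  fix p assume p: "p \<in> carrier (func_cocycles m (susp X))"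
  have "\<zero>\<^bsub>cmod X (m - 1)\<^esub> \<notin> elts p"
    using functional_zero[OF func_cocyclesD(2)[OF p] complexD(1)[OF objects'(2)]] by simp
  then show "func_pullback m Y (mapping_cone X Y f) (\<lambda>k y. vpair y \<zero>\<^bsub>cmod X (k - 1)\<^esub>) (func_pullback m (mapping_cone X Y f) (susp X) (\<lambda>k. vsnd) p) \<in> func_coboundaries m Y"
    unfolding func_pullback_def
    by (intro func_coboundariesI[OF Y functional_False]) (simp add: elts_extents)
next
  fix r assume r: "r \<in> carrier (func_cocycles m (mapping_cone X Y f))"
    and "func_pullback m Y (mapping_cone X Y f) (\<lambda>k y. vpair y \<zero>\<^bsub>cmod X (k - 1)\<^esub>) r \<in> func_coboundaries m Y"
  then obtain S where S: "functional (cmod Y (m - 1)) S"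
    "\<And>y. y \<in> carrier (cmod Y m) \<Longrightarrow> vpair y \<zero>\<^bsub>cmod X (m - 1)\<^esub> \<in> elts r \<longleftrightarrow> S (cdiff Y m y)"
    unfolding func_pullback_def using func_coboundariesE[OF Y] by blast
  note R = func_cocyclesD(2)[OF r]
  let ?P = "\<lambda>x. vpair \<zero>\<^bsub>cmod Y m\<^esub> x \<in> elts r \<longleftrightarrow> \<not> S (f (m - 1) x)"
  have "?P (cdiff X m x) = False" if x: "x \<in> carrier (cmod X m)" for x
    using cocycle_cone(2)[OF r x] S(2)[OF f_closed[OF x]] chain_mapD(3)[OF f x] by simp
  then have "extent (cmod X (m - 1)) ?P \<in> carrier (func_cocycles (m - 1) X)"
    by (intro func_cocyclesI[OF X] functional_xor functional_cone(2)[OF R] functional_comp[OF S(1) chain_mapD(1)[OF f]]) simp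
  then have p: "extent (cmod X (m - 1)) ?P \<in> carrier (func_cocycles m (susp X))" unfolding func_shift[OF X] .
  show "\<exists>p\<in>carrier (func_cocycles m (susp X)). r \<otimes>\<^bsub>func_cocycles m (mapping_cone X Y f)\<^esub>
      inv\<^bsub>func_cocycles m (mapping_cone X Y f)\<^esub> func_pullback m (mapping_cone X Y f) (susp X) (\<lambda>k. vsnd) p \<in> func_coboundaries m (mapping_cone X Y f)"
  proof (rule bexI[OF _ p], rule func_cocycles_differ[OF objects'(1)])
    show "func_pullback m (mapping_cone X Y f) (susp X) (\<lambda>k. vsnd) (extent (cmod X (m - 1)) ?P) \<in> carrier (func_cocycles m (mapping_cone X Y f))"
      by (rule func_pullback_chain_map(1)[OF objects'(1,2) cone_projection_chain_map[OF X Y f] p])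
    show "functional (cmod (mapping_cone X Y f) (m - 1)) (\<lambda>z. S (vfst z))"
      using functional_direct_sum[OF S(1) functional_False] by simp
    fix z assume "z \<in> carrier (cmod (mapping_cone X Y f) m)"
    then obtain y x where z: "z = vpair y x" "y \<in> carrier (cmod Y m)" "x \<in> carrier (cmod X (m - 1))" by auto
    show "z \<in> elts r \<longleftrightarrow> (z \<in> elts (func_pullback m (mapping_cone X Y f) (susp X) (\<lambda>k. vsnd) (extent (cmod X (m - 1)) ?P))) \<noteq> S (vfst (cdiff (mapping_cone X Y f) m z))"
      using functional_cone(3)[OF R z(2,3)] S(2)[OF z(2)] functional_add[OF S(1) diff_closed(3)[OF z(2)] f_closed[OF z(3)]] z(2,3)
      by (auto simp: z(1) func_pullback_def elts_extents cdiff_cone)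
  qed
qed (simp_all add: maps' objects' Y)

text \<open>
  If \<open>p\<close> becomes the differential of \<open>T\<close> on the cone, then the first component \<open>W\<close> of \<open>T\<close> is a
  cocycle, and \<open>p\<close> differs from \<open>W f\<close> by the differential of the second component of \<open>T\<close>.
\<close>

lemma func_exact_cone_3:
  "exact_at (func_H m) (func_h m) (mapping_cone X Y f) (susp X) (susp Y) (cone_projection X Y f) (K_ShiftHom 1 X Y (homotopy_class X Y f))"
proof (rule contra.exact_atI[of "mapping_cone X Y f" "susp X" "susp Y" _ "\<lambda>k. vsnd" _ "\<lambda>k. f (k - 1)"])
  fix p assume "p \<in> carrier (func_cocycles m (susp Y))"
  then have p: "p \<in> carrier (func_cocycles (m - 1) Y)" unfolding func_shift[OF Y] .
  note P = func_cocyclesD(2)[OF p]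
  have 0: "cdiff Y m y \<notin> elts p" if "y \<in> carrier (cmod Y m)" for y
    using func_cocyclesD(3)[OF p, of y] that by simp
  show "func_pullback m (mapping_cone X Y f) (susp X) (\<lambda>k. vsnd) (func_pullback m (susp X) (susp Y) (\<lambda>k. f (k - 1)) p) \<in> func_coboundaries m (mapping_cone X Y f)"
    unfolding func_pullback_def
  proof (rule func_coboundariesI[OF objects'(1)])
    show "functional (cmod (mapping_cone X Y f) (m - 1)) (\<lambda>z. vfst z \<in> elts p)"
      using functional_direct_sum[OF P functional_False] by simp
    fix z assume "z \<in> carrier (cmod (mapping_cone X Y f) m)"
    then obtain y x where z: "z = vpair y x" "y \<in> carrier (cmod Y m)" "x \<in> carrier (cmod X (m - 1))" by auto
    show "vsnd z \<in> elts (extent (cmod (susp X) m) (\<lambda>x. f (m - 1) x \<in> elts p)) \<longleftrightarrow> vfst (cdiff (mapping_cone X Y f) m z) \<in> elts p"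
      using functional_add[OF P diff_closed(3)[OF z(2)] f_closed[OF z(3)]] 0[OF z(2)] z(2,3)
      by (simp add: z(1) elts_extents cdiff_cone)
  qed
next
  fix p assume p: "p \<in> carrier (func_cocycles m (susp X))" and "func_pullback m (mapping_cone X Y f) (susp X) (\<lambda>k. vsnd) p \<in> func_coboundaries m (mapping_cone X Y f)"
  then obtain T where T: "functional (cmod (mapping_cone X Y f) (m - 1)) T"
    "\<And>z. z \<in> carrier (cmod (mapping_cone X Y f) m) \<Longrightarrow> vsnd z \<in> elts p \<longleftrightarrow> T (cdiff (mapping_cone X Y f) m z)"
    unfolding func_pullback_def using func_coboundariesE[OF objects'(1)] by blast
  have zeros: "f (m - 1) \<zero>\<^bsub>cmod X (m - 1)\<^esub> = \<zero>\<^bsub>cmod Y (m - 1)\<^esub>" "cdiff X (m - 1) \<zero>\<^bsub>cmod X (m - 1)\<^esub> = \<zero>\<^bsub>cmod X (m - 2)\<^esub>"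
    "cdiff Y m \<zero>\<^bsub>cmod Y m\<^esub> = \<zero>\<^bsub>cmod Y (m - 1)\<^esub>"
    using module_hom_zero[OF complexD(1)[OF X] complexD(1)[OF Y] chain_mapD(1)[OF f]] diff_zero[OF X, of "m - 1"]
      diff_zero[OF Y] by simp_all
  have T00: "\<not> T (vpair \<zero>\<^bsub>cmod Y (m - 1)\<^esub> \<zero>\<^bsub>cmod X (m - 2)\<^esub>)"
    using functional_zero[OF T(1) complexD(1)[OF objects'(1)]] by simp
  have p0: "\<zero>\<^bsub>cmod X (m - 1)\<^esub> \<notin> elts p"
    using functional_zero[OF func_cocyclesD(2)[OF p] complexD(1)[OF objects'(2)]] by simp
  have Tp: "x \<in> elts p \<longleftrightarrow> (T (vpair (cdiff Y m y) \<zero>\<^bsub>cmod X (m - 2)\<^esub>) \<noteq> T (vpair (f (m - 1) x) \<zero>\<^bsub>cmod X (m - 2)\<^esub>)) \<noteq>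
    T (vpair \<zero>\<^bsub>cmod Y (m - 1)\<^esub> (cdiff X (m - 1) x))" if "y \<in> carrier (cmod Y m)" "x \<in> carrier (cmod X (m - 1))" for x y
    using functional_cone_diff[OF T(1), of y x] T(2)[of "vpair y x"] that by simp
  let ?W = "\<lambda>y. T (vpair y \<zero>\<^bsub>cmod X (m - 2)\<^esub>)"
  have "?W (cdiff Y m y) = False" if "y \<in> carrier (cmod Y m)" for y
    using Tp[OF that X.zero_closed] p0 T00 by (simp add: zeros)
  moreover have W: "functional (cmod Y (m - 1)) ?W" using functional_cone(1)[OF T(1)] by simp
  ultimately have "extent (cmod Y (m - 1)) ?W \<in> carrier (func_cocycles (m - 1) Y)"
    by (intro func_cocyclesI[OF Y]) simp_all
  then have w: "extent (cmod Y (m - 1)) ?W \<in> carrier (func_cocycles m (susp Y))" unfolding func_shift[OF Y] .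
  show "\<exists>w\<in>carrier (func_cocycles m (susp Y)). p \<otimes>\<^bsub>func_cocycles m (susp X)\<^esub>
      inv\<^bsub>func_cocycles m (susp X)\<^esub> func_pullback m (susp X) (susp Y) (\<lambda>k. f (k - 1)) w \<in> func_coboundaries m (susp X)"
  proof (rule bexI[OF _ w], rule func_cocycles_differ[OF objects'(2)])
    show "func_pullback m (susp X) (susp Y) (\<lambda>k. f (k - 1)) (extent (cmod Y (m - 1)) ?W) \<in> carrier (func_cocycles m (susp X))"
      by (rule func_pullback_chain_map(1)[OF objects'(2,3) shift_chain_map[OF X Y f] w])
    show V: "functional (cmod (susp X) (m - 1)) (\<lambda>x. T (vpair \<zero>\<^bsub>cmod Y (m - 1)\<^esub> x))"
      using functional_cone(2)[OF T(1)] by simp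
    fix x assume "x \<in> carrier (cmod (susp X) m)"
    then have x: "x \<in> carrier (cmod X (m - 1))" by simp
    have "T (vpair \<zero>\<^bsub>cmod Y (m - 1)\<^esub> (cdiff (susp X) m x)) \<longleftrightarrow> T (vpair \<zero>\<^bsub>cmod Y (m - 1)\<^esub> (cdiff X (m - 1) x))"
      using functional_minus[OF V complexD(1)[OF objects'(2)], of "cdiff X (m - 1) x"] diff_closed(1)[OF x] x
      by (simp add: cdiff_shift)
    then show "x \<in> elts p \<longleftrightarrow> (x \<in> elts (func_pullback m (susp X) (susp Y) (\<lambda>k. f (k - 1)) (extent (cmod Y (m - 1)) ?W))) \<noteq>
        T (vpair \<zero>\<^bsub>cmod Y (m - 1)\<^esub> (cdiff (susp X) m x))"
      using Tp[OF Y.zero_closed x] T00 x f_closed[OF x] by (simp add: zeros func_pullback_def elts_extents)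
  qed
qed (simp_all add: maps' objects')

end

lemma func_functor: "cofunctor_to_Ab K_cat (func_H m) (func_h m)"
  by (rule cocycle_functor.h_functor[OF func_cocycle_functor])

lemma func_exact_triangle:
  assumes "(X, Y, Z, u, v, w) \<in> K_Triangles"
  shows "exact_at (func_H m) (func_h m) X Y Z u v"
    and "exact_at (func_H m) (func_h m) Y Z (shift_complex 1 X) v w"
    and "exact_at (func_H m) (func_h m) Z (shift_complex 1 X) (shift_complex 1 Y) w (K_ShiftHom 1 X Y u)"
  by (rule K_TrianglesE[OF assms], rule exact_at_isomorphic_pairs[OF func_functor], assumption,
      rule func_exact_cone_1 func_exact_cone_2 func_exact_cone_3; assumption)+

lemma func_exact_shift:
  assumes ABC: "A \<in> chain_complexes" "B \<in> chain_complexes" "C \<in> chain_complexes"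
    and FG: "F \<in> carrier (K_Hom A B)" "G \<in> carrier (K_Hom B C)"
  shows "exact_at (func_H m) (func_h m) (shift_complex n A) (shift_complex n B) (shift_complex n C)
      (K_ShiftHom n A B F) (K_ShiftHom n B C G) \<longleftrightarrow> exact_at (func_H (m - n)) (func_h (m - n)) A B C F G"
  unfolding exact_at_def func_H_shift[OF ABC(1)] func_H_shift[OF ABC(2)] func_H_shift[OF ABC(3)]
  using func_h_shift[OF ABC(1,2) FG(1)] func_h_shift[OF ABC(2,3) FG(2)] by (simp cong: image_cong)

lemma func_homological: "homological K_cat (func_H m) (func_h m)"
  unfolding homological_def
proof (intro ballI, clarify, unfold Let_def K_cat_simps)
  fix X Y Z :: "'u::universe chain_complex" and u v w and n :: int
  let ?S = "shift_complex n" and ?D = "shift_complex 1" and ?N = "m - n"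
  let ?Du = "K_ShiftHom 1 X Y u"
  assume tri: "(X, Y, Z, u, v, w) \<in> K_Triangles"
  then have XYZ: "X \<in> chain_complexes" "Y \<in> chain_complexes" "Z \<in> chain_complexes"
    and hom: "u \<in> carrier (K_Hom X Y)" "v \<in> carrier (K_Hom Y Z)" "w \<in> carrier (K_Hom Z (?D X))"
    by (simp_all add: K_Triangles_def)
  have D: "?D X \<in> chain_complexes" "?D Y \<in> chain_complexes" "?Du \<in> carrier (K_Hom (?D X) (?D Y))"
    using XYZ hom by (simp_all add: shift_complex_closed K_ShiftHom_closed)
  have exact:
    "exact_at (func_H m) (func_h m) (?S X) (?S Y) (?S Z) (K_ShiftHom n X Y u) (K_ShiftHom n Y Z v)"
    "exact_at (func_H m) (func_h m) (?S Y) (?S Z) (?S (?D X)) (K_ShiftHom n Y Z v) (K_ShiftHom n Z (?D X) w)"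
    "exact_at (func_H m) (func_h m) (?S Z) (?S (?D X)) (?S (?D Y)) (K_ShiftHom n Z (?D X) w) (K_ShiftHom n (?D X) (?D Y) ?Du)"
    using func_exact_triangle[OF tri, of ?N] by (simp_all add: func_exact_shift XYZ D hom)
  have grp: "group (func_H m (?S W))" if "W \<in> chain_complexes" for W
    by (rule cofunctor_group[OF func_functor]) (simp add: shift_complex_closed that)
  have h_hom: "func_h m (?S V) (?S W) (K_ShiftHom n V W F) \<in> hom (func_H m (?S W)) (func_H m (?S V))"
    if "V \<in> chain_complexes" "W \<in> chain_complexes" "F \<in> carrier (K_Hom V W)" for V W F
    by (rule cofunctor_hom[OF func_functor]) (simp_all add: shift_complex_closed K_ShiftHom_closed that)
  show "exact_seq
      ([func_H m (?S X), func_H m (?S Y), func_H m (?S Z), func_H m (?S (?D X)), func_H m (?S (?D Y))],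
       [func_h m (?S X) (?S Y) (K_ShiftHom n X Y u), func_h m (?S Y) (?S Z) (K_ShiftHom n Y Z v),
        func_h m (?S Z) (?S (?D X)) (K_ShiftHom n Z (?D X) w),
        func_h m (?S (?D X)) (?S (?D Y)) (K_ShiftHom n (?D X) (?D Y) ?Du)])"
    by (rule exact_seq_five[OF grp[OF XYZ(1)] grp[OF XYZ(2)] grp[OF XYZ(3)] grp[OF D(1)] grp[OF D(2)]
          h_hom[OF XYZ(1,2) hom(1)] h_hom[OF XYZ(2,3) hom(2)] h_hom[OF XYZ(3) D(1) hom(3)] h_hom[OF D]])
      (use exact in \<open>simp_all add: exact_at_def\<close>)
qed

section \<open>Products and direct sums of complexes\<close>

text \<open>
  Products and direct sums are treated together, since their module structure, their differentials
  and their acyclicity have the same proofs: \<open>fin\<close> says whether the families must have finite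
  support.
\<close>

definition product_module :: "bool \<Rightarrow> 'u::universe set \<Rightarrow> ('u \<Rightarrow> 'u big_module) \<Rightarrow> 'u big_module" where
  "product_module fin J M =
     \<lparr>carrier = {vfamily J x | x. (\<forall>j\<in>J. x j \<in> carrier (M j)) \<and> (fin \<longrightarrow> finite {j \<in> J. x j \<noteq> \<zero>\<^bsub>M j\<^esub>})},
      mult = undefined, one = undefined,
      zero = vfamily J (\<lambda>j. \<zero>\<^bsub>M j\<^esub>),
      add = (\<lambda>a b. vfamily J (\<lambda>j. vcomponent a j \<oplus>\<^bsub>M j\<^esub> vcomponent b j)),
      smult = (\<lambda>r a. vfamily J (\<lambda>j. r \<odot>\<^bsub>M j\<^esub> vcomponent a j))\<rparr>"

definition single_family :: "'u::universe set \<Rightarrow> ('u \<Rightarrow> 'u big_module) \<Rightarrow> 'u \<Rightarrow> 'u \<Rightarrow> 'u" where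
  "single_family J M j x = vfamily J (\<lambda>i. if i = j then x else \<zero>\<^bsub>M i\<^esub>)"

text \<open>
  The target will be a module or the group with two elements.
\<close>

definition additive_map :: "('a, 'c) ring_scheme \<Rightarrow> ('b, 'd) ring_scheme \<Rightarrow> ('a \<Rightarrow> 'b) \<Rightarrow> bool" where
  "additive_map M A u \<longleftrightarrow> (\<forall>x\<in>carrier M. u x \<in> carrier A) \<and>
     (\<forall>x\<in>carrier M. \<forall>y\<in>carrier M. u (x \<oplus>\<^bsub>M\<^esub> y) = u x \<oplus>\<^bsub>A\<^esub> u y)"

lemma additive_map_zero:
  assumes "abelian_group M" "abelian_group A" "additive_map M A u"
  shows "u \<zero>\<^bsub>M\<^esub> = \<zero>\<^bsub>A\<^esub>"
proof -
  interpret M: abelian_group M by fact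
  interpret A: abelian_group A by fact
  have "u \<zero>\<^bsub>M\<^esub> \<in> carrier A" "u \<zero>\<^bsub>M\<^esub> \<oplus>\<^bsub>A\<^esub> u \<zero>\<^bsub>M\<^esub> = u \<zero>\<^bsub>M\<^esub>"
    using assms(3) M.zero_closed M.l_zero[OF M.zero_closed] unfolding additive_map_def by metis+
  then show ?thesis by (simp add: A.add.r_cancel_one')
qed

lemma module_hom_additive: "f \<in> module_hom M N \<Longrightarrow> additive_map M N f"
  by (auto simp: module_hom_def additive_map_def)

context
  fixes J :: "'u::universe set" and M :: "'u \<Rightarrow> 'u big_module" and fin :: bool
  assumes J: "small J" and MJ: "\<forall>j\<in>J. small_module (M j)"
begin

private lemmas M = MJ[rule_format]

private abbreviation "P \<equiv> product_module fin J M"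

lemma product_carrier:
  assumes "a \<in> carrier P"
  shows "j \<in> J \<Longrightarrow> vcomponent a j \<in> carrier (M j)"
    and "fin \<Longrightarrow> finite {j \<in> J. vcomponent a j \<noteq> \<zero>\<^bsub>M j\<^esub>}"
    and "vfamily J (vcomponent a) = a"
proof -
  obtain x where x: "a = vfamily J x" "\<forall>j\<in>J. x j \<in> carrier (M j)" "fin \<longrightarrow> finite {j \<in> J. x j \<noteq> \<zero>\<^bsub>M j\<^esub>}"
    using assms by (auto simp: product_module_def)
  have c: "vcomponent a j = x j" if "j \<in> J" for j using that J by (simp add: x(1))
  then show "j \<in> J \<Longrightarrow> vcomponent a j \<in> carrier (M j)" using x(2) by simp
  have "{j \<in> J. vcomponent a j \<noteq> \<zero>\<^bsub>M j\<^esub>} = {j \<in> J. x j \<noteq> \<zero>\<^bsub>M j\<^esub>}" using c by auto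
  then show "fin \<Longrightarrow> finite {j \<in> J. vcomponent a j \<noteq> \<zero>\<^bsub>M j\<^esub>}" using x(3) by simp
  show "vfamily J (vcomponent a) = a" unfolding x(1) using c x(1) by (intro vfamily_cong) simp
qed

lemma product_carrierI:
  assumes "\<And>j. j \<in> J \<Longrightarrow> x j \<in> carrier (M j)" "fin \<Longrightarrow> finite {j \<in> J. x j \<noteq> \<zero>\<^bsub>M j\<^esub>}"
  shows "vfamily J x \<in> carrier P"
  using assms by (auto simp: product_module_def)

lemma product_eqI:
  assumes "a \<in> carrier P" "b \<in> carrier P" "\<And>j. j \<in> J \<Longrightarrow> vcomponent a j = vcomponent b j"
  shows "a = b"
  using vfamily_cong[of J "vcomponent a" "vcomponent b"] product_carrier(3) assms by simp

lemma product_components: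
  "j \<in> J \<Longrightarrow> vcomponent \<zero>\<^bsub>P\<^esub> j = \<zero>\<^bsub>M j\<^esub>"
  "j \<in> J \<Longrightarrow> vcomponent (a \<oplus>\<^bsub>P\<^esub> b) j = vcomponent a j \<oplus>\<^bsub>M j\<^esub> vcomponent b j"
  "j \<in> J \<Longrightarrow> vcomponent (r \<odot>\<^bsub>P\<^esub> a) j = r \<odot>\<^bsub>M j\<^esub> vcomponent a j"
  "i \<in> J \<Longrightarrow> vcomponent (single_family J M j x) i = (if i = j then x else \<zero>\<^bsub>M i\<^esub>)"
  using J by (simp_all add: product_module_def single_family_def)

lemma product_map_closed:
  assumes "a \<in> carrier P" "\<And>j. j \<in> J \<Longrightarrow> f j \<in> carrier (M j) \<rightarrow> carrier (N j)" "\<And>j. j \<in> J \<Longrightarrow> f j \<zero>\<^bsub>M j\<^esub> = \<zero>\<^bsub>N j\<^esub>"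
  shows "vfamily J (\<lambda>j. f j (vcomponent a j)) \<in> carrier (product_module fin J N)"
proof -
  have "{j \<in> J. f j (vcomponent a j) \<noteq> \<zero>\<^bsub>N j\<^esub>} \<subseteq> {j \<in> J. vcomponent a j \<noteq> \<zero>\<^bsub>M j\<^esub>}" using assms(3) by auto
  then have "fin \<Longrightarrow> finite {j \<in> J. f j (vcomponent a j) \<noteq> \<zero>\<^bsub>N j\<^esub>}"
    using product_carrier(2)[OF assms(1)] finite_subset by blast
  moreover have "f j (vcomponent a j) \<in> carrier (N j)" if "j \<in> J" for j
    using assms(2)[OF that] product_carrier(1)[OF assms(1) that] by auto
  ultimately show ?thesis unfolding product_module_def by auto
qed

lemma product_small_module: "small_module P"
proof -
  have mod: "module big_ring (M j)" "abelian_group (M j)" if "j \<in> J" for j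
    using small_moduleD(1,2)[OF M[OF that]] by auto
  then have mon: "abelian_monoid (M j)" if "j \<in> J" for j
    using that by (simp add: abelian_group_def)
  note zero = abelian_monoid.zero_closed[OF mon]
  note ag = abelian_monoid.a_closed[OF mon] abelian_monoid.a_lcomm[OF mon] abelian_monoid.a_comm[OF mon] abelian_monoid.a_assoc[OF mon]
    abelian_monoid.l_zero[OF mon] abelian_group.r_neg[OF mod(2)] abelian_group.a_inv_closed[OF mod(2)]
  have add: "a \<oplus>\<^bsub>P\<^esub> b \<in> carrier P" if "a \<in> carrier P" "b \<in> carrier P" for a b
  proof -
    have "{j \<in> J. vcomponent a j \<oplus>\<^bsub>M j\<^esub> vcomponent b j \<noteq> \<zero>\<^bsub>M j\<^esub>} \<subseteq>
        {j \<in> J. vcomponent a j \<noteq> \<zero>\<^bsub>M j\<^esub>} \<union> {j \<in> J. vcomponent b j \<noteq> \<zero>\<^bsub>M j\<^esub>}"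
      using ag(5) zero by auto
    then have "fin \<Longrightarrow> finite {j \<in> J. vcomponent a j \<oplus>\<^bsub>M j\<^esub> vcomponent b j \<noteq> \<zero>\<^bsub>M j\<^esub>}"
      using product_carrier(2) that finite_subset finite_UnI by meson
    then have "vfamily J (\<lambda>j. vcomponent a j \<oplus>\<^bsub>M j\<^esub> vcomponent b j) \<in> carrier P"
      using ag(1) product_carrier(1) that by (intro product_carrierI) auto
    then show ?thesis by (simp add: product_module_def)
  qed
  have smult: "r \<odot>\<^bsub>P\<^esub> a \<in> carrier P" if "a \<in> carrier P" for r a
  proof -
    have "vfamily J (\<lambda>j. r \<odot>\<^bsub>M j\<^esub> vcomponent a j) \<in> carrier P"
      by (rule product_map_closed[OF that]) (auto simp: small_module_smult M module.smult_r_null[OF mod(1)])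
    then show ?thesis by (simp add: product_module_def)
  qed
  have uminus: "vfamily J (\<lambda>j. \<ominus>\<^bsub>M j\<^esub> vcomponent a j) \<in> carrier P" if "a \<in> carrier P" for a
    by (rule product_map_closed[OF that]) (auto simp: ag abelian_group.uminus_zero[OF mod(2)])
  have zeroP: "\<zero>\<^bsub>P\<^esub> \<in> carrier P"
    using product_carrierI[of "\<lambda>j. \<zero>\<^bsub>M j\<^esub>"] zero by (simp add: product_module_def)
  note c = product_carrier(1)
  have "abelian_group P"
  proof (rule abelian_groupI)
    fix a assume a: "a \<in> carrier P"
    show "\<exists>b\<in>carrier P. b \<oplus>\<^bsub>P\<^esub> a = \<zero>\<^bsub>P\<^esub>"
      by (rule bexI[OF _ uminus[OF a]], rule product_eqI)
        (auto simp: add uminus a zeroP product_components J ag c)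
    show "\<zero>\<^bsub>P\<^esub> \<oplus>\<^bsub>P\<^esub> a = a"
      by (rule product_eqI) (simp_all add: add a zeroP product_components ag c)
    fix b assume b: "b \<in> carrier P"
    show "a \<oplus>\<^bsub>P\<^esub> b \<in> carrier P" using a b by (rule add)
    show "a \<oplus>\<^bsub>P\<^esub> b = b \<oplus>\<^bsub>P\<^esub> a"
      by (rule product_eqI) (simp_all add: add a b product_components ag c)
    fix d assume d: "d \<in> carrier P"
    show "a \<oplus>\<^bsub>P\<^esub> b \<oplus>\<^bsub>P\<^esub> d = a \<oplus>\<^bsub>P\<^esub> (b \<oplus>\<^bsub>P\<^esub> d)"
      by (rule product_eqI) (simp_all add: add a b d product_components ag c)
  qed (rule zeroP)
  moreover have "small (carrier P)"
  proof (rule small_subset)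
    show "small {vfamily J x | x. \<forall>j\<in>J. x j \<in> carrier (M j)}"
      using J small_moduleD(3)[OF M] by (rule small_vfamilies)
  qed (auto simp: product_module_def)
  ultimately show ?thesis
  proof (rule small_moduleI)
    fix r s a b assume a: "a \<in> carrier P"
    show "r \<odot>\<^bsub>P\<^esub> a \<in> carrier P" using a by (rule smult)
    show "(r + s) \<odot>\<^bsub>P\<^esub> a = r \<odot>\<^bsub>P\<^esub> a \<oplus>\<^bsub>P\<^esub> s \<odot>\<^bsub>P\<^esub> a"
      by (rule product_eqI) (use module.smult_l_distr[OF mod(1), of _ r s] in \<open>simp_all add: smult add a product_components c\<close>)
    show "(r * s) \<odot>\<^bsub>P\<^esub> a = r \<odot>\<^bsub>P\<^esub> (s \<odot>\<^bsub>P\<^esub> a)"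
      by (rule product_eqI) (use module.smult_assoc1[OF mod(1), of _ r s] in \<open>simp_all add: smult a product_components c\<close>)
    show "1 \<odot>\<^bsub>P\<^esub> a = a"
      by (rule product_eqI) (use module.smult_one[OF mod(1)] in \<open>simp_all add: smult a product_components c\<close>)
    assume b: "b \<in> carrier P"
    show "r \<odot>\<^bsub>P\<^esub> (a \<oplus>\<^bsub>P\<^esub> b) = r \<odot>\<^bsub>P\<^esub> a \<oplus>\<^bsub>P\<^esub> r \<odot>\<^bsub>P\<^esub> b"
      by (rule product_eqI) (use module.smult_r_distr[OF mod(1), of _ r] in \<open>simp_all add: smult add a b product_components c\<close>)
  qed
qed

lemma product_zero_closed: "\<zero>\<^bsub>P\<^esub> \<in> carrier P"
  using small_moduleD(2)[OF product_small_module] by (simp add: abelian_group_def abelian_monoid.zero_closed)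

lemma component_hom: "j \<in> J \<Longrightarrow> (\<lambda>a. vcomponent a j) \<in> module_hom P (M j)"
  by (rule module_homI) (simp_all add: product_carrier product_components)

lemma single_family_closed:
  assumes "j \<in> J" "x \<in> carrier (M j)"
  shows "single_family J M j x \<in> carrier P"
  unfolding single_family_def
proof (rule product_carrierI)
  have "finite {i \<in> J. (if i = j then x else \<zero>\<^bsub>M i\<^esub>) \<noteq> \<zero>\<^bsub>M i\<^esub>}"
    by (rule finite_subset[of _ "{j}"]) auto
  then show "finite {i \<in> J. (if i = j then x else \<zero>\<^bsub>M i\<^esub>) \<noteq> \<zero>\<^bsub>M i\<^esub>}" .
  show "(if i = j then x else \<zero>\<^bsub>M i\<^esub>) \<in> carrier (M i)" if "i \<in> J" for i
    using small_moduleD(2)[OF M[OF that]] assms by (auto simp: abelian_group_def abelian_monoid.zero_closed)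
qed

lemma single_family_hom:
  assumes "j \<in> J"
  shows "single_family J M j \<in> module_hom (M j) P"
proof (rule module_homI)
  have mod: "module big_ring (M i)" if "i \<in> J" for i using small_moduleD(1)[OF M[OF that]] .
  have z: "\<zero>\<^bsub>M i\<^esub> \<oplus>\<^bsub>M i\<^esub> \<zero>\<^bsub>M i\<^esub> = \<zero>\<^bsub>M i\<^esub>" "r \<odot>\<^bsub>M i\<^esub> \<zero>\<^bsub>M i\<^esub> = \<zero>\<^bsub>M i\<^esub>" if "i \<in> J" for i r
  proof -
    interpret Mi: module big_ring "M i" using that by (rule mod)
    show "\<zero>\<^bsub>M i\<^esub> \<oplus>\<^bsub>M i\<^esub> \<zero>\<^bsub>M i\<^esub> = \<zero>\<^bsub>M i\<^esub>" "r \<odot>\<^bsub>M i\<^esub> \<zero>\<^bsub>M i\<^esub> = \<zero>\<^bsub>M i\<^esub>"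
      using Mi.smult_r_null by simp_all
  qed
  interpret P: abelian_group P using product_small_module by (rule small_moduleD)
  interpret Mj: abelian_group "M j" using M[OF assms] by (rule small_moduleD)
  show "single_family J M j x \<in> carrier P" if "x \<in> carrier (M j)" for x
    using assms that by (rule single_family_closed)
  show "single_family J M j (x \<oplus>\<^bsub>M j\<^esub> y) = single_family J M j x \<oplus>\<^bsub>P\<^esub> single_family J M j y"
    if "x \<in> carrier (M j)" "y \<in> carrier (M j)" for x y
    by (rule product_eqI) (use that assms in \<open>auto simp: single_family_closed product_components z\<close>)
  show "single_family J M j (r \<odot>\<^bsub>M j\<^esub> x) = r \<odot>\<^bsub>P\<^esub> single_family J M j x" if "x \<in> carrier (M j)" for r x
    by (rule product_eqI)
      (use that assms M in \<open>auto simp: single_family_closed product_components z small_module_smult product_small_module\<close>)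
qed

end

text \<open>
  Induction on the support, splitting off one component at a time.  Linearity of a map on a direct
  sum, its compatibility with differentials and its vanishing are equalities of additive maps, so
  this lemma reduces them to the summands.
\<close>

lemma direct_sum_map_unique:
  fixes A :: "('b, 'd) ring_scheme" and M :: "'u::universe \<Rightarrow> 'u big_module"
  assumes J: "small J" and MJ: "\<forall>j\<in>J. small_module (M j)" and A: "abelian_group A"
    and u: "additive_map (product_module True J M) A u" and v: "additive_map (product_module True J M) A v"
    and uv: "\<And>j x. \<lbrakk>j \<in> J; x \<in> carrier (M j)\<rbrakk> \<Longrightarrow> u (single_family J M j x) = v (single_family J M j x)"
    and a: "a \<in> carrier (product_module True J M)"
  shows "u a = v a"
proof -
  let ?P = "product_module True J M"
  note M = MJ[rule_format]
  note c = product_carrier[where M = M, OF J MJ]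
  have P: "abelian_group ?P" by (rule small_moduleD(2)[OF product_small_module[where M = M, OF J MJ]])
  have "u a = v a" if "finite F" "a \<in> carrier ?P" "{j \<in> J. vcomponent a j \<noteq> \<zero>\<^bsub>M j\<^esub>} \<subseteq> F" for F a
    using that
  proof (induction F arbitrary: a rule: finite_induct)
    case empty
    have "a = \<zero>\<^bsub>?P\<^esub>"
      by (rule product_eqI[where M = M, OF J MJ]) (use empty in \<open>auto simp: product_components[where M = M, OF J MJ] product_zero_closed[where M = M, OF J MJ]\<close>)
    then show ?case using additive_map_zero[OF P A u] additive_map_zero[OF P A v] by simp
  next
    case (insert j F)
    show ?case
    proof (cases "j \<in> J")
      case True
      interpret Mj: abelian_group "M j" using M[OF True] by (rule small_moduleD)
      let ?a = "vfamily J (\<lambda>i. if i = j then \<zero>\<^bsub>M i\<^esub> else vcomponent a i)"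
      let ?s = "single_family J M j (vcomponent a j)"
      have a': "?a \<in> carrier ?P"
        by (rule product_map_closed[where M = M, OF J MJ insert.prems(1), where f = "\<lambda>i x. if i = j then \<zero>\<^bsub>M i\<^esub> else x" and N = M])
          (use Mj.zero_closed in auto)
      have s: "?s \<in> carrier ?P" using single_family_closed[where M = M, OF J MJ True] c(1)[OF insert.prems(1) True] by simp
      have "a = ?a \<oplus>\<^bsub>?P\<^esub> ?s"
      proof (rule product_eqI[where M = M, OF J MJ insert.prems(1)])
        show "?a \<oplus>\<^bsub>?P\<^esub> ?s \<in> carrier ?P" using P a' s by (simp add: abelian_group_def abelian_monoid.a_closed)
        fix i assume i: "i \<in> J"
        interpret Mi: abelian_group "M i" using M[OF i] by (rule small_moduleD)
        show "vcomponent a i = vcomponent (?a \<oplus>\<^bsub>?P\<^esub> ?s) i"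
          using i J c(1)[OF insert.prems(1) i] c(1)[OF insert.prems(1) True] by (simp add: product_components[where M = M, OF J MJ])
      qed
      moreover have "u ?a = v ?a"
        using insert.prems(2) a' J by (intro insert.IH) (auto split: if_splits)
      moreover have "u ?s = v ?s" using uv True c(1)[OF insert.prems(1) True] by simp
      ultimately show ?thesis using u v a' s unfolding additive_map_def by metis
    next
      case False
      then show ?thesis using insert by (intro insert.IH) auto
    qed
  qed
  from this[OF c(2)[OF a] a] show ?thesis by simp
qed

definition sum_map ::
  "('b, 'd) ring_scheme \<Rightarrow> 'u::universe set \<Rightarrow> ('u \<Rightarrow> 'u big_module) \<Rightarrow> ('u \<Rightarrow> 'u \<Rightarrow> 'b) \<Rightarrow> 'u \<Rightarrow> 'b" where
  "sum_map A J M f a = finsum A (\<lambda>j. f j (vcomponent a j)) {j \<in> J. vcomponent a j \<noteq> \<zero>\<^bsub>M j\<^esub>}"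

text \<open>
  The supports of two families and of their sum are contained in a common finite set, over which all
  three sums can be taken since \<open>f j\<close> maps \<open>0\<close> to \<open>0\<close>.
\<close>

lemma sum_map:
  fixes A :: "('b, 'd) ring_scheme" and M :: "'u::universe \<Rightarrow> 'u big_module"
  assumes J: "small J" and MJ: "\<forall>j\<in>J. small_module (M j)" and A: "abelian_group A"
    and fJ: "\<forall>j\<in>J. additive_map (M j) A (f j)"
  shows "additive_map (product_module True J M) A (sum_map A J M f)"
    and "\<lbrakk>j \<in> J; x \<in> carrier (M j)\<rbrakk> \<Longrightarrow> sum_map A J M f (single_family J M j x) = f j x"
proof -
  let ?P = "product_module True J M"
  note M = MJ[rule_format] and f = fJ[rule_format]
  interpret A: abelian_group A by (rule A)
  note c = product_carrier[where M = M, OF J MJ]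
  have fc: "f j x \<in> carrier A" if "j \<in> J" "x \<in> carrier (M j)" for j x
    using f that by (auto simp: additive_map_def)
  have f0: "f j \<zero>\<^bsub>M j\<^esub> = \<zero>\<^bsub>A\<^esub>" if "j \<in> J" for j
    using additive_map_zero[OF small_moduleD(2)[OF M[OF that]] A f[OF that]] .
  have extend: "sum_map A J M f a = finsum A (\<lambda>j. f j (vcomponent a j)) F"
    if "a \<in> carrier ?P" "finite F" "{j \<in> J. vcomponent a j \<noteq> \<zero>\<^bsub>M j\<^esub>} \<subseteq> F" "F \<subseteq> J" for a F
    unfolding sum_map_def
    by (rule A.add.finprod_mono_neutral_cong_left) (use that c(1)[OF that(1)] fc f0 in auto)
  show "additive_map ?P A (sum_map A J M f)"
    unfolding additive_map_def
  proof (intro conjI ballI)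
    fix a assume a: "a \<in> carrier ?P"
    show "sum_map A J M f a \<in> carrier A"
      unfolding sum_map_def by (rule A.finsum_closed) (use c(1)[OF a] fc in auto)
    fix b assume b: "b \<in> carrier ?P"
    let ?S = "\<lambda>a. {j \<in> J. vcomponent a j \<noteq> \<zero>\<^bsub>M j\<^esub>}"
    have ab: "a \<oplus>\<^bsub>?P\<^esub> b \<in> carrier ?P"
      using small_moduleD(2)[OF product_small_module[where M = M, OF J MJ]] a b by (simp add: abelian_group_def abelian_monoid.a_closed)
    have S: "?S (a \<oplus>\<^bsub>?P\<^esub> b) \<subseteq> ?S a \<union> ?S b"
    proof
      fix j assume j: "j \<in> ?S (a \<oplus>\<^bsub>?P\<^esub> b)"
      then have "j \<in> J" by simp
      then interpret Mj: abelian_group "M j" using M by (intro small_moduleD)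
      from j show "j \<in> ?S a \<union> ?S b" by (auto simp: product_components[where M = M, OF J MJ])
    qed
    have fin: "finite (?S a \<union> ?S b)" using c(2)[OF a] c(2)[OF b] by simp
    have "sum_map A J M f (a \<oplus>\<^bsub>?P\<^esub> b) = finsum A (\<lambda>j. f j (vcomponent (a \<oplus>\<^bsub>?P\<^esub> b) j)) (?S a \<union> ?S b)"
      by (rule extend[OF ab fin S]) auto
    also have "\<dots> = finsum A (\<lambda>j. f j (vcomponent a j) \<oplus>\<^bsub>A\<^esub> f j (vcomponent b j)) (?S a \<union> ?S b)"
    proof (rule A.finsum_cong')
      fix j assume "j \<in> ?S a \<union> ?S b"
      then have j: "j \<in> J" by auto
      then show "f j (vcomponent (a \<oplus>\<^bsub>?P\<^esub> b) j) = f j (vcomponent a j) \<oplus>\<^bsub>A\<^esub> f j (vcomponent b j)"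
        using f[OF j] c(1)[OF a j] c(1)[OF b j] by (simp add: product_components[where M = M, OF J MJ] additive_map_def)
    qed (use fc c(1)[OF a] c(1)[OF b] in auto)
    also have "\<dots> = finsum A (\<lambda>j. f j (vcomponent a j)) (?S a \<union> ?S b) \<oplus>\<^bsub>A\<^esub> finsum A (\<lambda>j. f j (vcomponent b j)) (?S a \<union> ?S b)"
      by (rule A.finsum_addf) (use fc c(1)[OF a] c(1)[OF b] in auto)
    also have "\<dots> = sum_map A J M f a \<oplus>\<^bsub>A\<^esub> sum_map A J M f b"
      using extend[OF a fin] extend[OF b fin] by auto
    finally show "sum_map A J M f (a \<oplus>\<^bsub>?P\<^esub> b) = sum_map A J M f a \<oplus>\<^bsub>A\<^esub> sum_map A J M f b" .
  qed
  assume j: "j \<in> J" and x: "x \<in> carrier (M j)"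
  have "sum_map A J M f (single_family J M j x) = finsum A (\<lambda>i. f i (vcomponent (single_family J M j x) i)) {j}"
    by (rule extend[OF single_family_closed[where M = M, OF J MJ j x]]) (use j in \<open>auto simp: product_components[where M = M, OF J MJ] split: if_splits\<close>)
  also have "\<dots> = f j x" using fc[OF j x] j by (simp add: product_components[where M = M, OF J MJ])
  finally show "sum_map A J M f (single_family J M j x) = f j x" .
qed

definition product_complex :: "bool \<Rightarrow> 'u::universe set \<Rightarrow> ('u \<Rightarrow> 'u chain_complex) \<Rightarrow> 'u chain_complex" where
  "product_complex fin J X =
     \<lparr>cmod = (\<lambda>k. product_module fin J (\<lambda>j. cmod (X j) k)),
      cdiff = (\<lambda>k. \<lambda>a\<in>carrier (product_module fin J (\<lambda>j. cmod (X j) k)).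
        vfamily J (\<lambda>j. cdiff (X j) k (vcomponent a j)))\<rparr>"

lemma homotopy_class_cong:
  assumes X: "X \<in> chain_complexes" and Y: "Y \<in> chain_complexes"
    and f: "f \<in> chain_maps X Y" and g: "g \<in> chain_maps X Y"
    and fg: "\<And>k x. x \<in> carrier (cmod X k) \<Longrightarrow> f k x = g k x"
  shows "homotopy_class X Y f = homotopy_class X Y g"
proof (rule homotopy_class_eq[OF X Y f g])
  show "homotopy X Y (\<lambda>k x. \<zero>\<^bsub>cmod Y (k + 1)\<^esub>) f g"
    using homotopy_refl[OF X Y f] fg by (simp add: homotopy_def)
qed

context
  fixes J :: "'u::universe set" and X :: "'u \<Rightarrow> 'u chain_complex"
  assumes J: "small J" and XJ: "\<forall>j\<in>J. X j \<in> chain_complexes"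
begin

private lemmas X = XJ[rule_format]

private lemma modules: "\<forall>j\<in>J. small_module (cmod (X j) k)"
  using X complexD(1) by blast

lemma cmod_product [simp]: "cmod (product_complex fin J X) k = product_module fin J (\<lambda>j. cmod (X j) k)"
  by (simp add: product_complex_def)

private lemmas carrier = product_carrier[where M = "\<lambda>j. cmod (X j) k" for k, OF J modules]
private lemmas eqI = product_eqI[where M = "\<lambda>j. cmod (X j) k" for k, OF J modules]
private lemmas components = product_components[where M = "\<lambda>j. cmod (X j) k" for k, OF J modules]
private lemmas map_closed = product_map_closed[where M = "\<lambda>j. cmod (X j) k" for k, OF J modules]

lemma product_diff:
  assumes "a \<in> carrier (product_module fin J (\<lambda>j. cmod (X j) k))" "j \<in> J"
  shows "vcomponent (cdiff (product_complex fin J X) k a) j = cdiff (X j) k (vcomponent a j)"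
  using assms J by (simp add: product_complex_def)

private lemma zero_closed: "j \<in> J \<Longrightarrow> \<zero>\<^bsub>cmod (X j) k\<^esub> \<in> carrier (cmod (X j) k)"
  using complexD(2)[OF X] by (simp add: abelian_group_def abelian_monoid.zero_closed)

lemma product_diff_closed:
  assumes a: "a \<in> carrier (product_module fin J (\<lambda>j. cmod (X j) k))"
  shows "cdiff (product_complex fin J X) k a \<in> carrier (product_module fin J (\<lambda>j. cmod (X j) (k - 1)))"
proof -
  have "vfamily J (\<lambda>j. cdiff (X j) k (vcomponent a j)) \<in> carrier (product_module fin J (\<lambda>j. cmod (X j) (k - 1)))"
    by (rule map_closed[OF a]) (auto simp: complex_diff_closed X diff_zero)
  then show ?thesis using a by (simp add: product_complex_def)
qed

lemma product_complex_closed: "product_complex fin J X \<in> chain_complexes"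
proof (rule complexI)
  fix k
  let ?P = "\<lambda>k. product_module fin J (\<lambda>j. cmod (X j) k)" and ?d = "cdiff (product_complex fin J X)"
  have mod: "small_module (?P k)" for k by (rule product_small_module[OF J modules])
  have add: "a \<oplus>\<^bsub>?P k\<^esub> b \<in> carrier (?P k)" if "a \<in> carrier (?P k)" "b \<in> carrier (?P k)" for a b k
    using small_moduleD(2)[OF mod] that by (simp add: abelian_group_def abelian_monoid.a_closed)
  show "small_module (cmod (product_complex fin J X) k)" using mod by simp
  show "?d k \<in> extensional (carrier (cmod (product_complex fin J X) k))"
    by (simp add: product_complex_def)
  have "?d k \<in> module_hom (?P k) (?P (k - 1))"
  proof (rule module_homI)
    fix a assume a: "a \<in> carrier (?P k)"
    show da: "?d k a \<in> carrier (?P (k - 1))" using a by (rule product_diff_closed)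
    show "?d k (r \<odot>\<^bsub>?P k\<^esub> a) = r \<odot>\<^bsub>?P (k - 1)\<^esub> ?d k a" for r
      by (rule eqI[where k = "k - 1" and fin = fin]) (simp_all add: product_diff_closed da a small_module_smult mod
          product_diff components carrier(1)[OF a] module_homD(3)[OF complexD(3)[OF X]])
    fix b assume b: "b \<in> carrier (?P k)"
    show "?d k (a \<oplus>\<^bsub>?P k\<^esub> b) = ?d k a \<oplus>\<^bsub>?P (k - 1)\<^esub> ?d k b"
      by (rule eqI[where k = "k - 1" and fin = fin]) (simp_all add: product_diff_closed da a b add product_diff
          components carrier(1)[OF a] carrier(1)[OF b] module_homD(2)[OF complexD(3)[OF X]])
  qed
  then show "?d k \<in> module_hom (cmod (product_complex fin J X) k) (cmod (product_complex fin J X) (k - 1))" by simp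
  fix a assume "a \<in> carrier (cmod (product_complex fin J X) k)"
  then have a: "a \<in> carrier (?P k)" by simp
  have da: "?d k a \<in> carrier (?P (k - 1))" and dda: "?d (k - 1) (?d k a) \<in> carrier (?P (k - 2))"
    using product_diff_closed[OF a] product_diff_closed[OF product_diff_closed[OF a]] by simp_all
  have "?d (k - 1) (?d k a) = \<zero>\<^bsub>?P (k - 2)\<^esub>"
    by (rule eqI[OF dda product_zero_closed[OF J modules]])
      (simp add: product_diff a da components complexD(5)[OF X] carrier(1)[OF a])
  then show "?d (k - 1) (?d k a) = \<zero>\<^bsub>cmod (product_complex fin J X) (k - 2)\<^esub>" by simp
qed

text \<open>
  Preimages are chosen in each component, taking \<open>0\<close> as the preimage of \<open>0\<close> to keep the support finite.
\<close>

lemma product_complex_acyclic: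
  assumes acyclic: "\<And>j. j \<in> J \<Longrightarrow> acyclic_complex (X j)"
  shows "acyclic_complex (product_complex fin J X)"
  unfolding acyclic_complex_def
proof (intro allI equalityI subsetI)
  fix k a
  let ?S = "product_complex fin J X"
  assume "a \<in> {x \<in> carrier (cmod ?S k). cdiff ?S k x = \<zero>\<^bsub>cmod ?S (k - 1)\<^esub>}"
  then have a: "a \<in> carrier (product_module fin J (\<lambda>j. cmod (X j) k))"
    and da: "cdiff ?S k a = \<zero>\<^bsub>product_module fin J (\<lambda>j. cmod (X j) (k - 1))\<^esub>" by simp_all
  have "\<exists>y. y \<in> carrier (cmod (X j) (k + 1)) \<and> cdiff (X j) (k + 1) y = vcomponent a j \<and>
      (vcomponent a j = \<zero>\<^bsub>cmod (X j) k\<^esub> \<longrightarrow> y = \<zero>\<^bsub>cmod (X j) (k + 1)\<^esub>)" if j: "j \<in> J" for j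
  proof (cases "vcomponent a j = \<zero>\<^bsub>cmod (X j) k\<^esub>")
    case True
    then show ?thesis using zero_closed[OF j] diff_zero[OF X[OF j], of "k + 1"] by auto
  next
    case False
    have "cdiff (X j) k (vcomponent a j) = \<zero>\<^bsub>cmod (X j) (k - 1)\<^esub>"
      using product_diff[OF a j] j by (simp add: da components)
    then have "vcomponent a j \<in> cdiff (X j) (k + 1) ` carrier (cmod (X j) (k + 1))"
      using acyclic[OF j] carrier(1)[OF a j] unfolding acyclic_complex_def by blast
    with False show ?thesis by auto
  qed
  then obtain y where y: "\<And>j. j \<in> J \<Longrightarrow> y j \<in> carrier (cmod (X j) (k + 1)) \<and> cdiff (X j) (k + 1) (y j) = vcomponent a j \<and>
      (vcomponent a j = \<zero>\<^bsub>cmod (X j) k\<^esub> \<longrightarrow> y j = \<zero>\<^bsub>cmod (X j) (k + 1)\<^esub>)" by metis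
  have "{j \<in> J. y j \<noteq> \<zero>\<^bsub>cmod (X j) (k + 1)\<^esub>} \<subseteq> {j \<in> J. vcomponent a j \<noteq> \<zero>\<^bsub>cmod (X j) k\<^esub>}" using y by auto
  then have b: "vfamily J y \<in> carrier (product_module fin J (\<lambda>j. cmod (X j) (k + 1)))"
    using carrier(2)[OF a] y finite_subset by (intro product_carrierI[OF J modules]) blast+
  have "cdiff ?S (k + 1) (vfamily J y) = a"
    by (rule eqI[where k = k and fin = fin]) (use product_diff_closed[OF b] a y J in \<open>simp_all add: product_diff[OF b]\<close>)
  with b show "a \<in> cdiff ?S (k + 1) ` carrier (cmod ?S (k + 1))" by auto
next
  fix k a
  let ?S = "product_complex fin J X"
  assume "a \<in> cdiff ?S (k + 1) ` carrier (cmod ?S (k + 1))"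
  then obtain b where "b \<in> carrier (cmod ?S (k + 1))" "a = cdiff ?S (k + 1) b" by blast
  then show "a \<in> {x \<in> carrier (cmod ?S k). cdiff ?S k x = \<zero>\<^bsub>cmod ?S (k - 1)\<^esub>}"
    using complex_diff_closed(2)[OF product_complex_closed] complex_diff_from_above(2)[OF product_complex_closed] by blast
qed

lemma projection_chain_map: "j \<in> J \<Longrightarrow> (\<lambda>k a. vcomponent a j) \<in> chain_maps (product_complex fin J X) (X j)"
  using component_hom[where M = "\<lambda>j. cmod (X j) k" for k, OF J modules] product_diff by (intro chain_mapI) simp_all

lemma inclusion_chain_map:
  "j \<in> J \<Longrightarrow> (\<lambda>k. single_family J (\<lambda>j. cmod (X j) k) j) \<in> chain_maps (X j) (product_complex fin J X)"
proof (rule chain_mapI)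
  fix k assume j: "j \<in> J"
  show "single_family J (\<lambda>j. cmod (X j) k) j \<in> module_hom (cmod (X j) k) (cmod (product_complex fin J X) k)"
    using single_family_hom[where M = "\<lambda>j. cmod (X j) k", OF J modules j] by simp
  fix x assume x: "x \<in> carrier (cmod (X j) k)"
  note s = single_family_closed[where M = "\<lambda>j. cmod (X j) k" for k, OF J modules j]
  show "cdiff (product_complex fin J X) k (single_family J (\<lambda>j. cmod (X j) k) j x) =
      single_family J (\<lambda>j. cmod (X j) (k - 1)) j (cdiff (X j) k x)"
    by (rule eqI[where k = "k - 1" and fin = fin])
      (use x j in \<open>auto simp: s product_diff_closed complex_diff_closed X product_diff[OF s] components diff_zero\<close>)
qed

end

lemma A_cat_simps [simp]:
  "Ob A_cat = {X \<in> chain_complexes. acyclic_complex X}" "Hom A_cat = K_Hom" "Comp A_cat = K_Comp" "Id A_cat = K_Id"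
  "Shift A_cat = shift_complex" "ShiftHom A_cat = K_ShiftHom"
  by (simp_all add: A_cat_def full_subcategory_def)

lemma A_category_laws: "category_laws A_cat"
  unfolding A_cat_def by (rule category_laws_full_subcategory[OF K_category_laws])

lemma product_weak_coproduct:
  assumes J: "small J" and X: "X ` J \<subseteq> Ob (A_cat :: ('u::universe) homotopy_cat)"
  shows "is_weak_coproduct (dual A_cat) J X (product_complex False J X)
    (\<lambda>j. homotopy_class (product_complex False J X) (X j) (\<lambda>k a. vcomponent a j))"
  unfolding is_weak_coproduct_def dual_simps A_cat_simps
proof (intro conjI ballI allI impI)
  have XJ: "\<forall>j\<in>J. X j \<in> chain_complexes" and ac: "\<And>j. j \<in> J \<Longrightarrow> acyclic_complex (X j)" using X by auto
  let ?S = "product_complex False J X"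
  note S = product_complex_closed[OF J XJ, of False]
  show "?S \<in> {X \<in> chain_complexes. acyclic_complex X}"
    using S product_complex_acyclic[OF J XJ ac] by simp
  show "homotopy_class ?S (X j) (\<lambda>k a. vcomponent a j) \<in> carrier (K_Hom ?S (X j))" if "j \<in> J" for j
    using that by (intro homotopy_class_in_K_Hom S XJ[rule_format] projection_chain_map[OF J XJ])
  fix Y :: "'u chain_complex" and F
  assume "Y \<in> {X \<in> chain_complexes. acyclic_complex X}" and "\<forall>j\<in>J. F j \<in> carrier (K_Hom Y (X j))"
  then have Y: "Y \<in> chain_complexes" and F: "\<And>j. j \<in> J \<Longrightarrow> F j \<in> carrier (K_Hom Y (X j))" by auto
  have "\<exists>f. f \<in> chain_maps Y (X j) \<and> F j = homotopy_class Y (X j) f" if "j \<in> J" for j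
    using K_HomE[OF Y XJ[rule_format, OF that] F[OF that]] by blast
  then obtain f where f: "\<And>j. j \<in> J \<Longrightarrow> f j \<in> chain_maps Y (X j)" "\<And>j. j \<in> J \<Longrightarrow> F j = homotopy_class Y (X j) (f j)"
    by metis
  let ?g = "\<lambda>k y. vfamily J (\<lambda>j. f j k y)"
  have mods: "\<forall>j\<in>J. small_module (cmod (X j) k)" for k using XJ complexD(1) by blast
  have g: "?g k y \<in> carrier (product_module False J (\<lambda>j. cmod (X j) k))" if "y \<in> carrier (cmod Y k)" for k y
    using chain_mapD(2)[OF f(1) that] by (intro product_carrierI[OF J mods]) auto
  have Yc: "a \<oplus>\<^bsub>cmod Y k\<^esub> b \<in> carrier (cmod Y k)" if "a \<in> carrier (cmod Y k)" "b \<in> carrier (cmod Y k)" for a b k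
    using complexD(2)[OF Y] that by (simp add: abelian_group_def abelian_monoid.a_closed)
  have gY: "?g \<in> chain_maps Y ?S"
  proof (rule chain_mapI)
    fix k
    show "?g k \<in> module_hom (cmod Y k) (cmod ?S k)"
      unfolding cmod_product[OF J XJ]
    proof (rule module_homI)
      fix y assume y: "y \<in> carrier (cmod Y k)"
      show gy: "?g k y \<in> carrier (product_module False J (\<lambda>j. cmod (X j) k))" using y by (rule g)
      show "?g k (r \<odot>\<^bsub>cmod Y k\<^esub> y) = r \<odot>\<^bsub>product_module False J (\<lambda>j. cmod (X j) k)\<^esub> ?g k y" for r
        by (rule product_eqI[where fin = False and M = "\<lambda>j. cmod (X j) (k)", OF J mods])
          (use y J in \<open>simp_all add: g gy small_module_smult complexD(1)[OF Y] product_small_module[OF J mods]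
            product_components[OF J mods] module_homD(3)[OF chain_mapD(1)[OF f(1)]]\<close>)
      fix z assume z: "z \<in> carrier (cmod Y k)"
      show "?g k (y \<oplus>\<^bsub>cmod Y k\<^esub> z) = ?g k y \<oplus>\<^bsub>product_module False J (\<lambda>j. cmod (X j) k)\<^esub> ?g k z"
        by (rule product_eqI[where fin = False and M = "\<lambda>j. cmod (X j) (k)", OF J mods])
          (use y z J small_moduleD(2)[OF product_small_module[OF J mods]] in \<open>simp_all add: g gy Yc
            abelian_group_def abelian_monoid.a_closed product_components[OF J mods] module_homD(2)[OF chain_mapD(1)[OF f(1)]]\<close>)
    qed
    fix y assume y: "y \<in> carrier (cmod Y k)"
    show "cdiff ?S k (?g k y) = ?g (k - 1) (cdiff Y k y)"
      by (rule product_eqI[where fin = False and M = "\<lambda>j. cmod (X j) (k - 1)", OF J mods])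
        (use y J in \<open>simp_all add: g product_diff_closed[OF J XJ] complex_diff_closed[OF Y] product_diff[OF J XJ g] chain_mapD(3)[OF f(1)]\<close>)
  qed
  have "K_Comp Y ?S (X j) (homotopy_class ?S (X j) (\<lambda>k a. vcomponent a j)) (homotopy_class Y ?S ?g) = F j" if j: "j \<in> J" for j
  proof -
    note Xj = XJ[rule_format, OF j]
    have "homotopy_class Y (X j) (\<lambda>k. (\<lambda>a. vcomponent a j) \<circ> ?g k) = homotopy_class Y (X j) (f j)"
      by (rule homotopy_class_cong[OF Y Xj chain_map_comp[OF gY projection_chain_map[OF J XJ j]] f(1)[OF j]]) (simp add: J j)
    then show ?thesis using K_Comp_homotopy_class[OF Y S Xj gY projection_chain_map[OF J XJ j]] f(2)[OF j] by simp
  qed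
  then show "\<exists>G\<in>carrier (K_Hom Y ?S). \<forall>j\<in>J.
      K_Comp Y ?S (X j) (homotopy_class ?S (X j) (\<lambda>k a. vcomponent a j)) G = F j"
    using homotopy_class_in_K_Hom[OF Y S gY] by blast
qed

lemma additive_map_comp: "\<lbrakk>additive_map M N u; additive_map N A v\<rbrakk> \<Longrightarrow> additive_map M A (\<lambda>x. v (u x))"
  by (simp add: additive_map_def)

lemma additive_map_smult: "small_module M \<Longrightarrow> additive_map M M (\<lambda>x. r \<odot>\<^bsub>M\<^esub> x)"
  using module.smult_r_distr[OF small_moduleD(1), of M r] by (simp add: additive_map_def small_module_smult)

lemma direct_sum_weak_coproduct:
  assumes J: "small J" and X: "X ` J \<subseteq> Ob (A_cat :: ('u::universe) homotopy_cat)"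
  shows "is_weak_coproduct A_cat J X (product_complex True J X)
    (\<lambda>j. homotopy_class (X j) (product_complex True J X) (\<lambda>k. single_family J (\<lambda>j. cmod (X j) k) j))"
  unfolding is_weak_coproduct_def A_cat_simps
proof (intro conjI ballI allI impI)
  have XJ: "\<forall>j\<in>J. X j \<in> chain_complexes" and ac: "\<And>j. j \<in> J \<Longrightarrow> acyclic_complex (X j)" using X by auto
  let ?S = "product_complex True J X"
  let ?P = "\<lambda>k. product_module True J (\<lambda>j. cmod (X j) k)"
  let ?s = "\<lambda>k. single_family J (\<lambda>j. cmod (X j) k)"
  note S = product_complex_closed[OF J XJ, of True]
  note incl = inclusion_chain_map[OF J XJ, where fin = True]
  have mods: "\<forall>j\<in>J. small_module (cmod (X j) k)" for k using XJ complexD(1) by blast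
  note P = product_small_module[OF J mods, of True]
  note s = single_family_closed[where fin = True, OF J mods]
  show "?S \<in> {X \<in> chain_complexes. acyclic_complex X}"
    using S product_complex_acyclic[OF J XJ ac] by simp
  show "homotopy_class (X j) ?S (\<lambda>k. ?s k j) \<in> carrier (K_Hom (X j) ?S)" if "j \<in> J" for j
    using that by (intro homotopy_class_in_K_Hom S XJ[rule_format] incl)
  fix Y :: "'u chain_complex" and F
  assume "Y \<in> {X \<in> chain_complexes. acyclic_complex X}" and "\<forall>j\<in>J. F j \<in> carrier (K_Hom (X j) Y)"
  then have Y: "Y \<in> chain_complexes" and F: "\<And>j. j \<in> J \<Longrightarrow> F j \<in> carrier (K_Hom (X j) Y)" by auto
  have "\<exists>f. f \<in> chain_maps (X j) Y \<and> F j = homotopy_class (X j) Y f" if "j \<in> J" for j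
    using K_HomE[OF XJ[rule_format, OF that] Y F[OF that]] by blast
  then obtain f where f: "\<And>j. j \<in> J \<Longrightarrow> f j \<in> chain_maps (X j) Y" "\<And>j. j \<in> J \<Longrightarrow> F j = homotopy_class (X j) Y (f j)"
    by metis
  let ?g = "\<lambda>k. sum_map (cmod Y k) J (\<lambda>j. cmod (X j) k) (\<lambda>j. f j k)"
  have f_add: "\<forall>j\<in>J. additive_map (cmod (X j) k) (cmod Y k) (f j k)" for k
    using module_hom_additive[OF chain_mapD(1)[OF f(1)]] by blast
  note g_add = sum_map(1)[OF J mods complexD(2)[OF Y] f_add]
    and g_single = sum_map(2)[OF J mods complexD(2)[OF Y] f_add]
  note g = g_add[unfolded additive_map_def]
  have gS: "?g \<in> chain_maps ?S Y"
  proof (rule chain_mapI)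
    fix k
    have "?g k \<in> module_hom (?P k) (cmod Y k)"
    proof (rule module_homI)
      fix a assume a: "a \<in> carrier (?P k)"
      show "?g k a \<in> carrier (cmod Y k)" using g a by blast
      show "?g k (a \<oplus>\<^bsub>?P k\<^esub> b) = ?g k a \<oplus>\<^bsub>cmod Y k\<^esub> ?g k b" if "b \<in> carrier (?P k)" for b
        using g a that by blast
      fix r
      show "?g k (r \<odot>\<^bsub>?P k\<^esub> a) = r \<odot>\<^bsub>cmod Y k\<^esub> ?g k a"
      proof (rule direct_sum_map_unique[OF J mods complexD(2)[OF Y] _ _ _ a])
        show "additive_map (?P k) (cmod Y k) (\<lambda>a. ?g k (r \<odot>\<^bsub>?P k\<^esub> a))"
          by (rule additive_map_comp[OF additive_map_smult[OF P] g_add])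
        show "additive_map (?P k) (cmod Y k) (\<lambda>a. r \<odot>\<^bsub>cmod Y k\<^esub> ?g k a)"
          by (rule additive_map_comp[OF g_add additive_map_smult[OF complexD(1)[OF Y]]])
        fix j x assume j: "j \<in> J" and x: "x \<in> carrier (cmod (X j) k)"
        have rx: "r \<odot>\<^bsub>cmod (X j) k\<^esub> x \<in> carrier (cmod (X j) k)"
          using small_module_smult mods j x by blast
        have "r \<odot>\<^bsub>?P k\<^esub> ?s k j x = ?s k j (r \<odot>\<^bsub>cmod (X j) k\<^esub> x)"
          using module_homD(3)[OF single_family_hom[where fin = True, OF J mods j] x] by simp
        then show "?g k (r \<odot>\<^bsub>?P k\<^esub> ?s k j x) = r \<odot>\<^bsub>cmod Y k\<^esub> ?g k (?s k j x)"
          using g_single[OF j x] g_single[OF j rx] module_homD(3)[OF chain_mapD(1)[OF f(1)[OF j]] x] by simp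
      qed
    qed
    then show "?g k \<in> module_hom (cmod ?S k) (cmod Y k)" by (simp add: cmod_product[OF J XJ])
    fix a assume "a \<in> carrier (cmod ?S k)"
    then have a: "a \<in> carrier (?P k)" by (simp add: cmod_product[OF J XJ])
    have d_add: "additive_map (?P k) (?P (k - 1)) (cdiff ?S k)"
      using module_hom_additive[OF complexD(3)[OF S, of k]] by (simp add: cmod_product[OF J XJ])
    show "cdiff Y k (?g k a) = ?g (k - 1) (cdiff ?S k a)"
    proof (rule direct_sum_map_unique[OF J mods complexD(2)[OF Y] _ _ _ a])
      show "additive_map (?P k) (cmod Y (k - 1)) (\<lambda>a. cdiff Y k (?g k a))"
        by (rule additive_map_comp[OF g_add module_hom_additive[OF complexD(3)[OF Y]]])
      show "additive_map (?P k) (cmod Y (k - 1)) (\<lambda>a. ?g (k - 1) (cdiff ?S k a))"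
        by (rule additive_map_comp[OF d_add g_add])
      fix j x assume j: "j \<in> J" and x: "x \<in> carrier (cmod (X j) k)"
      have dx: "cdiff (X j) k x \<in> carrier (cmod (X j) (k - 1))"
        using complex_diff_closed(1)[OF XJ[rule_format, OF j] x] .
      show "cdiff Y k (?g k (?s k j x)) = ?g (k - 1) (cdiff ?S k (?s k j x))"
        using chain_mapD(3)[OF incl[OF j] x] chain_mapD(3)[OF f(1)[OF j] x] g_single[OF j x] g_single[OF j dx] by simp
    qed
  qed
  have "K_Comp (X j) ?S Y (homotopy_class ?S Y ?g) (homotopy_class (X j) ?S (\<lambda>k. ?s k j)) = F j" if j: "j \<in> J" for j
  proof -
    note Xj = XJ[rule_format, OF j]
    have "homotopy_class (X j) Y (\<lambda>k. ?g k \<circ> ?s k j) = homotopy_class (X j) Y (f j)"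
      by (rule homotopy_class_cong[OF Xj Y chain_map_comp[OF incl[OF j] gS] f(1)[OF j]]) (simp add: g_single[OF j])
    then show ?thesis using K_Comp_homotopy_class[OF Xj S Y incl[OF j] gS] f(2)[OF j] by simp
  qed
  then show "\<exists>G\<in>carrier (K_Hom ?S Y). \<forall>j\<in>J.
      K_Comp (X j) ?S Y G (homotopy_class (X j) ?S (\<lambda>k. ?s k j)) = F j"
    using homotopy_class_in_K_Hom[OF S Y gS] by blast
qed


subsection \<open>The two functors on acyclic complexes\<close>

lemma cofunctor_dual_full_subcategory:
  "cofunctor_to_Ab (dual T) H h \<Longrightarrow> cofunctor_to_Ab (dual (full_subcategory T P)) H h"
  unfolding cofunctor_to_Ab_def by (auto simp: dual_def full_subcategory_def)

lemma inv_functor_A: "cofunctor_to_Ab (dual A_cat) (inv_H m) (inv_h m)"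
  unfolding A_cat_def by (rule cofunctor_dual_full_subcategory[OF inv_functor])

lemma func_functor_A: "cofunctor_to_Ab A_cat (func_H m) (func_h m)"
  unfolding A_cat_def by (rule cofunctor_full_subcategory[OF func_functor])

lemma homological_fewer_triangles:
  assumes "homological T H h" "Triangles T' \<subseteq> Triangles T" "Shift T' = Shift T" "ShiftHom T' = ShiftHom T"
  shows "homological T' H h"
  using assms(1,2) unfolding homological_def assms(3,4) by blast

lemma inv_homological_A: "homological (dual A_cat) (inv_H m) (inv_h m)"
proof (rule homological_fewer_triangles[OF inv_homological])
  show "Triangles (dual A_cat) \<subseteq> Triangles (dual K_cat)"
    by (auto simp: dual_def A_cat_def full_subcategory_def)
qed (auto simp: dual_def)

lemma func_homological_A: "homological A_cat (func_H m) (func_h m)"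
  by (rule homological_fewer_triangles[OF func_homological]) (auto simp: A_cat_def full_subcategory_def)

text \<open>
  A family of invariant cycles is an invariant cycle of the product, and it bounds as soon as all of
  its members do, by a choice of invariant preimages.
\<close>

lemma inv_products: "coproducts_to_products (dual A_cat) (inv_H m) (inv_h m)"
proof (rule coproducts_to_productsI[OF category_laws_dual[OF A_category_laws] inv_functor_A])
  fix J :: "'u::universe set" and X
  assume J: "small J" and X: "X ` J \<subseteq> Ob (dual A_cat :: 'u homotopy_cat)"
  interpret co: cocycle_functor "dual K_cat :: 'u homotopy_cat"
    "inv_cycles k" "inv_boundaries k" "\<lambda>X Y f. f k" for k
    by (rule inv_cocycle_functor)
  have XA: "X ` J \<subseteq> Ob (A_cat :: 'u homotopy_cat)" using X by simp
  then have XJ: "\<forall>j\<in>J. X j \<in> chain_complexes" by auto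
  let ?S = "product_complex False J X"
  let ?\<pi> = "\<lambda>j. homotopy_class ?S (X j) (\<lambda>k a. vcomponent a j)"
  note S = product_complex_closed[OF J XJ, of False]
  note proj = projection_chain_map[OF J XJ, where fin = False]
  have mods: "\<forall>j\<in>J. small_module (cmod (X j) k)" for k using XJ complexD(1) by blast
  have h: "inv_h m (X j) ?S (?\<pi> j) (co.cls m ?S z) = co.cls m (X j) (vcomponent z j)"
    if "j \<in> J" "z \<in> carrier (inv_cycles m ?S)" for j z
    using co.h_cls[of "X j" ?S "?\<pi> j" "\<lambda>k a. vcomponent a j" z m] that XJ S
      homotopy_class_in_K_Hom[OF S _ proj] mem_homotopy_class_self[OF S _ proj] by simp
  have inv_S: "a \<in> invariants (cmod ?S k) \<longleftrightarrow> a \<in> carrier (cmod ?S k) \<and> (\<forall>j\<in>J. vcomponent a j \<in> invariants (cmod (X j) k))" for a k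
  proof -
    have "var i \<odot>\<^bsub>cmod ?S k\<^esub> a = \<zero>\<^bsub>cmod ?S k\<^esub> \<longleftrightarrow> (\<forall>j\<in>J. var i \<odot>\<^bsub>cmod (X j) k\<^esub> vcomponent a j = \<zero>\<^bsub>cmod (X j) k\<^esub>)"
      if a: "a \<in> carrier (cmod ?S k)" for i
    proof
      assume eq: "var i \<odot>\<^bsub>cmod ?S k\<^esub> a = \<zero>\<^bsub>cmod ?S k\<^esub>"
      show "\<forall>j\<in>J. var i \<odot>\<^bsub>cmod (X j) k\<^esub> vcomponent a j = \<zero>\<^bsub>cmod (X j) k\<^esub>"
      proof
        fix j assume "j \<in> J"
        then show "var i \<odot>\<^bsub>cmod (X j) k\<^esub> vcomponent a j = \<zero>\<^bsub>cmod (X j) k\<^esub>"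
          using arg_cong[OF eq, of "\<lambda>x. vcomponent x j"] by (simp add: cmod_product[OF J XJ] product_components[OF J mods])
      qed
    next
      assume eq: "\<forall>j\<in>J. var i \<odot>\<^bsub>cmod (X j) k\<^esub> vcomponent a j = \<zero>\<^bsub>cmod (X j) k\<^esub>"
      have a': "a \<in> carrier (product_module False J (\<lambda>j. cmod (X j) k))" using a by (simp add: cmod_product[OF J XJ])
      show "var i \<odot>\<^bsub>cmod ?S k\<^esub> a = \<zero>\<^bsub>cmod ?S k\<^esub>"
        unfolding cmod_product[OF J XJ]
      proof (rule product_eqI[where fin = False and M = "\<lambda>j. cmod (X j) k", OF J mods])
        show "vcomponent (var i \<odot>\<^bsub>product_module False J (\<lambda>j. cmod (X j) k)\<^esub> a) j =
            vcomponent \<zero>\<^bsub>product_module False J (\<lambda>j. cmod (X j) k)\<^esub> j" if "j \<in> J" for j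
          using eq that by (simp add: product_components[OF J mods])
      qed (rule small_module_smult[OF product_small_module[OF J mods] a'] product_zero_closed[OF J mods])+
    qed
    then show ?thesis
      using product_carrier(1)[where M = "\<lambda>j. cmod (X j) k" and fin = False, OF J mods]
      by (auto simp: invariants_def cmod_product[OF J XJ])
  qed
  have family: "vfamily J b \<in> invariants (cmod ?S k)" if "\<And>j. j \<in> J \<Longrightarrow> b j \<in> invariants (cmod (X j) k)" for b k
    unfolding inv_S using that J
    by (auto simp: cmod_product[OF J XJ] invariants_carrier intro!: product_carrierI[OF J mods])
  have eqI: "a = b" if "a \<in> carrier (cmod ?S k)" "b \<in> carrier (cmod ?S k)" "\<And>j. j \<in> J \<Longrightarrow> vcomponent a j = vcomponent b j" for a b k
    using product_eqI[where fin = False and M = "\<lambda>j. cmod (X j) k", OF J mods] that by (simp add: cmod_product[OF J XJ])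
  have d: "vcomponent (cdiff ?S k a) j = cdiff (X j) k (vcomponent a j)" if "a \<in> carrier (cmod ?S k)" "j \<in> J" for a j k
    using product_diff[OF J XJ] that by (simp add: cmod_product[OF J XJ])
  have zero: "vcomponent \<zero>\<^bsub>cmod ?S k\<^esub> j = \<zero>\<^bsub>cmod (X j) k\<^esub>" "\<zero>\<^bsub>cmod ?S k\<^esub> \<in> carrier (cmod ?S k)" if "j \<in> J" for j k
    using that product_zero_closed[OF J mods] by (simp_all add: cmod_product[OF J XJ] product_components[OF J mods])
  show "\<exists>S \<sigma>. is_weak_coproduct (dual A_cat) J X S \<sigma> \<and>
      (\<forall>x. (\<forall>j\<in>J. x j \<in> carrier (inv_H m (X j))) \<longrightarrow>
         (\<exists>s\<in>carrier (inv_H m S). \<forall>j\<in>J. inv_h m (X j) S (\<sigma> j) s = x j)) \<and>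
      (\<forall>s\<in>carrier (inv_H m S). (\<forall>j\<in>J. inv_h m (X j) S (\<sigma> j) s = \<one>\<^bsub>inv_H m (X j)\<^esub>) \<longrightarrow> s = \<one>\<^bsub>inv_H m S\<^esub>)"
  proof (intro exI conjI allI ballI impI)
    show "is_weak_coproduct (dual A_cat) J X ?S ?\<pi>" using J XA by (rule product_weak_coproduct)
  next
    fix x assume x: "\<forall>j\<in>J. x j \<in> carrier (inv_H m (X j))"
    have "\<exists>z. z \<in> carrier (inv_cycles m (X j)) \<and> x j = co.cls m (X j) z" if "j \<in> J" for j
      using x that co.carrier_H[of "X j" m] XJ by auto
    then obtain z where z: "\<And>j. j \<in> J \<Longrightarrow> z j \<in> carrier (inv_cycles m (X j))" "\<And>j. j \<in> J \<Longrightarrow> x j = co.cls m (X j) (z j)"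
      by metis
    have zi: "vfamily J z \<in> invariants (cmod ?S m)" using z(1) by (intro family) (simp add: inv_cycles_def)
    have zc: "vfamily J z \<in> carrier (cmod ?S m)" using zi by (rule invariants_carrier)
    have "cdiff ?S m (vfamily J z) = \<zero>\<^bsub>cmod ?S (m - 1)\<^esub>"
    proof (rule eqI[where k = "m - 1"])
      show "\<zero>\<^bsub>cmod ?S (m - 1)\<^esub> \<in> carrier (cmod ?S (m - 1))"
        using complexD(2)[OF S] by (simp add: abelian_group_def abelian_monoid.zero_closed)
      show "vcomponent (cdiff ?S m (vfamily J z)) j = vcomponent \<zero>\<^bsub>cmod ?S (m - 1)\<^esub> j" if "j \<in> J" for j
        unfolding d[OF zc that] zero(1)[OF that] using z(1)[OF that] J that by (simp add: inv_cycles_def)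
    qed (rule complex_diff_closed(1)[OF S zc])
    with zi have zZ: "vfamily J z \<in> carrier (inv_cycles m ?S)" by (simp add: inv_cycles_def)
    show "\<exists>s\<in>carrier (inv_H m ?S). \<forall>j\<in>J. inv_h m (X j) ?S (?\<pi> j) s = x j"
    proof (rule bexI)
      show "co.cls m ?S (vfamily J z) \<in> carrier (inv_H m ?S)" using co.carrier_H[of ?S m] S zZ by simp
      show "\<forall>j\<in>J. inv_h m (X j) ?S (?\<pi> j) (co.cls m ?S (vfamily J z)) = x j"
        using h[OF _ zZ] z(2) J by simp
    qed
  next
    fix s assume "s \<in> carrier (inv_H m ?S)" and s1: "\<forall>j\<in>J. inv_h m (X j) ?S (?\<pi> j) s = \<one>\<^bsub>inv_H m (X j)\<^esub>"
    then obtain z where z: "z \<in> carrier (inv_cycles m ?S)" "s = co.cls m ?S z"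
      using co.carrier_H[of ?S m] S by auto
    have "vcomponent z j \<in> inv_boundaries m (X j)" if j: "j \<in> J" for j
      using s1 h[OF j z(1)] co.cls_eq_one_iff[of "X j" "vcomponent z j" m] XJ j
        inv_cycles_chain_map(1)[OF S _ proj[OF j] z(1)] by (simp add: z(2))
    then have "\<exists>b. b \<in> invariants (cmod (X j) (m + 1)) \<and> vcomponent z j = cdiff (X j) (m + 1) b" if "j \<in> J" for j
      using that unfolding inv_boundaries_def by blast
    then obtain b where b: "\<And>j. j \<in> J \<Longrightarrow> b j \<in> invariants (cmod (X j) (m + 1))"
      "\<And>j. j \<in> J \<Longrightarrow> vcomponent z j = cdiff (X j) (m + 1) (b j)" by metis
    have bi: "vfamily J b \<in> invariants (cmod ?S (m + 1))" using b(1) by (rule family)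
    note bc = invariants_carrier[OF bi]
    have "z = cdiff ?S (m + 1) (vfamily J b)"
    proof (rule eqI[where k = m])
      show "z \<in> carrier (cmod ?S m)" using z(1) by (simp add: inv_cycles_def invariants_carrier)
      show "vcomponent z j = vcomponent (cdiff ?S (m + 1) (vfamily J b)) j" if "j \<in> J" for j
        unfolding d[OF bc that] b(2)[OF that] using J that by simp
    qed (rule complex_diff_closed(2)[OF S bc])
    then have "z \<in> inv_boundaries m ?S" using bi by (simp add: inv_boundaries_def)
    then show "s = \<one>\<^bsub>inv_H m ?S\<^esub>" using co.cls_eq_one_iff[of ?S z m] S z by simp
  qed
qed

text \<open>
  The values of functionals are added up in this group, so that the functional glued from a
  family of functionals is an instance of \<open>sum_map\<close>.
\<close>

definition xor_group :: "bool ring" where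
  "xor_group = \<lparr>carrier = UNIV, mult = (\<and>), one = True, zero = False, add = (\<noteq>)\<rparr>"

lemma xor_abelian_group: "abelian_group xor_group"
  by (rule abelian_groupI) (auto simp: xor_group_def)

lemma additive_map_xor:
  "additive_map M xor_group P \<longleftrightarrow> (\<forall>x\<in>carrier M. \<forall>y\<in>carrier M. P (x \<oplus>\<^bsub>M\<^esub> y) \<longleftrightarrow> P x \<noteq> P y)"
  by (simp add: additive_map_def xor_group_def)

lemma functional_additive: "functional M P \<Longrightarrow> additive_map M xor_group P"
  by (simp add: additive_map_xor functional_def)

lemma sum_functional:
  assumes J: "small J" and M: "\<forall>j\<in>J. small_module (M j)" and P: "\<forall>j\<in>J. functional (M j) (P j)"
  shows "functional (product_module True J M) (sum_map xor_group J M P)"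
    and "\<lbrakk>j \<in> J; x \<in> carrier (M j)\<rbrakk> \<Longrightarrow> sum_map xor_group J M P (single_family J M j x) \<longleftrightarrow> P j x"
proof -
  have "\<forall>j\<in>J. additive_map (M j) xor_group (P j)" using P functional_additive by blast
  note add = sum_map(1)[OF J M xor_abelian_group this] and single = sum_map(2)[OF J M xor_abelian_group this]
  show "\<lbrakk>j \<in> J; x \<in> carrier (M j)\<rbrakk> \<Longrightarrow> sum_map xor_group J M P (single_family J M j x) \<longleftrightarrow> P j x"
    by (rule single)
  have "sum_map xor_group J M P (var i \<odot>\<^bsub>product_module True J M\<^esub> a) = False"
    if a: "a \<in> carrier (product_module True J M)" for i a
  proof (rule direct_sum_map_unique[OF J M xor_abelian_group _ _ _ a])
    show "additive_map (product_module True J M) xor_group (\<lambda>a. sum_map xor_group J M P (var i \<odot>\<^bsub>product_module True J M\<^esub> a))"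
      by (rule additive_map_comp[OF additive_map_smult[OF product_small_module[OF J M]] add])
    show "additive_map (product_module True J M) xor_group (\<lambda>a. False)"
      by (simp add: additive_map_xor)
    fix j x assume j: "j \<in> J" and x: "x \<in> carrier (M j)"
    have "var i \<odot>\<^bsub>product_module True J M\<^esub> single_family J M j x = single_family J M j (var i \<odot>\<^bsub>M j\<^esub> x)"
      using module_homD(3)[OF single_family_hom[where fin = True, OF J M j] x] by simp
    moreover have "var i \<odot>\<^bsub>M j\<^esub> x \<in> carrier (M j)" using small_module_smult M j x by blast
    ultimately show "sum_map xor_group J M P (var i \<odot>\<^bsub>product_module True J M\<^esub> single_family J M j x) = False"
      using single j P x by (auto simp: functional_def)
  qed
  with add show "functional (product_module True J M) (sum_map xor_group J M P)"
    by (simp add: functional_def additive_map_xor)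
qed

text \<open>
  Functionals on the summands add up to a functional on the direct sum.  The sum of cocycles is a
  cocycle, and a cocycle whose restrictions are differentials of functionals \<open>Q j\<close> is the differential
  of their sum; both are equalities of additive maps, valid on the summands.
\<close>

lemma func_coproducts: "coproducts_to_products A_cat (func_H m) (func_h m)"
proof (rule coproducts_to_productsI[OF A_category_laws func_functor_A])
  fix J :: "'u::universe set" and X
  assume J: "small J" and XA: "X ` J \<subseteq> Ob (A_cat :: 'u homotopy_cat)"
  interpret contra: cocycle_functor "K_cat :: 'u homotopy_cat"
    "func_cocycles k" "func_coboundaries k" "func_pullback k" for k
    by (rule func_cocycle_functor)
  have XJ: "\<forall>j\<in>J. X j \<in> chain_complexes" using XA by auto
  let ?S = "product_complex True J X"
  let ?s = "\<lambda>k. single_family J (\<lambda>j. cmod (X j) k)"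
  let ?\<sigma> = "\<lambda>j. homotopy_class (X j) ?S (\<lambda>k. ?s k j)"
  note S = product_complex_closed[OF J XJ, of True]
  note incl = inclusion_chain_map[OF J XJ, where fin = True]
  note XJ' = XJ[rule_format]
  have mods: "\<forall>j\<in>J. small_module (cmod (X j) k)" for k using XJ complexD(1) by blast
  have s: "?s k j x \<in> carrier (cmod ?S k)" if "j \<in> J" "x \<in> carrier (cmod (X j) k)" for j x k
    using chain_mapD(2)[OF incl[OF that(1)] that(2)] .
  have h: "func_h m (X j) ?S (?\<sigma> j) (contra.cls m ?S z) = contra.cls m (X j) (func_pullback m (X j) ?S (\<lambda>k. ?s k j) z)"
    if "j \<in> J" "z \<in> carrier (func_cocycles m ?S)" for j z
    using contra.h_cls[of "X j" ?S "?\<sigma> j" "\<lambda>k. ?s k j" z m] that XJ S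
      homotopy_class_in_K_Hom[OF _ S incl] mem_homotopy_class_self[OF _ S incl] by simp
  have unique: "u a = v a" if "additive_map (cmod ?S k) xor_group u" "additive_map (cmod ?S k) xor_group v"
    "\<And>j x. \<lbrakk>j \<in> J; x \<in> carrier (cmod (X j) k)\<rbrakk> \<Longrightarrow> u (?s k j x) = v (?s k j x)" "a \<in> carrier (cmod ?S k)" for u v a k
    using direct_sum_map_unique[OF J mods xor_abelian_group, of k u v a] that by (simp add: cmod_product[OF J XJ])
  have sum: "functional (cmod ?S k) (sum_map xor_group J (\<lambda>j. cmod (X j) k) P)"
    "\<And>j x. \<lbrakk>j \<in> J; x \<in> carrier (cmod (X j) k)\<rbrakk> \<Longrightarrow> sum_map xor_group J (\<lambda>j. cmod (X j) k) P (?s k j x) \<longleftrightarrow> P j x"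
    if "\<forall>j\<in>J. functional (cmod (X j) k) (P j)" for P k
    using sum_functional[OF J mods that] by (simp_all add: cmod_product[OF J XJ])
  have ds: "cdiff ?S k (?s k j x) = ?s (k - 1) j (cdiff (X j) k x)" if "j \<in> J" "x \<in> carrier (cmod (X j) k)" for j x k
    using chain_mapD(3)[OF incl[OF that(1)] that(2)] .
  show "\<exists>S \<sigma>. is_weak_coproduct A_cat J X S \<sigma> \<and>
      (\<forall>x. (\<forall>j\<in>J. x j \<in> carrier (func_H m (X j))) \<longrightarrow>
         (\<exists>s\<in>carrier (func_H m S). \<forall>j\<in>J. func_h m (X j) S (\<sigma> j) s = x j)) \<and>
      (\<forall>s\<in>carrier (func_H m S). (\<forall>j\<in>J. func_h m (X j) S (\<sigma> j) s = \<one>\<^bsub>func_H m (X j)\<^esub>) \<longrightarrow> s = \<one>\<^bsub>func_H m S\<^esub>)"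
  proof (intro exI conjI allI ballI impI)
    show "is_weak_coproduct A_cat J X ?S ?\<sigma>" using J XA by (rule direct_sum_weak_coproduct)
  next
    fix x assume x: "\<forall>j\<in>J. x j \<in> carrier (func_H m (X j))"
    have "\<exists>p. p \<in> carrier (func_cocycles m (X j)) \<and> x j = contra.cls m (X j) p" if "j \<in> J" for j
      using x that contra.carrier_H[of "X j" m] XJ by auto
    then obtain p where p: "\<And>j. j \<in> J \<Longrightarrow> p j \<in> carrier (func_cocycles m (X j))" "\<And>j. j \<in> J \<Longrightarrow> x j = contra.cls m (X j) (p j)"
      by metis
    have "\<forall>j\<in>J. functional (cmod (X j) m) (\<lambda>x. x \<in> elts (p j))" using func_cocyclesD(2)[OF p(1)] by blast
    note Q = sum[OF this]
    let ?Q = "sum_map xor_group J (\<lambda>j. cmod (X j) m) (\<lambda>j x. x \<in> elts (p j))"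
    have "?Q (cdiff ?S (m + 1) a) = False" if a: "a \<in> carrier (cmod ?S (m + 1))" for a
    proof (rule unique[OF _ _ _ a])
      show "additive_map (cmod ?S (m + 1)) xor_group (\<lambda>a. ?Q (cdiff ?S (m + 1) a))"
        by (rule additive_map_comp[OF module_hom_additive[OF complex_diff_from_above(1)[OF S]] functional_additive[OF Q(1)]])
      show "additive_map (cmod ?S (m + 1)) xor_group (\<lambda>a. False)" by (simp add: additive_map_xor)
      show "?Q (cdiff ?S (m + 1) (?s (m + 1) j x)) = False" if "j \<in> J" "x \<in> carrier (cmod (X j) (m + 1))" for j x
        using ds[OF that] Q(2)[OF that(1) complex_diff_closed(2)[OF XJ'[OF that(1)] that(2)]] func_cocyclesD(3)[OF p(1)[OF that(1)] that(2)] by simp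
    qed
    then have qZ: "extent (cmod ?S m) ?Q \<in> carrier (func_cocycles m ?S)" by (intro func_cocyclesI[OF S] Q(1)) simp
    have pb: "func_pullback m (X j) ?S (\<lambda>k. ?s k j) (extent (cmod ?S m) ?Q) = p j" if j: "j \<in> J" for j
    proof -
      have "func_pullback m (X j) ?S (\<lambda>k. ?s k j) (extent (cmod ?S m) ?Q) = extent (cmod (X j) m) (\<lambda>x. x \<in> elts (p j))"
        unfolding func_pullback_def using Q(2)[OF j] s[OF j] by (intro extent_cong) (simp add: elts_extent_complex[OF S])
      then show ?thesis using extent_elts[OF func_cocyclesD(1)[OF p(1)[OF j]]] by simp
    qed
    show "\<exists>s\<in>carrier (func_H m ?S). \<forall>j\<in>J. func_h m (X j) ?S (?\<sigma> j) s = x j"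
    proof (rule bexI)
      show "contra.cls m ?S (extent (cmod ?S m) ?Q) \<in> carrier (func_H m ?S)" using contra.carrier_H[of ?S m] S qZ by simp
      show "\<forall>j\<in>J. func_h m (X j) ?S (?\<sigma> j) (contra.cls m ?S (extent (cmod ?S m) ?Q)) = x j"
        using h[OF _ qZ] p(2) pb by simp
    qed
  next
    fix c assume "c \<in> carrier (func_H m ?S)" and c1: "\<forall>j\<in>J. func_h m (X j) ?S (?\<sigma> j) c = \<one>\<^bsub>func_H m (X j)\<^esub>"
    then obtain p where p: "p \<in> carrier (func_cocycles m ?S)" "c = contra.cls m ?S p"
      using contra.carrier_H[of ?S m] S by auto
    have "func_pullback m (X j) ?S (\<lambda>k. ?s k j) p \<in> func_coboundaries m (X j)" if j: "j \<in> J" for j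
      using c1 h[OF j p(1)] contra.cls_eq_one_iff[of "X j" "func_pullback m (X j) ?S (\<lambda>k. ?s k j) p" m] XJ j
        func_pullback_chain_map(1)[OF XJ'[OF j] S incl[OF j] p(1)] by (simp add: p(2))
    then have "\<exists>Q. functional (cmod (X j) (m - 1)) Q \<and> (\<forall>x\<in>carrier (cmod (X j) m). ?s m j x \<in> elts p \<longleftrightarrow> Q (cdiff (X j) m x))"
      if "j \<in> J" for j
      using that func_coboundariesE[OF XJ'[OF that]] unfolding func_pullback_def by metis
    then obtain Q where Q: "\<forall>j\<in>J. functional (cmod (X j) (m - 1)) (Q j)"
      "\<And>j x. \<lbrakk>j \<in> J; x \<in> carrier (cmod (X j) m)\<rbrakk> \<Longrightarrow> ?s m j x \<in> elts p \<longleftrightarrow> Q j (cdiff (X j) m x)"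
      by metis
    let ?Q = "sum_map xor_group J (\<lambda>j. cmod (X j) (m - 1)) Q"
    have "a \<in> elts p \<longleftrightarrow> ?Q (cdiff ?S m a)" if a: "a \<in> carrier (cmod ?S m)" for a
    proof (rule unique[OF _ _ _ a])
      show "additive_map (cmod ?S m) xor_group (\<lambda>a. a \<in> elts p)"
        by (rule functional_additive[OF func_cocyclesD(2)[OF p(1)]])
      show "additive_map (cmod ?S m) xor_group (\<lambda>a. ?Q (cdiff ?S m a))"
        by (rule additive_map_comp[OF module_hom_additive[OF complexD(3)[OF S]] functional_additive[OF sum(1)[OF Q(1)]]])
      show "(?s m j x \<in> elts p) = ?Q (cdiff ?S m (?s m j x))" if "j \<in> J" "x \<in> carrier (cmod (X j) m)" for j x
        using ds[OF that] Q(2)[OF that] sum(2)[OF Q(1) that(1) complex_diff_closed(1)[OF XJ'[OF that(1)] that(2)]] by simp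
    qed
    then have "extent (cmod ?S m) (\<lambda>a. a \<in> elts p) \<in> func_coboundaries m ?S"
      by (intro func_coboundariesI[OF S sum(1)[OF Q(1)]])
    then have "p \<in> func_coboundaries m ?S" using extent_elts[OF func_cocyclesD(1)[OF p(1)]] by simp
    then show "c = \<one>\<^bsub>func_H m ?S\<^esub>" using contra.cls_eq_one_iff[of ?S p m] S p by simp
  qed
qed

section \<open>Periodic complexes\<close>

definition zero_set :: "'u::universe" where
  "zero_set = set_of_class {}"

text \<open>
  The element \<open>a \<epsilon> + b\<close> of \<open>F\<^sub>2[\<epsilon>]\<close>.
\<close>

definition dual_number :: "bit \<Rightarrow> bit \<Rightarrow> 'u::universe" where
  "dual_number a b = vpair (if a = 0 then zero_set else set_of_class {zero_set})
     (if b = 0 then zero_set else set_of_class {zero_set})"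

definition eps_coeff :: "'u::universe \<Rightarrow> bit" where
  "eps_coeff x = (if vfst x = zero_set then 0 else 1)"

definition unit_coeff :: "'u::universe \<Rightarrow> bit" where
  "unit_coeff x = (if vsnd x = zero_set then 0 else 1)"

definition const_coeff :: "'u::universe big_poly \<Rightarrow> bit" where
  "const_coeff r = of_int (Poly_Mapping.lookup r 0)"

definition lin_coeff :: "'u::universe ordinal \<Rightarrow> 'u big_poly \<Rightarrow> bit" where
  "lin_coeff i r = of_int (Poly_Mapping.lookup r (Poly_Mapping.single i 1))"

text \<open>
  The polynomial \<open>r\<close> acts as its image under \<open>X\<^sub>i \<mapsto> \<epsilon>\<close> and \<open>X\<^sub>j \<mapsto> 0\<close> for \<open>j \<noteq> i\<close>, which depends only on its
  constant term and on its coefficient at \<open>X\<^sub>i\<close>.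
\<close>

definition dual_numbers :: "'u::universe ordinal \<Rightarrow> 'u big_module" where
  "dual_numbers i =
     \<lparr>carrier = {dual_number a b | a b. True}, mult = undefined, one = undefined,
      zero = dual_number 0 0,
      add = (\<lambda>x y. dual_number (eps_coeff x + eps_coeff y) (unit_coeff x + unit_coeff y)),
      smult = (\<lambda>r x. dual_number (const_coeff r * eps_coeff x + lin_coeff i r * unit_coeff x)
        (const_coeff r * unit_coeff x))\<rparr>"

definition periodic_complex :: "'u::universe ordinal \<Rightarrow> 'u chain_complex" where
  "periodic_complex i = \<lparr>cmod = (\<lambda>k. dual_numbers i),
     cdiff = (\<lambda>k. \<lambda>x\<in>carrier (dual_numbers i). var i \<odot>\<^bsub>dual_numbers i\<^esub> x)\<rparr>"

lemma zero_set_neq: "set_of_class {zero_set} \<noteq> (zero_set :: 'u::universe)"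
  by (simp add: zero_set_def set_of_class_inject small_empty small_singleton)

lemma coeff_dual_number [simp]: "eps_coeff (dual_number a b) = a" "unit_coeff (dual_number a b) = b"
  using zero_set_neq by (auto simp: eps_coeff_def unit_coeff_def dual_number_def)

lemma dual_number_inject [simp]: "dual_number a b = dual_number c d \<longleftrightarrow> a = c \<and> b = d"
  by (metis coeff_dual_number)

lemma single_neq_zero: "Poly_Mapping.single i (Suc 0) \<noteq> 0"
  by (simp add: poly_mapping_eq_iff fun_eq_iff lookup_single when_def)

lemma single_eq_iff: "Poly_Mapping.single i (Suc 0) = Poly_Mapping.single j (Suc 0) \<longleftrightarrow> i = j"
  by (auto simp: poly_mapping_eq_iff fun_eq_iff lookup_single when_def split: if_splits)

lemma const_coeff_simps:
  "const_coeff (r + s) = const_coeff r + const_coeff s" "const_coeff 1 = 1" "const_coeff (var j) = 0"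
  by (auto simp: single_neq_zero single_neq_zero[symmetric] const_coeff_def lookup_add var_def lookup_single when_def lookup_one)

lemma lin_coeff_simps:
  "lin_coeff i (r + s) = lin_coeff i r + lin_coeff i s" "lin_coeff i 1 = 0"
  "lin_coeff i (var j) = (if i = j then 1 else 0)"
  by (auto simp: single_neq_zero single_neq_zero[symmetric] lin_coeff_def lookup_add var_def lookup_single when_def lookup_one single_eq_iff)

text \<open>
  The exponents \<open>0\<close> and \<open>X\<^sub>i\<close> decompose into sums in finitely many ways, which gives the coefficients of
  a product that determine the action on the dual numbers.
\<close>

lemma lookup_times_finite:
  fixes r s :: "('a \<Rightarrow>\<^sub>0 nat) \<Rightarrow>\<^sub>0 int"
  assumes "finite D" "\<And>a b. k = a + b \<longleftrightarrow> (a, b) \<in> D"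
  shows "Poly_Mapping.lookup (r * s) k = (\<Sum>(a, b)\<in>D. Poly_Mapping.lookup r a * Poly_Mapping.lookup s b)"
proof -
  have "Poly_Mapping.lookup (r * s) k = (\<Sum>(a, b). Poly_Mapping.lookup r a * Poly_Mapping.lookup s b when k = a + b)"
    by (simp add: times_poly_mapping.rep_eq prod_fun_unfold_prod)
  also have "\<dots> = (\<Sum>p\<in>D. (\<lambda>(a, b). Poly_Mapping.lookup r a * Poly_Mapping.lookup s b when k = a + b) p)"
    by (rule Sum_any.expand_superset[OF assms(1)]) (auto simp: assms(2) when_def split: if_splits)
  also have "\<dots> = (\<Sum>(a, b)\<in>D. Poly_Mapping.lookup r a * Poly_Mapping.lookup s b)"
    by (rule sum.cong) (auto simp: assms(2) when_def)
  finally show ?thesis .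
qed

lemma exponent_zero_iff: "0 = a + b \<longleftrightarrow> (a, b) \<in> {(0, 0)}" for a b :: "'a \<Rightarrow>\<^sub>0 nat"
  by (auto simp: poly_mapping_eq_iff lookup_add fun_eq_iff)

lemma exponent_single_iff:
  "Poly_Mapping.single i 1 = a + b \<longleftrightarrow> (a, b) \<in> {(0, Poly_Mapping.single i 1), (Poly_Mapping.single i 1, 0)}"
  for a b :: "'a \<Rightarrow>\<^sub>0 nat"
proof
  assume eq: "Poly_Mapping.single i 1 = a + b"
  have l: "Poly_Mapping.lookup a x + Poly_Mapping.lookup b x = (if x = i then 1 else 0)" for x
    using arg_cong[OF eq, of "\<lambda>p. Poly_Mapping.lookup p x"] by (simp add: lookup_add lookup_single when_def eq_commute)
  have off: "Poly_Mapping.lookup a x = 0" "Poly_Mapping.lookup b x = 0" if "x \<noteq> i" for x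
    using l[of x] that by simp_all
  have sum_one: "Poly_Mapping.lookup a i + Poly_Mapping.lookup b i = 1" using l[of i] by simp
  show "(a, b) \<in> {(0, Poly_Mapping.single i 1), (Poly_Mapping.single i 1, 0)}"
  proof (cases "Poly_Mapping.lookup a i = 0")
    case True
    have "Poly_Mapping.lookup a x = 0" "Poly_Mapping.lookup b x = Poly_Mapping.lookup (Poly_Mapping.single i 1) x" for x
      using True sum_one off[of x] by (cases "x = i"; simp add: lookup_single)+
    then have "a = 0" "b = Poly_Mapping.single i 1" by (simp_all add: poly_mapping_eq_iff fun_eq_iff)
    then show ?thesis by simp
  next
    case False
    then have "Poly_Mapping.lookup a i = 1" "Poly_Mapping.lookup b i = 0" using sum_one by simp_all
    then have "Poly_Mapping.lookup b x = 0" "Poly_Mapping.lookup a x = Poly_Mapping.lookup (Poly_Mapping.single i 1) x" for x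
      using off[of x] by (cases "x = i"; simp add: lookup_single)+
    then have "b = 0" "a = Poly_Mapping.single i 1" by (simp_all add: poly_mapping_eq_iff fun_eq_iff)
    then show ?thesis by simp
  qed
qed auto

lemma coeff_times:
  "const_coeff (r * s) = const_coeff r * const_coeff s"
  "lin_coeff i (r * s) = const_coeff r * lin_coeff i s + lin_coeff i r * const_coeff s"
proof -
  show "const_coeff (r * s) = const_coeff r * const_coeff s"
    by (simp add: const_coeff_def lookup_times_finite[OF _ exponent_zero_iff])
  have "Poly_Mapping.lookup (r * s) (Poly_Mapping.single i 1) =
      (\<Sum>(a, b)\<in>{(0, Poly_Mapping.single i 1), (Poly_Mapping.single i 1, 0)}. Poly_Mapping.lookup r a * Poly_Mapping.lookup s b)"
    by (rule lookup_times_finite[OF _ exponent_single_iff]) simp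
  also have "\<dots> = Poly_Mapping.lookup r 0 * Poly_Mapping.lookup s (Poly_Mapping.single i 1)
      + Poly_Mapping.lookup r (Poly_Mapping.single i 1) * Poly_Mapping.lookup s 0"
    by (simp add: single_neq_zero single_neq_zero[symmetric])
  finally show "lin_coeff i (r * s) = const_coeff r * lin_coeff i s + lin_coeff i r * const_coeff s"
    by (simp only: const_coeff_def lin_coeff_def of_int_add of_int_mult)
qed

lemma dual_numbers_simps [simp]:
  "carrier (dual_numbers i) = {dual_number a b | a b. True}"
  "\<zero>\<^bsub>dual_numbers i\<^esub> = dual_number 0 0"
  "dual_number a b \<oplus>\<^bsub>dual_numbers i\<^esub> dual_number c d = dual_number (a + c) (b + d)"
  "r \<odot>\<^bsub>dual_numbers i\<^esub> dual_number a b = dual_number (const_coeff r * a + lin_coeff i r * b) (const_coeff r * b)"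
  by (simp_all add: dual_numbers_def)

lemma dual_numbers_module: "small_module (dual_numbers i :: 'u::universe big_module)"
proof (rule small_moduleI)
  show "abelian_group (dual_numbers i :: 'u big_module)"
  proof (rule abelian_groupI)
    fix x :: 'u assume "x \<in> carrier (dual_numbers i)"
    then obtain a b where "x = dual_number a b" by auto
    then show "\<exists>y\<in>carrier (dual_numbers i). y \<oplus>\<^bsub>dual_numbers i\<^esub> x = \<zero>\<^bsub>dual_numbers i\<^esub>"
      by (intro bexI[of _ x]) auto
  qed (auto simp: add_ac)
  let ?S = "{zero_set, set_of_class {zero_set}} :: 'u set"
  have "small {vpair x y | x y. x \<in> ?S \<and> y \<in> ?S}" by (intro small_vpairs small_pair)
  then show "small (carrier (dual_numbers i :: 'u big_module))"
    by (rule small_subset) (auto simp: dual_number_def)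
qed (auto simp: const_coeff_simps lin_coeff_simps coeff_times algebra_simps)

lemma periodic_complex_simps [simp]:
  "cmod (periodic_complex i) k = dual_numbers i"
  "cdiff (periodic_complex i) k (dual_number a b) = dual_number b 0"
  by (auto simp: periodic_complex_def const_coeff_simps lin_coeff_simps)

lemma periodic_complex_closed: "periodic_complex i \<in> chain_complexes"
proof (rule complexI)
  show "cdiff (periodic_complex i) k \<in> module_hom (cmod (periodic_complex i) k) (cmod (periodic_complex i) (k - 1))" for k
    by (rule module_homI) auto
  show "cdiff (periodic_complex i) k \<in> extensional (carrier (cmod (periodic_complex i) k))" for k
    by (simp add: periodic_complex_def del: dual_numbers_simps)
qed (auto simp: dual_numbers_module)

lemma periodic_complex_acyclic: "acyclic_complex (periodic_complex i)"
proof -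
  have "{x \<in> carrier (dual_numbers i). cdiff (periodic_complex i) k x = \<zero>\<^bsub>dual_numbers i\<^esub>} =
      cdiff (periodic_complex i) (k + 1) ` carrier (dual_numbers i)" for k
  proof -
    have "dual_number a 0 \<in> cdiff (periodic_complex i) (k + 1) ` {dual_number a b | a b. True}" for a
      by (rule image_eqI[of _ _ "dual_number 0 a"]) auto
    then show ?thesis by auto
  qed
  then show ?thesis unfolding acyclic_complex_def by simp
qed

lemma periodic_complex_A: "periodic_complex i \<in> Ob A_cat"
  by (simp add: periodic_complex_closed periodic_complex_acyclic)


section \<open>Neither functor is representable\<close>

lemma acyclic_complexE:
  assumes "acyclic_complex X" "x \<in> carrier (cmod X k)" "cdiff X k x = \<zero>\<^bsub>cmod X (k - 1)\<^esub>"
  obtains y where "y \<in> carrier (cmod X (k + 1))" "x = cdiff X (k + 1) y"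
proof -
  have "x \<in> {x \<in> carrier (cmod X k). cdiff X k x = \<zero>\<^bsub>cmod X (k - 1)\<^esub>}" using assms(2,3) by simp
  also have "\<dots> = cdiff X (k + 1) ` carrier (cmod X (k + 1))"
    using assms(1) unfolding acyclic_complex_def by (rule spec)
  finally show ?thesis using that by blast
qed

lemma inv_not_representable:
  "\<not> representable (dual (A_cat :: ('u::universe) homotopy_cat)) (inv_H 0) (inv_h 0)"
proof
  interpret co: cocycle_functor "dual K_cat :: 'u homotopy_cat"
    "inv_cycles k" "inv_boundaries k" "\<lambda>X Y f. f k" for k
    by (rule inv_cocycle_functor)
  let ?P = "periodic_complex :: 'u ordinal \<Rightarrow> 'u chain_complex"
  have P: "?P i \<in> chain_complexes" for i by (rule periodic_complex_closed)
  assume "representable (dual (A_cat :: 'u homotopy_cat)) (inv_H 0) (inv_h 0)"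
  then obtain A c where A: "A \<in> Ob (dual (A_cat :: 'u homotopy_cat))" and c: "c \<in> carrier (inv_H 0 A)"
    and univ: "\<And>X x. \<lbrakk>X \<in> Ob (dual (A_cat :: 'u homotopy_cat)); x \<in> carrier (inv_H 0 X)\<rbrakk>
      \<Longrightarrow> \<exists>F\<in>carrier (Hom (dual A_cat) X A). inv_h 0 X A F c = x"
    using representable_universal_element[OF category_laws_dual[OF A_category_laws] inv_functor_A] by blast
  have Ac: "A \<in> chain_complexes" and acyclic: "acyclic_complex A" using A by simp_all
  obtain a where a: "a \<in> carrier (inv_cycles 0 A)" "c = co.cls 0 A a"
    using c co.carrier_H[of A 0] Ac by auto
  \<comment> \<open>The universal cycle bounds, but \<open>b\<close> need not be invariant.\<close>
  have "a \<in> carrier (cmod A 0)" "cdiff A 0 a = \<zero>\<^bsub>cmod A (0 - 1)\<^esub>"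
    using a(1) by (simp_all add: inv_cycles_def invariants_carrier)
  then obtain b where b: "b \<in> carrier (cmod A 1)" "a = cdiff A 1 b"
    using acyclic_complexE[OF acyclic] by (metis add_0)
  have "\<exists>g\<in>chain_maps A (?P i). g 0 a = dual_number 1 0" for i
  proof -
    have e: "(dual_number 1 0 :: 'u) \<in> carrier (inv_cycles 0 (?P i))"
      by (auto simp: inv_cycles_def invariants_def const_coeff_simps lin_coeff_simps)
    \<comment> \<open>The invariants of \<open>P\<^sub>i\<close> are the multiples of \<open>\<epsilon>\<close>, and the differential kills them.\<close>
    have bnd: "x = dual_number 0 0" if "x \<in> inv_boundaries 0 (?P i)" for x
      using that by (auto simp: inv_boundaries_def invariants_def const_coeff_simps lin_coeff_simps split: if_splits)
    have "co.cls 0 (?P i) (dual_number 1 0) \<in> carrier (inv_H 0 (?P i))"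
      using co.carrier_H[of "?P i" 0] P e by simp
    with univ[of "?P i"] obtain F where F: "F \<in> carrier (K_Hom A (?P i))" "inv_h 0 (?P i) A F c = co.cls 0 (?P i) (dual_number 1 0)"
      using periodic_complex_A[of i] by auto
    obtain g where g: "g \<in> chain_maps A (?P i)" "F = homotopy_class A (?P i) g" using K_HomE[OF Ac P F(1)] .
    have "co.cls 0 (?P i) (g 0 a) = co.cls 0 (?P i) (dual_number 1 0)"
      using co.h_cls[of "?P i" A F g a 0] F g a P Ac mem_homotopy_class_self[OF Ac P g(1)] by simp
    then have "g 0 a \<otimes>\<^bsub>inv_cycles 0 (?P i)\<^esub> inv\<^bsub>inv_cycles 0 (?P i)\<^esub> dual_number 1 0 \<in> inv_boundaries 0 (?P i)"
      using co.cls_eq_iff[of "?P i" "g 0 a" 0 "dual_number 1 0"] P e inv_cycles_chain_map(1)[OF Ac P g(1) a(1)] by simp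
    then have "g 0 a \<otimes>\<^bsub>inv_cycles 0 (?P i)\<^esub> inv\<^bsub>inv_cycles 0 (?P i)\<^esub> dual_number 1 0 = dual_number 0 0"
      by (rule bnd)
    also have "dual_number 0 0 = \<one>\<^bsub>inv_cycles 0 (?P i)\<^esub>" by (simp add: inv_cycles_def)
    finally have "g 0 a \<otimes>\<^bsub>inv_cycles 0 (?P i)\<^esub> inv\<^bsub>inv_cycles 0 (?P i)\<^esub> dual_number 1 0 = \<one>\<^bsub>inv_cycles 0 (?P i)\<^esub>" .
    moreover interpret Z: comm_group "inv_cycles 0 (?P i)" by (rule inv_cycles_comm_group[OF P])
    have "g 0 a \<otimes>\<^bsub>inv_cycles 0 (?P i)\<^esub> inv\<^bsub>inv_cycles 0 (?P i)\<^esub> dual_number 1 0 \<otimes>\<^bsub>inv_cycles 0 (?P i)\<^esub> dual_number 1 0 = g 0 a"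
      using e inv_cycles_chain_map(1)[OF Ac P g(1) a(1)] by (simp add: Z.m_assoc)
    ultimately have "g 0 a = dual_number 1 0" using Z.l_one[OF e] by simp
    with g(1) show ?thesis by blast
  qed
  then obtain g where g: "\<And>i. g i \<in> chain_maps A (?P i)" "\<And>i. g i 0 a = dual_number 1 0" by metis
  have smult: "var i \<odot>\<^bsub>cmod A 1\<^esub> b \<in> carrier (cmod A 1)" for i
    using small_module_smult[OF complexD(1)[OF Ac]] b(1) by blast
  obtain i j where ij: "i \<noteq> j" "var i \<odot>\<^bsub>cmod A 1\<^esub> b = var j \<odot>\<^bsub>cmod A 1\<^esub> b"
    using ordinals_not_small[OF small_moduleD(3)[OF complexD(1)[OF Ac]], of "\<lambda>i. var i \<odot>\<^bsub>cmod A 1\<^esub> b" 1] smult by blast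
  obtain x y where xy: "g i 1 b = dual_number x y" using chain_mapD(2)[OF g(1) b(1), of i] by auto
  have "dual_number 1 0 = dual_number y 0"
    using chain_mapD(3)[OF g(1) b(1), of i] g(2)[of i] by (simp add: b(2) xy)
  then have y: "y = 1" by simp
  have "g i 1 (var i \<odot>\<^bsub>cmod A 1\<^esub> b) = dual_number 1 0" "g i 1 (var j \<odot>\<^bsub>cmod A 1\<^esub> b) = dual_number 0 0"
    using module_homD(3)[OF chain_mapD(1)[OF g(1)] b(1), of i] ij(1) by (simp_all add: xy y const_coeff_simps lin_coeff_simps)
  with ij(2) show False by simp
qed

lemma func_not_representable:
  "\<not> representable (A_cat :: ('u::universe) homotopy_cat) (func_H 0) (func_h 0)"
proof
  interpret contra: cocycle_functor "K_cat :: 'u homotopy_cat"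
    "func_cocycles k" "func_coboundaries k" "func_pullback k" for k
    by (rule func_cocycle_functor)
  let ?P = "periodic_complex :: 'u ordinal \<Rightarrow> 'u chain_complex"
  have P: "?P i \<in> chain_complexes" for i by (rule periodic_complex_closed)
  assume "representable (A_cat :: 'u homotopy_cat) (func_H 0) (func_h 0)"
  then obtain A c where A: "A \<in> Ob (A_cat :: 'u homotopy_cat)" and c: "c \<in> carrier (func_H 0 A)"
    and univ: "\<And>X x. \<lbrakk>X \<in> Ob (A_cat :: 'u homotopy_cat); x \<in> carrier (func_H 0 X)\<rbrakk>
      \<Longrightarrow> \<exists>F\<in>carrier (Hom A_cat X A). func_h 0 X A F c = x"
    using representable_universal_element[OF A_category_laws func_functor_A] by blast
  have Ac: "A \<in> chain_complexes" and acyclic: "acyclic_complex A" using A by simp_all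
  obtain p where p: "p \<in> carrier (func_cocycles 0 A)" "c = contra.cls 0 A p"
    using c contra.carrier_H[of A 0] Ac by auto
  have "\<exists>g\<in>chain_maps (?P i) A. g 0 (dual_number 0 1) \<in> elts p" for i
  proof -
    \<comment> \<open>The coefficient of \<open>1\<close> is a functional because every variable maps \<open>F\<^sub>2[\<epsilon>]\<close> into the multiples of \<open>\<epsilon>\<close>.\<close>
    let ?u = "extent (dual_numbers i) (\<lambda>x. unit_coeff x = 1) :: 'u"
    have "extent (cmod (?P i) 0) (\<lambda>x. unit_coeff x = 1) \<in> carrier (func_cocycles 0 (?P i))"
      by (rule func_cocyclesI[OF P]) (auto simp: functional_def const_coeff_simps)
    then have u: "?u \<in> carrier (func_cocycles 0 (?P i))" by simp
    have "contra.cls 0 (?P i) ?u \<in> carrier (func_H 0 (?P i))"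
      using contra.carrier_H[of "?P i" 0] P u by simp
    with univ[of "?P i"] obtain F where F: "F \<in> carrier (K_Hom (?P i) A)" "func_h 0 (?P i) A F c = contra.cls 0 (?P i) ?u"
      using periodic_complex_A[of i] by auto
    obtain g where g: "g \<in> chain_maps (?P i) A" "F = homotopy_class (?P i) A g" using K_HomE[OF P Ac F(1)] .
    let ?q = "func_pullback 0 (?P i) A g p"
    have "contra.cls 0 (?P i) ?q = contra.cls 0 (?P i) ?u"
      using contra.h_cls[of "?P i" A F g p 0] F g p P Ac mem_homotopy_class_self[OF P Ac g(1)] by simp
    then have "?q \<otimes>\<^bsub>func_cocycles 0 (?P i)\<^esub> inv\<^bsub>func_cocycles 0 (?P i)\<^esub> ?u \<in> func_coboundaries 0 (?P i)"
      using contra.cls_eq_iff[of "?P i" ?q 0 ?u] P u func_pullback_chain_map(1)[OF P Ac g(1) p(1)] by simp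
    then have "extent (cmod (?P i) 0) (\<lambda>x. x \<in> elts ?q \<longleftrightarrow> x \<notin> elts ?u) \<in> func_coboundaries 0 (?P i)"
      unfolding func_inverse[OF P u] by (simp add: func_cocycles_ops)
    then obtain Q where Q: "functional (cmod (?P i) (0 - 1)) Q"
      "\<And>x. x \<in> carrier (cmod (?P i) 0) \<Longrightarrow> (x \<in> elts ?q \<longleftrightarrow> x \<notin> elts ?u) \<longleftrightarrow> Q (cdiff (?P i) 0 x)"
      by (rule func_coboundariesE[OF P]) (rule that)
    \<comment> \<open>A functional vanishes on \<open>\<epsilon> = X\<^sub>i 1\<close>, so a coboundary vanishes on \<open>1\<close>.\<close>
    have "dual_number 0 1 \<in> carrier (cmod (?P i) (0 - 1))" by auto
    then have "\<not> Q (var i \<odot>\<^bsub>cmod (?P i) (0 - 1)\<^esub> dual_number 0 1)" using Q(1) unfolding functional_def by blast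
    then have "\<not> Q (dual_number 1 0)" by (simp add: const_coeff_simps lin_coeff_simps)
    then have "dual_number 0 1 \<in> elts ?q \<longleftrightarrow> (dual_number 0 1 :: 'u) \<in> elts ?u"
      using Q(2)[of "dual_number 0 1"] by auto
    then have "g 0 (dual_number 0 1) \<in> elts p"
      by (simp add: func_pullback_def elts_extent[OF dual_numbers_module])
    with g(1) show ?thesis by blast
  qed
  then obtain g where g: "\<And>i. g i \<in> chain_maps (?P i) A" "\<And>i. g i 0 (dual_number 0 1) \<in> elts p" by metis
  let ?a = "\<lambda>i. g i 0 (dual_number 0 1)" and ?b = "\<lambda>i. g i (- 1) (dual_number 0 1)"
  have one: "dual_number 0 1 \<in> carrier (cmod (?P i) k)" for i k by auto
  have "small {vpair x y | x y. x \<in> carrier (cmod A 0) \<and> y \<in> carrier (cmod A (- 1))}"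
    by (intro small_vpairs small_moduleD(3) complexD(1)[OF Ac])
  moreover have "range (\<lambda>i. vpair (?a i) (?b i)) \<subseteq> {vpair x y | x y. x \<in> carrier (cmod A 0) \<and> y \<in> carrier (cmod A (- 1))}"
    using chain_mapD(2)[OF g(1) one] by blast
  ultimately obtain i j where "i \<noteq> j" "vpair (?a i) (?b i) = vpair (?a j) (?b j)"
    by (rule ordinals_not_small)
  then have ij: "i \<noteq> j" "?a i = ?a j" "?b i = ?b j" by simp_all
  have act: "var l \<odot>\<^bsub>cmod A (- 1)\<^esub> ?b k = g k (- 1) (if k = l then dual_number 1 0 else dual_number 0 0)" for k l
    using module_homD(3)[OF chain_mapD(1)[OF g(1)] one, of k "- 1" "var l"]
    by (simp add: const_coeff_simps lin_coeff_simps split: if_splits)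
  have "cdiff A 0 (?a i) = g i (- 1) (dual_number 1 0)"
    using chain_mapD(3)[where k = 0, OF g(1)[of i] one] by simp
  also have "\<dots> = var i \<odot>\<^bsub>cmod A (- 1)\<^esub> ?b i" by (simp add: act)
  also have "\<dots> = g j (- 1) (dual_number 0 0)" using ij act[of i j] by simp
  also have "\<dots> = \<zero>\<^bsub>cmod A (- 1)\<^esub>"
    using module_hom_zero[OF complexD(1)[OF P] complexD(1)[OF Ac] chain_mapD(1)[where k = "- 1", OF g(1)[of j]]] by simp
  finally have "cdiff A 0 (?a i) = \<zero>\<^bsub>cmod A (0 - 1)\<^esub>" by simp
  then obtain x where x: "x \<in> carrier (cmod A (0 + 1))" "?a i = cdiff A (0 + 1) x"
    using acyclic_complexE[OF acyclic chain_mapD(2)[OF g(1) one]] by metis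
  then show False using func_cocyclesD(3)[OF p(1) x(1)] g(2)[of i] by simp
qed

theorem corollary1p4:
  shows "\<not> Brown_representability TYPE('u::universe) (A_cat :: ('u chain_complex, 'u hclass) tricat) \<and>
         \<not> Brown_representability TYPE('u) (dual (A_cat :: ('u chain_complex, 'u hclass) tricat))"
proof (intro conjI notI)
  assume "Brown_representability TYPE('u) (A_cat :: 'u homotopy_cat)"
  then have "representable (A_cat :: 'u homotopy_cat) (func_H 0) (func_h 0)"
    unfolding Brown_representability_def using func_functor_A func_homological_A func_coproducts by blast
  then show False using func_not_representable by blast
next
  assume "Brown_representability TYPE('u) (dual (A_cat :: 'u homotopy_cat))"
  then have "representable (dual (A_cat :: 'u homotopy_cat)) (inv_H 0) (inv_h 0)"
    unfolding Brown_representability_def using inv_functor_A inv_homological_A inv_products by blast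
  then show False using inv_not_representable by blast
qed

end
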